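(* Let $k$ be a perfect field of characteristic $p>0$, let $R=k[x_1,\dots,x_n]$, and let $I=(f_1,\dots,f_s)\subseteq R$ be a (nonzero, proper) equi-dimensional and unmixed ideal of height $c$. Let $S=R[u_{ij}]_{1\le i\le c,\,1\le j\le s}$ be a polynomial ring over $R$, let $g_i=u_{i1}f_1+\cdots+u_{is}f_s$ for $1\le i\le c$, and let $J=(g_1,\dots,g_c):_S IS$ be the generic link of $I$ in $S$. Then: (1) If $I$ has a reduction generated by $r$ elements, then $\mathrm{fpt}_S(J)\ge\frac{c}{r}\,\mathrm{fpt}_R(I)$. (2) If $I$ has a reduction generated by $c$ elements, in particular if $I$ is a complete intersection, then $\mathrm{fpt}_S(J)\ge\mathrm{fpt}_R(I)$. (3) $\mathrm{fpt}_S(J)\ge\frac{c}{n}\,\mathrm{fpt}_R(I)$ (note $n=\dim R$).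
   Context: Equi-dimensional and unmixed means that all associated primes of $I$ have the same height. A reduction of $I$ is an ideal $K\subseteq I$ with $KI^m=I^{m+1}$ for some $m\ge0$. $F^e_*A$ denotes the ring $A$ regarded as an $A$-module via the $e$-th Frobenius $a\mapsto a^{p^e}$. For an $F$-finite Noetherian local domain $A$ of characteristic $p$, an ideal $\mathfrak a$ and real $t\ge 0$, the pair $(A,\mathfrak a^t)$ is $F$-pure if for all large $e\gg0$ there is $d\in\mathfrak a^{\lfloor t(p^e-1)\rfloor}$ such that the $A$-linear map $A\to F^e_*A$, $1\mapsto F^e_*d$, splits. For a non-local ring, the pair is $F$-pure if it is so after localizing at every maximal ideal. The $F$-pure threshold is $\mathrm{fpt}_A(\mathfrak a)=\sup\{s\in\mathbb{R}_{\ge0}: (A,\mathfrak a^s)\text{ is }F\text{-pure}\}$. For $A$ a polynomial ring over a perfect field this equals $\sup\{s:\tau(\mathfrak a^s)=A\}$, where $\tau(\mathfrak a^s)$ is the test ideal, i.e. the smallest nonzero ideal $\mathfrak b$ with $\phi(F^e_*(\mathfrak a^{\lceil s(p^e-1)\rceil}\mathfrak b))\subseteq\mathfrak b$ for all $e>0$ and $\phi\in\mathrm{Hom}_A(F^e_*A,A)$. *)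

theory Defs
  imports
    Complex_Main
    "HOL-Library.Poly_Mapping"
    "HOL-Library.Cardinality"
    "HOL-Library.Product_Lexorder"
    "HOL-Library.Extended_Nat"
    "HOL-Library.Extended_Real"
    "HOL-Computational_Algebra.Fraction_Field"
    "HOL-Algebra.Ideal_Product"
    "HOL-Algebra.Module"
    "HOL-Decision_Procs.Algebra_Aux"
begin

text \<open>
  A ring given by a type class is turned into a record of HOL-Algebra by
  \<^const>\<open>cring_class_ops\<close>, whose carrier is the whole type.
\<close>


section \<open>Fields and polynomial rings\<close>

definition perfect_field :: "'k::field itself \<Rightarrow> bool" where
  "perfect_field _ \<longleftrightarrow> CHAR('k) = 0 \<or> surj (\<lambda>x::'k. x ^ CHAR('k))"

text \<open>
  Polynomials with variables indexed by \<open>'v\<close> and coefficients in \<open>'a\<close>: exponent vectors are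
  finitely supported maps \<open>'v \<Rightarrow>\<^sub>0 nat\<close>, and the library's product on \<^typ>\<open>'m \<Rightarrow>\<^sub>0 'a\<close> is convolution.
  The instance showing that this is an integral domain needs a linear order on \<open>'v\<close>.
\<close>

type_synonym ('v, 'a) mpoly = "('v \<Rightarrow>\<^sub>0 nat) \<Rightarrow>\<^sub>0 'a"

definition mvar :: "'v \<Rightarrow> ('v, 'a::comm_ring_1) mpoly" where
  "mvar v = Poly_Mapping.single (Poly_Mapping.single v 1) 1"

definition mconst :: "'a \<Rightarrow> ('v, 'a::comm_ring_1) mpoly" where
  "mconst a = Poly_Mapping.single 0 a"


section \<open>Ideals\<close>

abbreviation ideal_power :: "('a, 'b) ring_scheme \<Rightarrow> 'a set \<Rightarrow> nat \<Rightarrow> 'a set" where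
  "ideal_power R I m \<equiv> I [^]\<^bsub>ideals_set R\<^esub> m"

definition colon_ideal :: "('a, 'b) ring_scheme \<Rightarrow> 'a set \<Rightarrow> 'a set \<Rightarrow> 'a set" where
  "colon_ideal R I X = {a \<in> carrier R. \<forall>x\<in>X. a \<otimes>\<^bsub>R\<^esub> x \<in> I}"

definition generated_by_elements :: "('a, 'b) ring_scheme \<Rightarrow> 'a set \<Rightarrow> nat \<Rightarrow> bool" where
  "generated_by_elements R I r \<longleftrightarrow>
     (\<exists>hs. length hs = r \<and> set hs \<subseteq> carrier R \<and> I = Idl\<^bsub>R\<^esub> (set hs))"

definition prime_height :: "('a, 'b) ring_scheme \<Rightarrow> 'a set \<Rightarrow> enat" where
  "prime_height R P = Sup {enat n | n. \<exists>C. (\<forall>i\<le>n. primeideal (C i) R) \<and>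
     (\<forall>i<n. C i \<subset> C (Suc i)) \<and> C n = P}"

definition height :: "('a, 'b) ring_scheme \<Rightarrow> 'a set \<Rightarrow> enat" where
  "height R I = Inf {prime_height R P | P. primeideal P R \<and> I \<subseteq> P}"

text \<open>The associated primes of the module \<open>R / I\<close>.\<close>

definition associated_primes :: "('a, 'b) ring_scheme \<Rightarrow> 'a set \<Rightarrow> 'a set set" where
  "associated_primes R I = {P. primeideal P R \<and> (\<exists>x\<in>carrier R. P = colon_ideal R I {x})}"

definition equidimensional_unmixed :: "('a, 'b) ring_scheme \<Rightarrow> 'a set \<Rightarrow> bool" where
  "equidimensional_unmixed R I \<longleftrightarrow>
     (\<forall>P\<in>associated_primes R I. \<forall>Q\<in>associated_primes R I. prime_height R P = prime_height R Q)"

definition reduction :: "('a, 'b) ring_scheme \<Rightarrow> 'a set \<Rightarrow> 'a set \<Rightarrow> bool" where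
  "reduction R K I \<longleftrightarrow> ideal K R \<and> K \<subseteq> I \<and>
     (\<exists>m. K \<cdot>\<^bsub>R\<^esub> ideal_power R I m = ideal_power R I (Suc m))"

definition complete_intersection :: "('a, 'b) ring_scheme \<Rightarrow> 'a set \<Rightarrow> bool" where
  "complete_intersection R I \<longleftrightarrow> (\<exists>c. height R I = enat c \<and> generated_by_elements R I c)"


section \<open>F-purity of pairs and the F-pure threshold\<close>

text \<open>\<open>F\<^sup>e\<^sub>*A\<close>: the ring \<open>A\<close> with scalars acting through the \<open>e\<close>-th Frobenius.\<close>

definition frobenius_pushforward :: "nat \<Rightarrow> nat \<Rightarrow> ('a, 'b) ring_scheme \<Rightarrow> ('a, 'a) module" where
  "frobenius_pushforward p e A =
     \<lparr>carrier = carrier A, mult = mult A, one = \<one>\<^bsub>A\<^esub>, zero = \<zero>\<^bsub>A\<^esub>, add = add A,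
      smult = (\<lambda>a x. (a [^]\<^bsub>A\<^esub> (p ^ e)) \<otimes>\<^bsub>A\<^esub> x)\<rparr>"

text \<open>\<open>Hom\<^sub>A(M, A)\<close>, up to the values outside the carrier of \<open>M\<close>.\<close>

definition linear_functionals :: "('a, 'b) ring_scheme \<Rightarrow> ('a, 'm, 'c) module_scheme \<Rightarrow> ('m \<Rightarrow> 'a) set" where
  "linear_functionals A M = {\<phi>. (\<forall>x\<in>carrier M. \<phi> x \<in> carrier A) \<and>
     (\<forall>x\<in>carrier M. \<forall>y\<in>carrier M. \<phi> (x \<oplus>\<^bsub>M\<^esub> y) = \<phi> x \<oplus>\<^bsub>A\<^esub> \<phi> y) \<and>
     (\<forall>a\<in>carrier A. \<forall>x\<in>carrier M. \<phi> (a \<odot>\<^bsub>M\<^esub> x) = a \<otimes>\<^bsub>A\<^esub> \<phi> x)}"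

text \<open>The \<open>A\<close>-linear map \<open>A \<rightarrow> M\<close>, \<open>1 \<mapsto> d\<close>, that is \<open>a \<mapsto> a \<odot> d\<close>, has a linear left inverse.\<close>

definition splits_at :: "('a, 'b) ring_scheme \<Rightarrow> ('a, 'm, 'c) module_scheme \<Rightarrow> 'm \<Rightarrow> bool" where
  "splits_at A M d \<longleftrightarrow> (\<exists>\<phi>\<in>linear_functionals A M. \<forall>a\<in>carrier A. \<phi> (a \<odot>\<^bsub>M\<^esub> d) = a)"

text \<open>F-purity of \<open>(A, \<aa>\<^sup>t)\<close> for a local domain \<open>A\<close> of characteristic \<open>p\<close> and \<open>t \<ge> 0\<close>.\<close>

definition F_pure_local :: "nat \<Rightarrow> ('a, 'b) ring_scheme \<Rightarrow> 'a set \<Rightarrow> real \<Rightarrow> bool" where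
  "F_pure_local p A \<aa> t \<longleftrightarrow>
     (\<forall>\<^sub>F e in sequentially. \<exists>d\<in>ideal_power A \<aa> (nat \<lfloor>t * (real p ^ e - 1)\<rfloor>).
        splits_at A (frobenius_pushforward p e A) d)"

text \<open>
  The localization of a domain at a prime \<open>P\<close> is realized inside the field of fractions. The
  condition \<open>b \<notin> P\<close> entails \<open>b \<noteq> 0\<close>.
\<close>

definition localization :: "'a::idom set \<Rightarrow> 'a fract ring" where
  "localization P = cring_class_ops\<lparr>carrier := {Fract a b | a b. b \<notin> P}\<rparr>"

definition localized_ideal :: "'a::idom set \<Rightarrow> 'a set \<Rightarrow> 'a fract set" where
  "localized_ideal P \<aa> = Idl\<^bsub>localization P\<^esub> ((\<lambda>a. Fract a 1) ` \<aa>)"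

definition F_pure :: "nat \<Rightarrow> 'a::idom set \<Rightarrow> real \<Rightarrow> bool" where
  "F_pure p \<aa> t \<longleftrightarrow> (\<forall>M. maximalideal M (cring_class_ops :: 'a ring) \<longrightarrow>
     F_pure_local p (localization M) (localized_ideal M \<aa>) t)"

text \<open>The supremum is taken in the extended reals, so that it is meaningful without a boundedness proof.\<close>

definition fpt :: "nat \<Rightarrow> 'a::idom set \<Rightarrow> ereal" where
  "fpt p \<aa> = Sup {ereal s | s. 0 \<le> s \<and> F_pure p \<aa> s}"


section \<open>The generic link\<close>

text \<open>
  For \<open>f\<^sub>1, \<dots>, f\<^sub>s\<close> in \<open>R\<close>, the ring \<open>S = R[u\<^sub>i\<^sub>j]\<close> has its variables indexed by \<^typ>\<open>'c \<times> 's\<close> and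
  coefficients in \<open>R\<close>; the number \<open>c\<close> of the elements \<open>g\<^sub>i\<close> is the cardinality of \<open>'c\<close>.
\<close>

definition generic_combination ::
    "('s::finite \<Rightarrow> 'a::comm_ring_1) \<Rightarrow> 'c \<Rightarrow> ('c \<times> 's, 'a) mpoly" where
  "generic_combination f i = (\<Sum>j\<in>UNIV. mvar (i, j) * mconst (f j))"

definition generic_link :: "('s::finite \<Rightarrow> 'a::comm_ring_1) \<Rightarrow> ('c \<times> 's, 'a) mpoly set" where
  "generic_link f =
     (let R = cring_class_ops; S = cring_class_ops;
          I = Idl\<^bsub>R\<^esub> (range f);
          IS = Idl\<^bsub>S\<^esub> (mconst ` I)
      in colon_ideal S (Idl\<^bsub>S\<^esub> (range (generic_combination f))) IS)"

end

theory Submission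
  imports Defs
    "HOL-Algebra.Subrings"
    "HOL-Computational_Algebra.Primes"
    "HOL-Computational_Algebra.Polynomial"
begin

text \<open>The proof works in \<open>S\<close> only with products of the \<open>g\<^sub>i\<close>, which lie in the link. For a monomial \<open>u\<^sup>\<beta>\<close> with
  exponents below \<open>q = p\<^sup>e\<close>, every \<open>q\<close>-linear functional \<open>\<phi>\<close> on \<open>R\<close> extends to one on \<open>S\<close> that applies \<open>\<phi>\<close> to the
  coefficient of \<open>u\<^sup>\<beta>\<close>; so F-purity along \<open>J\<close> at a prime of \<open>S\<close> follows once some coefficient of the product
  is not killed by the functionals on \<open>R\<close>. If the base-\<open>p\<close> digits of the exponents of the \<open>g\<^sub>i\<close> sum up level by
  level, multinomial coefficients do not vanish modulo \<open>p\<close>, and the coefficients are products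
  \<open>\<Prod>f\<^sub>j ^ p ^ k\<close> in which every level \<open>k\<close> occurs at most \<open>c (p - 1)\<close> times. When \<open>I\<close> has a reduction with
  \<open>r\<close> generators, a power of \<open>I\<close> that splits contains such a product with at most \<open>r (p - 1)\<close> factors per
  level and nearly the same degree; keeping a fraction \<open>c / r\<close> of each level gives the bound. For \<open>r = n\<close> the
  reduction exists modulo a power of a nonzero element \<open>y \<in> I\<close>, because \<open>n + 1\<close> elements and \<open>y\<close> satisfy a
  homogeneous relation, by counting monomials. That \<open>c \<le> r\<close> is Krull's height theorem, which is obtained by
  counting generators of the ring over its \<open>q\<close>-th powers.\<close>

section \<open>Ideals of a commutative ring\<close>

text \<open>The obstacle is characteristic p: most multinomial coefficients vanish, so large powers
  of the g_i cannot be expanded directly. If each row i and level k carries at most p - 1 factors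
  g_i ^ p ^ k, no carries occur in base p. Then c rows have capacity c (p - 1) per level, against r
  (p - 1) for the generators of a reduction, and c / r is the quotient of these capacities. The
  losses (exponent m of the reduction, rounding) are bounded independently of e and vanish against
  q. At a prime of S whose contraction does not contain I the exponent c is reached instead, which
  suffices since fpt(I) \<le> r. The height bound compares counts over q-th powers: modulo the
  Frobenius power of a prime, q^n generators are necessary; modulo a prime of height c, a constant
  times q^(n-c) suffice; dropping r generators costs a factor q^r. For r = n the homogeneous
  relation is made integral by a linear change of generators. Its coefficients must avoid the roots
  of a polynomial, which requires infinitely many constants and forces the passage from k to
  k[T].\<close>

interpretation idl: Modules.module "(*) :: 'a::comm_ring_1 \<Rightarrow> 'a \<Rightarrow> 'a"
  by unfold_locales (simp_all add: algebra_simps)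

declare idl.scale_scale [simp del] \<comment> \<open>loops with \<open>mult.assoc\<close>\<close>

text \<open>Counterpart of \<open>primeideal\<close> on a whole type. The ring is a module over
  itself, so \<open>idl.subspace\<close> means ideal and \<open>idl.span\<close> the generated
  ideal; the module library then replaces records.\<close>

definition prime_id :: "'a::comm_ring_1 set \<Rightarrow> bool" where
  "prime_id P \<longleftrightarrow> idl.subspace P \<and> 1 \<notin> P \<and> (\<forall>a b. a * b \<in> P \<longrightarrow> a \<in> P \<or> b \<in> P)"

lemma subspace_mult_right: "idl.subspace P \<Longrightarrow> a \<in> P \<Longrightarrow> a * b \<in> P"
  by (metis idl.subspace_scale mult.commute)

lemma subspace_power: "idl.subspace P \<Longrightarrow> a \<in> P \<Longrightarrow> n > 0 \<Longrightarrow> a ^ n \<in> P"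
  by (cases n) (auto intro: subspace_mult_right)

lemma ideal_class_iff: "ideal I (cring_class_ops :: 'a::comm_ring_1 ring) \<longleftrightarrow> idl.subspace I"
proof
  assume "ideal I (cring_class_ops :: 'a ring)"
  then interpret ideal I "cring_class_ops :: 'a ring" .
  show "idl.subspace I"
    using zero_closed a_closed I_l_closed
    by (auto simp: idl.subspace_def class_simps)
next
  assume I: "idl.subspace I"
  show "ideal I (cring_class_ops :: 'a ring)"
  proof (rule idealI)
    show "ring (cring_class_ops :: 'a ring)" ..
    show "subgroup I (add_monoid (cring_class_ops :: 'a ring))"
    proof (rule group.subgroupI[OF abelian_group.a_group])
      show "abelian_group (cring_class_ops :: 'a ring)" ..
      show "I \<noteq> {}" using idl.subspace_0[OF I] by auto
      fix a assume "a \<in> I"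
      then show "inv\<^bsub>add_monoid (cring_class_ops :: 'a ring)\<^esub> a \<in> I"
        using idl.subspace_neg[OF I] uminus_class[of a] unfolding a_inv_def by simp
    qed (use idl.subspace_add[OF I] in \<open>auto simp: cring_class_ops_def\<close>)
  qed (use idl.subspace_scale[OF I] subspace_mult_right[OF I] in \<open>auto simp: class_simps\<close>)
qed

lemma primeideal_class_iff: "primeideal P (cring_class_ops :: 'a::comm_ring_1 ring) \<longleftrightarrow> prime_id P"
proof
  assume "primeideal P (cring_class_ops :: 'a ring)"
  then interpret primeideal P "cring_class_ops :: 'a ring" .
  have "idl.subspace P" using is_ideal by (simp add: ideal_class_iff)
  moreover have "1 \<notin> P" using I_notcarr one_imp_carrier by (auto simp: class_simps)
  ultimately show "prime_id P" using I_prime by (auto simp: prime_id_def class_simps)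
next
  assume P: "prime_id P"
  then have "ideal P (cring_class_ops :: 'a ring)" by (simp add: prime_id_def ideal_class_iff)
  then show "primeideal P (cring_class_ops :: 'a ring)"
  proof (rule primeidealI)
    show "cring (cring_class_ops :: 'a ring)" by (rule cring_class)
    show "carrier (cring_class_ops :: 'a ring) \<noteq> P"
      using P by (auto simp: prime_id_def cring_class_ops_def)
  qed (use P in \<open>auto simp: prime_id_def class_simps\<close>)
qed

lemma maximalideal_class_prime:
  "maximalideal M (cring_class_ops :: 'a::comm_ring_1 ring) \<Longrightarrow> prime_id M"
  using cring.maximalideal_prime[OF cring_class] primeideal_class_iff by blast

lemma genideal_class: "Idl\<^bsub>cring_class_ops\<^esub> S = idl.span (S :: 'a::comm_ring_1 set)"
  by (simp add: genideal_def ideal_class_iff idl.span_def hull_def)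

lemma subspace_chain_Union:
  fixes \<C> :: "'a::comm_ring_1 set set"
  assumes C: "\<C> \<noteq> {}" "subset.chain \<A> \<C>" "\<And>X. X \<in> \<C> \<Longrightarrow> idl.subspace X"
  shows "idl.subspace (\<Union>\<C>)"
proof (unfold idl.subspace_def, intro conjI ballI allI)
  obtain X where "X \<in> \<C>" using C(1) by blast
  with idl.subspace_0[OF C(3)] show "0 \<in> \<Union>\<C>" by blast
  fix x assume "x \<in> \<Union>\<C>"
  then obtain X where X: "x \<in> X" "X \<in> \<C>" by blast
  show "c * x \<in> \<Union>\<C>" for c using idl.subspace_scale[OF C(3) X(1)] X(2) by blast
  fix y assume "y \<in> \<Union>\<C>"
  then obtain Y where Y: "y \<in> Y" "Y \<in> \<C>" by blast
  have "X \<subseteq> Y \<or> Y \<subseteq> X" using C(2) X(2) Y(2) by (auto simp: subset_chain_def)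
  then show "x + y \<in> \<Union>\<C>"
    using idl.subspace_add[OF C(3)[OF X(2)]] idl.subspace_add[OF C(3)[OF Y(2)]] X Y by blast
qed

text \<open>Zorn's lemma applies because properness is the absence of 1, which passes to unions of
  chains.\<close>

lemma prime_id_subset_maximal:
  assumes "idl.subspace (I :: 'a::comm_ring_1 set)" "1 \<notin> I"
  obtains M where "maximalideal M (cring_class_ops :: 'a ring)" "I \<subseteq> M"
proof -
  define \<A> where "\<A> = {M. idl.subspace M \<and> 1 \<notin> M \<and> I \<subseteq> M}"
  have "\<exists>M\<in>\<A>. \<forall>X\<in>\<A>. M \<subseteq> X \<longrightarrow> X = M"
  proof (rule subset_Zorn_nonempty)
    show "\<A> \<noteq> {}" using assms by (auto simp: \<A>_def)
    fix \<C> assume C: "\<C> \<noteq> {}" "subset.chain \<A> \<C>"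
    then have sub: "\<C> \<subseteq> \<A>" by (simp add: subset_chain_def)
    have "idl.subspace (\<Union>\<C>)"
      by (rule subspace_chain_Union[OF C]) (use sub in \<open>auto simp: \<A>_def\<close>)
    with sub C(1) show "\<Union>\<C> \<in> \<A>" by (auto simp: \<A>_def)
  qed
  then obtain M where M: "M \<in> \<A>" and max: "\<And>X. X \<in> \<A> \<Longrightarrow> M \<subseteq> X \<Longrightarrow> X = M" by blast
  have "maximalideal M (cring_class_ops :: 'a ring)"
  proof (rule maximalidealI)
    show "ideal M (cring_class_ops :: 'a ring)" using M by (simp add: ideal_class_iff \<A>_def)
    show "carrier (cring_class_ops :: 'a ring) \<noteq> M"
      using M by (auto simp: \<A>_def cring_class_ops_def)
    fix J assume J: "ideal J (cring_class_ops :: 'a ring)" "M \<subseteq> J"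
    have "J \<in> \<A>" if "1 \<notin> J"
      using that J M by (auto simp: \<A>_def ideal_class_iff)
    moreover have "J = UNIV" if "1 \<in> J"
      using idl.subspace_scale[of J 1] that J by (auto simp: ideal_class_iff)
    ultimately show "J = M \<or> J = carrier (cring_class_ops :: 'a ring)"
      using max J(2) by (auto simp: cring_class_ops_def)
  qed
  then show ?thesis using that M by (auto simp: \<A>_def)
qed

section \<open>Products of elements and powers of ideals\<close>

text \<open>Products of exactly \<open>n\<close> factors are kept apart from the ideals they span,
  so that degrees can be split and single factors exhibited.\<close>

primrec mons :: "'a::comm_ring_1 set \<Rightarrow> nat \<Rightarrow> 'a set" where
  "mons F 0 = {1}"
| "mons F (Suc n) = {a * b | a b. a \<in> F \<and> b \<in> mons F n}"

lemma mons_mult: "a \<in> mons F m \<Longrightarrow> b \<in> mons F n \<Longrightarrow> a * b \<in> mons F (m + n)"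
proof (induction m arbitrary: a)
  case (Suc m)
  then obtain x y where "a = x * y" "x \<in> F" "y \<in> mons F m" by auto
  with Suc.IH[of y] Suc.prems(2) have "x * (y * b) \<in> mons F (Suc (m + n))"
    unfolding mons.simps by blast
  with \<open>a = x * y\<close> show ?case by (simp only: mult.assoc add_Suc)
qed simp

lemma mons_mono: "F \<subseteq> G \<Longrightarrow> mons F n \<subseteq> mons G n"
  by (induction n) (simp, simp only: mons.simps, blast)

lemma mons_base: "a \<in> F \<Longrightarrow> a \<in> mons F 1"
  by auto

lemma mons_power: "a \<in> F \<Longrightarrow> a ^ n \<in> mons F n"
  by (induction n) auto

lemma mons_prod: "finite A \<Longrightarrow> (\<And>i. i \<in> A \<Longrightarrow> f i \<in> mons F (n i)) \<Longrightarrow> prod f A \<in> mons F (sum n A)"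
  by (induction A rule: finite_induct) (auto intro: mons_mult)

lemma mons_split: "x \<in> mons F (m + n) \<Longrightarrow> \<exists>a\<in>mons F m. \<exists>b\<in>mons F n. x = a * b"
proof (induction m arbitrary: x)
  case (Suc m)
  then obtain a b where "x = a * b" "a \<in> F" "b \<in> mons F (m + n)" by auto
  with Suc.IH[of b] obtain c d where "c \<in> mons F m" "d \<in> mons F n" "b = c * d" by blast
  have "a * c \<in> mons F (Suc m)"
    unfolding mons.simps using \<open>a \<in> F\<close> \<open>c \<in> mons F m\<close> by blast
  moreover have "x = (a * c) * d"
    using \<open>x = a * b\<close> \<open>b = c * d\<close> by (simp only: mult.assoc)
  ultimately show ?case using \<open>d \<in> mons F n\<close> by blast
qed auto

text \<open>Bilinearity reduces a statement about products of ideals to their generators; the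
  arbitrary target \<open>U\<close> lets it serve all later degree bookkeeping.\<close>

lemma span_times:
  assumes "a \<in> idl.span S" "b \<in> idl.span T" "\<And>s t. s \<in> S \<Longrightarrow> t \<in> T \<Longrightarrow> s * t \<in> idl.span U"
  shows "a * b \<in> idl.span U"
proof -
  have "s * b \<in> idl.span U" if "s \<in> S" for s
    using assms(2)
  proof (induction rule: idl.span_induct_alt)
    case (step c x y)
    then show ?case using assms(3)[OF that]
      by (metis (no_types, opaque_lifting) distrib_left idl.span_add idl.span_scale mult.left_commute)
  qed (simp add: idl.span_zero)
  with assms(1) show ?thesis
  proof (induction rule: idl.span_induct_alt)
    case (step c x y)
    then show ?case
      by (metis (no_types, opaque_lifting) distrib_right idl.span_add idl.span_scale mult.assoc)
  qed (simp add: idl.span_zero)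
qed

lemma mons_span: "x \<in> mons (idl.span F) n \<Longrightarrow> x \<in> idl.span (mons F n)"
proof (induction n arbitrary: x)
  case (Suc n)
  then obtain a b where x: "x = a * b" "a \<in> idl.span F" "b \<in> mons (idl.span F) n" by auto
  show ?case unfolding x(1)
    by (rule span_times[OF x(2) Suc.IH[OF x(3)]]) (auto intro: idl.span_base)
qed (simp add: idl.span_base)

lemma span_mons_span: "idl.span (mons (idl.span F) n) = idl.span (mons F n)"
  by (intro subset_antisym idl.span_minimal)
    (auto intro: mons_span idl.span_base set_mp[OF mons_mono] idl.span_superset)

lemma ideal_power_0: "ideal_power R I 0 = carrier R"
  by (simp add: nat_pow_def ideals_set_def)

lemma ideal_power_Suc: "ideal_power R I (Suc n) = ideal_power R I n \<cdot>\<^bsub>R\<^esub> I"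
  by (simp add: nat_pow_def ideals_set_def)

lemma ideal_prod_class:
  assumes "idl.subspace I" "idl.subspace J"
  shows "I \<cdot>\<^bsub>cring_class_ops\<^esub> J = idl.span {a * b | a b. a \<in> I \<and> b \<in> J}" (is "?L = ?R")
proof
  show "?L \<subseteq> ?R"
  proof
    fix x assume "x \<in> ?L"
    then show "x \<in> ?R"
      by (induction rule: ideal_prod.induct) (auto simp: class_simps intro: idl.span_base idl.span_add)
  qed
  have "idl.subspace ?L"
    using ring.ideal_prod_is_ideal[OF cring.axioms(1)[OF cring_class]] assms
    by (metis ideal_class_iff)
  moreover have "{a * b | a b. a \<in> I \<and> b \<in> J} \<subseteq> ?L"
    using ideal_prod.prod[of _ I _ J cring_class_ops] by (auto simp: class_simps)
  ultimately show "?R \<subseteq> ?L" by (rule idl.span_minimal[rotated])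
qed

text \<open>Links powers in the monoid \<open>ideals_set\<close> with spans of products. The zeroth
  power there is the whole ring, in agreement with the span of 1.\<close>

lemma ideal_power_class:
  assumes "idl.subspace I"
  shows "ideal_power cring_class_ops I n = idl.span (mons I n)"
proof (induction n)
  case 0
  have "idl.span {1} = (UNIV :: 'a set)"
    using idl.span_scale[OF idl.span_base[of 1 "{1}"]] by auto
  then show ?case by (simp only: ideal_power_0 mons.simps) (simp add: cring_class_ops_def)
next
  case (Suc n)
  have "idl.span {a * b | a b. a \<in> idl.span (mons I n) \<and> b \<in> I} = idl.span (mons I (Suc n))"
    (is "?L = ?R")
  proof
    have "s * t \<in> idl.span (mons I (Suc n))" if "s \<in> mons I n" "t \<in> I" for s t
    proof (rule idl.span_base)
      have "s * t = t * s" by (rule mult.commute)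
      with that show "s * t \<in> mons I (Suc n)" unfolding mons.simps by blast
    qed
    then have "a * b \<in> ?R" if "a \<in> idl.span (mons I n)" "b \<in> I" for a b
      using that(1) idl.span_base[OF that(2)] by (rule span_times[rotated 2])
    then show "?L \<subseteq> ?R" by (intro idl.span_minimal) auto
    show "?R \<subseteq> ?L"
    proof (rule idl.span_mono, rule subsetI)
      fix x assume "x \<in> mons I (Suc n)"
      then obtain t s where "x = t * s" "t \<in> I" "s \<in> mons I n" unfolding mons.simps by blast
      then have "x = s * t" "s \<in> idl.span (mons I n)" by (simp_all add: mult.commute idl.span_base)
      with \<open>t \<in> I\<close> show "x \<in> {a * b | a b. a \<in> idl.span (mons I n) \<and> b \<in> I}" by blast
    qed
  qed
  then show ?case
    unfolding ideal_power_Suc Suc ideal_prod_class[OF idl.subspace_span assms] .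
qed

section \<open>Frobenius-linear functionals\<close>

text \<open>For \<open>q = p ^ e\<close> these are the linear maps from the e-th Frobenius
  pushforward of the ring to the ring.\<close>

definition frob_lin :: "nat \<Rightarrow> ('a::comm_ring_1 \<Rightarrow> 'a) \<Rightarrow> bool" where
  "frob_lin q \<phi> \<longleftrightarrow> (\<forall>x y. \<phi> (x + y) = \<phi> x + \<phi> y) \<and> (\<forall>a x. \<phi> (a ^ q * x) = a * \<phi> x)"

text \<open>For a maximal ideal \<open>M\<close> of a polynomial ring this is, locally at \<open>M\<close>, the Frobenius power of \<open>M\<close>; the
  definition by functionals makes Fedder's criterion automatic.\<close>

definition frob_ideal :: "nat \<Rightarrow> 'a::comm_ring_1 set \<Rightarrow> 'a set" where
  "frob_ideal q M = {d. \<forall>\<phi>. frob_lin q \<phi> \<longrightarrow> \<phi> d \<in> M}"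

lemma frob_lin_add: "frob_lin q \<phi> \<Longrightarrow> \<phi> (x + y) = \<phi> x + \<phi> y"
  by (simp add: frob_lin_def)

lemma frob_lin_scale: "frob_lin q \<phi> \<Longrightarrow> \<phi> (a ^ q * x) = a * \<phi> x"
  by (simp add: frob_lin_def)

lemma frob_lin_0: "frob_lin q \<phi> \<Longrightarrow> \<phi> 0 = 0"
  using frob_lin_add[of q \<phi> 0 0] by simp

lemma frob_lin_mult: "frob_lin q \<phi> \<Longrightarrow> frob_lin q (\<lambda>x. \<phi> (c * x))"
  unfolding frob_lin_def by (simp only: distrib_left mult.left_commute[of c] simp_thms)

lemma frob_lin_sum: "frob_lin q \<phi> \<Longrightarrow> \<phi> (sum f A) = (\<Sum>x\<in>A. \<phi> (f x))"
  by (induction A rule: infinite_finite_induct) (simp_all add: frob_lin_0 frob_lin_add)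

text \<open>Closed under scaling because premultiplying a functional by \<open>c\<close> gives a
  functional again.\<close>

lemma frob_ideal_subspace:
  assumes "idl.subspace M"
  shows "idl.subspace (frob_ideal q M)"
  unfolding idl.subspace_def
proof (intro conjI ballI allI)
  show "0 \<in> frob_ideal q M"
    by (simp add: frob_ideal_def frob_lin_0 idl.subspace_0[OF assms])
  show "x + y \<in> frob_ideal q M" if "x \<in> frob_ideal q M" "y \<in> frob_ideal q M" for x y
    using that by (simp add: frob_ideal_def frob_lin_add idl.subspace_add[OF assms])
  show "c * x \<in> frob_ideal q M" if "x \<in> frob_ideal q M" for c x
    using that frob_lin_mult[of q _ c] unfolding frob_ideal_def by blast
qed

lemma power_in_frob_ideal: "idl.subspace M \<Longrightarrow> a \<in> M \<Longrightarrow> a ^ q \<in> frob_ideal q M"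
proof -
  assume M: "idl.subspace M" "a \<in> M"
  have "\<phi> (a ^ q) \<in> M" if "frob_lin q \<phi>" for \<phi>
    using frob_lin_scale[OF that, of a 1] subspace_mult_right[OF M, of "\<phi> 1"] by simp
  then show ?thesis by (simp add: frob_ideal_def)
qed

lemma frob_ideal_antimono: "M \<subseteq> N \<Longrightarrow> frob_ideal q M \<subseteq> frob_ideal q N"
  by (auto simp: frob_ideal_def)

section \<open>F-purity of localizations\<close>

lemma nat_pow_type_class:
  assumes "monoid.mult A = (*)" "\<one>\<^bsub>A\<^esub> = (1 :: 'a::comm_ring_1)"
  shows "x [^]\<^bsub>A\<^esub> (n :: nat) = x ^ n"
proof (induction n)
  case 0
  then show ?case using assms by (simp add: nat_pow_def)
next
  case (Suc n)
  then show ?case using assms by (simp add: nat_pow_def mult.commute)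
qed

lemma localization_simps:
  "carrier (localization P) = {Fract a b | a b. b \<notin> P}"
  "x \<otimes>\<^bsub>localization P\<^esub> y = x * y"
  "x \<oplus>\<^bsub>localization P\<^esub> y = x + y"
  "\<one>\<^bsub>localization P\<^esub> = 1"
  "\<zero>\<^bsub>localization P\<^esub> = 0"
  "x [^]\<^bsub>localization P\<^esub> (n :: nat) = x ^ n"
  by (simp_all add: localization_def cring_class_ops_def nat_pow_type_class)

lemma prime_id_not_zero: "prime_id P \<Longrightarrow> b \<notin> P \<Longrightarrow> b \<noteq> 0"
  unfolding prime_id_def using idl.subspace_0 by blast

lemma prime_id_mult: "prime_id P \<Longrightarrow> a \<notin> P \<Longrightarrow> b \<notin> P \<Longrightarrow> a * b \<notin> P"
  by (auto simp: prime_id_def)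

lemma prime_id_power: "prime_id P \<Longrightarrow> a \<notin> P \<Longrightarrow> a ^ n \<notin> P"
proof (induction n)
  case 0
  then show ?case by (simp add: prime_id_def)
next
  case (Suc n)
  then show ?case by (simp add: prime_id_mult)
qed

lemma prime_id_one: "prime_id P \<Longrightarrow> 1 \<notin> P"
  by (simp add: prime_id_def)

lemma localization_ring:
  fixes P :: "'a::idom set"
  assumes P: "prime_id P"
  shows "ring (localization P)"
proof -
  have F: "ring (cring_class_ops :: 'a fract ring)" by (rule cring.axioms(1)[OF cring_class])
  let ?H = "{Fract a b | a b. b \<notin> P}"
  have "subring ?H (cring_class_ops :: 'a fract ring)"
  proof (rule ring.subringI[OF F])
    show "?H \<subseteq> carrier cring_class_ops" by (simp add: cring_class_ops_def)
    show "\<one>\<^bsub>cring_class_ops\<^esub> \<in> ?H"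
      using prime_id_one[OF P] by (auto simp: one_class One_fract_def)
    show "\<ominus>\<^bsub>cring_class_ops\<^esub> h \<in> ?H" if "h \<in> ?H" for h
      using that by (force simp: uminus_class minus_fract)
    show "h1 \<otimes>\<^bsub>cring_class_ops\<^esub> h2 \<in> ?H" if "h1 \<in> ?H" "h2 \<in> ?H" for h1 h2
      using that prime_id_mult[OF P] by (force simp: times_class mult_fract)
    show "h1 \<oplus>\<^bsub>cring_class_ops\<^esub> h2 \<in> ?H" if "h1 \<in> ?H" "h2 \<in> ?H" for h1 h2
    proof -
      from that obtain a b c d where "h1 = Fract a b" "h2 = Fract c d" "b \<notin> P" "d \<notin> P" by blast
      then have "h1 + h2 = Fract (a * d + c * b) (b * d)" "b * d \<notin> P"
        using prime_id_not_zero[OF P] prime_id_mult[OF P] by (simp_all add: add_fract)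
      then show ?thesis unfolding plus_class by blast
    qed
  qed
  then show ?thesis unfolding localization_def by (rule ring.subring_is_ring[OF F])
qed

text \<open>The fractions with numerator in \<open>J\<close> already form an ideal of the
  localization that contains the image of \<open>J\<close>; sums are handled by a common denominator
  outside \<open>P\<close>.\<close>

lemma localized_ideal_subset:
  fixes P :: "'a::idom set"
  assumes P: "prime_id P" and J: "idl.subspace J"
  shows "localized_ideal P J \<subseteq> {Fract a b | a b. a \<in> J \<and> b \<notin> P}" (is "_ \<subseteq> ?H")
proof -
  interpret L: ring "localization P" by (rule localization_ring[OF P])
  have sum: "x + y \<in> ?H" if "x \<in> ?H" "y \<in> ?H" for x y
  proof -
    from that obtain a b c d where x: "x = Fract a b" "y = Fract c d" "b \<notin> P" "d \<notin> P" "a \<in> J" "c \<in> J"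
      by blast
    then have "x + y = Fract (a * d + c * b) (b * d)"
      using prime_id_not_zero[OF P] by (simp add: add_fract)
    moreover have "a * d + c * b \<in> J"
      using x by (intro idl.subspace_add[OF J] subspace_mult_right[OF J])
    ultimately show ?thesis using prime_id_mult[OF P x(3,4)] by blast
  qed
  have scale: "x * y \<in> ?H" if "x \<in> carrier (localization P)" "y \<in> ?H" for x y
  proof -
    from that obtain a b c d where x: "x = Fract a b" "y = Fract c d" "b \<notin> P" "d \<notin> P" "c \<in> J"
      by (auto simp: localization_simps)
    then have "x * y = Fract (a * c) (b * d)" by simp
    moreover have "a * c \<in> J" using x idl.subspace_scale[OF J] by blast
    ultimately show ?thesis using prime_id_mult[OF P x(3,4)] by blast
  qed
  have neg1: "\<ominus>\<^bsub>localization P\<^esub> x = - x" if "x \<in> carrier (localization P)" for x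
  proof -
    have "\<ominus>\<^bsub>localization P\<^esub> x + x = 0"
      using L.l_neg[OF that] by (simp add: localization_simps)
    then show ?thesis by (simp add: eq_neg_iff_add_eq_0)
  qed
  have sub: "?H \<subseteq> carrier (localization P)" by (auto simp: localization_simps)
  have "ideal ?H (localization P)"
  proof (rule idealI)
    show "subgroup ?H (add_monoid (localization P))"
    proof (rule group.subgroupI[OF L.a_group])
      show "?H \<noteq> {}" using idl.subspace_0[OF J] prime_id_one[OF P] by blast
      fix x assume x: "x \<in> ?H"
      then obtain a b where ab: "x = Fract a b" "a \<in> J" "b \<notin> P" by blast
      then have "- x = Fract (- a) b" "- a \<in> J" using idl.subspace_neg[OF J] by simp_all
      then have "- x \<in> ?H" using ab(3) by blast
      moreover have "x \<in> carrier (localization P)" using sub x by (rule subsetD)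
      ultimately have "\<ominus>\<^bsub>localization P\<^esub> x \<in> ?H" by (simp only: neg1)
      then show "inv\<^bsub>add_monoid (localization P)\<^esub> x \<in> ?H" by (simp add: a_inv_def)
    next
      fix x y assume "x \<in> ?H" "y \<in> ?H"
      then have "x + y \<in> ?H" by (rule sum)
      then show "x \<otimes>\<^bsub>add_monoid (localization P)\<^esub> y \<in> ?H" by (simp add: localization_simps)
    qed (use sub in simp)
    show "x \<otimes>\<^bsub>localization P\<^esub> a \<in> ?H" if "a \<in> ?H" "x \<in> carrier (localization P)" for a x
      using scale[OF that(2,1)] by (simp only: localization_simps)
    show "a \<otimes>\<^bsub>localization P\<^esub> x \<in> ?H" if "a \<in> ?H" "x \<in> carrier (localization P)" for a x
      using scale[OF that(2,1)] by (simp only: localization_simps mult.commute)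
  qed (rule L.ring_axioms)
  moreover have "(\<lambda>a. Fract a 1) ` J \<subseteq> ?H" using prime_id_one[OF P] by blast
  ultimately show ?thesis unfolding localized_ideal_def by (rule L.genideal_minimal)
qed

text \<open>Recovers a global element, the numerator, from a local witness of F-purity.\<close>

lemma localized_power_subset:
  fixes P :: "'a::idom set"
  assumes P: "prime_id P" and J: "idl.subspace J"
    and "d \<in> ideal_power (localization P) (localized_ideal P J) n"
  shows "\<exists>a b. d = Fract a b \<and> b \<notin> P \<and> a \<in> idl.span (mons J n)"
  using assms(3)
proof (induction n arbitrary: d)
  case 0
  have "a \<in> idl.span (mons J 0)" for a
    using idl.span_scale[OF idl.span_base[of 1 "{1}"], of a] by simp
  with 0 show ?case unfolding ideal_power_0 localization_simps by blast
next
  case (Suc n)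
  from Suc.prems show ?case unfolding ideal_power_Suc
  proof (induction rule: ideal_prod.induct)
    case (prod i j)
    from Suc.IH[OF prod(1)] obtain a b where ab: "i = Fract a b" "b \<notin> P" "a \<in> idl.span (mons J n)"
      by blast
    from localized_ideal_subset[OF P J] prod(2) obtain c d where cd: "j = Fract c d" "d \<notin> P" "c \<in> J"
      by blast
    have "c * a \<in> idl.span (mons J (Suc n))"
      using idl.span_base[OF cd(3)] ab(3)
    proof (rule span_times)
      fix s t assume "s \<in> J" "t \<in> mons J n"
      then show "s * t \<in> idl.span (mons J (Suc n))"
        by (intro idl.span_base) (unfold mons.simps, blast)
    qed
    then show ?case using ab cd prime_id_mult[OF P]
      by (intro exI[of _ "c * a"] exI[of _ "d * b"])
        (simp add: localization_simps mult.commute)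
  next
    case (sum x y)
    then obtain a b c d where x: "x = Fract a b" "y = Fract c d" "b \<notin> P" "d \<notin> P"
        "a \<in> idl.span (mons J (Suc n))" "c \<in> idl.span (mons J (Suc n))"
      by blast
    then have "x + y = Fract (a * d + c * b) (b * d)"
      using prime_id_not_zero[OF P] by (simp add: add_fract)
    moreover have "a * d + c * b \<in> idl.span (mons J (Suc n))"
      using x(5,6) by (intro idl.span_add subspace_mult_right[OF idl.subspace_span])
    ultimately show ?case using prime_id_mult[OF P x(3,4)]
      unfolding localization_simps by blast
  qed
qed

text \<open>The opposite passage: a global element serves as a local witness of F-purity.\<close>

lemma localized_power_contains:
  fixes P :: "'a::idom set"
  assumes "1 \<notin> P" "d \<in> ideal_power (cring_class_ops :: 'a ring) J n"
  shows "Fract d 1 \<in> ideal_power (localization P) (localized_ideal P J) n"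
  using assms(2)
proof (induction n arbitrary: d)
  case 0
  show ?case using assms(1) unfolding ideal_power_0 localization_simps by blast
next
  case (Suc n)
  from Suc.prems show ?case unfolding ideal_power_Suc
  proof (induction rule: ideal_prod.induct)
    case (prod i j)
    have "Fract j 1 \<in> localized_ideal P J"
      using prod(2) unfolding localized_ideal_def genideal_def by blast
    from ideal_prod.prod[OF Suc.IH[OF prod(1)] this, of "localization P"] show ?case
      by (simp add: localization_simps times_class)
  next
    case (sum x y)
    from ideal_prod.sum[OF sum(3,4)] show ?case
      by (simp add: localization_simps plus_class)
  qed
qed

text \<open>Since a / b = a b^(q-1) / b^q, linearity forces the value \<phi>(a b^(q-1)) / b.
  \<open>SOME\<close> only picks a representative; the value does not depend on it.\<close>

definition extend_fract :: "nat \<Rightarrow> ('a::idom \<Rightarrow> 'a) \<Rightarrow> 'a fract \<Rightarrow> 'a fract" where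
  "extend_fract q \<phi> x = (let (a, b) = SOME (a, b). b \<noteq> 0 \<and> x = Fract a b
     in Fract (\<phi> (a * b ^ (q - 1))) b)"

lemma extend_fract:
  fixes \<phi> :: "'a::idom \<Rightarrow> 'a"
  assumes \<phi>: "frob_lin q \<phi>" and "q > 0" "b \<noteq> 0"
  shows "extend_fract q \<phi> (Fract a b) = Fract (\<phi> (a * b ^ (q - 1))) b"
proof -
  obtain c d where cd: "(SOME (c, d). d \<noteq> 0 \<and> Fract a b = Fract c d) = (c, d)"
    by fastforce
  have "case (c, d) of (c, d) \<Rightarrow> d \<noteq> 0 \<and> Fract a b = Fract c d"
    unfolding cd[symmetric] by (rule someI[of _ "(a, b)"]) (use assms in simp)
  then have d: "d \<noteq> 0" "a * d = c * b" using assms by (auto simp: eq_fract)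
  have q: "x ^ q = x * x ^ (q - 1)" for x :: 'a
    using assms(2) by (cases q) auto
  \<comment> \<open>Moving d and b through \<open>\<phi>\<close> as q-th powers, with a d = c b in
    between, transforms one candidate value into the other.\<close>
  have "d * \<phi> (a * b ^ (q - 1)) = \<phi> (d ^ q * (a * b ^ (q - 1)))"
    by (simp only: frob_lin_scale[OF \<phi>])
  also have "d ^ q * (a * b ^ (q - 1)) = (a * d) * b ^ (q - 1) * d ^ (q - 1)"
    unfolding q by (simp only: mult_ac)
  also have "\<dots> = b ^ q * (c * d ^ (q - 1))"
    unfolding q d(2) by (simp only: mult_ac)
  also have "\<phi> \<dots> = b * \<phi> (c * d ^ (q - 1))"
    by (simp only: frob_lin_scale[OF \<phi>])
  finally show ?thesis
    using d assms cd unfolding extend_fract_def Let_def by (simp add: eq_fract mult.commute)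
qed

lemma splits_atI:
  fixes M :: "'a::idom set"
  assumes M: "prime_id M" and \<phi>: "frob_lin (p ^ e) \<phi>" and "p > 0" and d: "\<phi> d \<notin> M"
  shows "splits_at (localization M) (frobenius_pushforward p e (localization M)) (Fract d 1)"
proof -
  define q where "q = p ^ e"
  have q: "q > 0" using \<open>p > 0\<close> by (simp add: q_def)
  have qq: "x ^ q = x * x ^ (q - 1)" for x :: 'a using q by (cases q) auto
  note \<phi> = \<phi>[folded q_def]
  note ext = extend_fract[OF \<phi> q]
  \<comment> \<open>Division by \<open>\<phi> d\<close>, a unit of the localization, normalizes the
    value at \<open>d\<close> to 1.\<close>
  define \<psi> where "\<psi> x = extend_fract q \<phi> x * Fract 1 (\<phi> d)" for x
  have d0: "\<phi> d \<noteq> 0" using prime_id_not_zero[OF M d] .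
  have car: "\<psi> x \<in> carrier (localization M)" if x: "x \<in> carrier (localization M)" for x
  proof -
    from x obtain a b where ab: "x = Fract a b" "b \<notin> M" by (auto simp: localization_simps)
    then have "\<psi> x = Fract (\<phi> (a * b ^ (q - 1))) (b * \<phi> d)"
      using prime_id_not_zero[OF M] by (simp add: \<psi>_def ext)
    then show ?thesis using prime_id_mult[OF M ab(2) d] unfolding localization_simps by blast
  qed
  have add: "\<psi> (x + y) = \<psi> x + \<psi> y" for x y
  proof -
    obtain a b c e where x: "x = Fract a b" "y = Fract c e" "b \<noteq> 0" "e \<noteq> 0"
      by (metis Fract_cases)
    have "extend_fract q \<phi> (x + y) = Fract (\<phi> ((a * e + c * b) * (b * e) ^ (q - 1))) (b * e)"
      using x by (simp add: ext)
    also have "(a * e + c * b) * (b * e) ^ (q - 1) = e ^ q * (a * b ^ (q - 1)) + b ^ q * (c * e ^ (q - 1))"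
      unfolding qq by (simp only: distrib_right distrib_left power_mult_distrib mult_ac)
    also have "\<phi> \<dots> = e * \<phi> (a * b ^ (q - 1)) + b * \<phi> (c * e ^ (q - 1))"
      by (simp only: frob_lin_add[OF \<phi>] frob_lin_scale[OF \<phi>])
    finally have "extend_fract q \<phi> (x + y) = extend_fract q \<phi> x + extend_fract q \<phi> y"
      using x by (simp add: ext mult.commute)
    then show ?thesis by (simp add: \<psi>_def distrib_right)
  qed
  have scale: "\<psi> (a ^ q * x) = a * \<psi> x" for a x
  proof -
    obtain a1 b c e where x: "a = Fract a1 b" "x = Fract c e" "b \<noteq> 0" "e \<noteq> 0"
      by (metis Fract_cases)
    have pow: "Fract a1 b ^ n = Fract (a1 ^ n) (b ^ n)" for n
      by (induction n) (simp_all add: One_fract_def)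
    have "extend_fract q \<phi> (a ^ q * x) = Fract (\<phi> ((a1 ^ q * c) * (b ^ q * e) ^ (q - 1))) (b ^ q * e)"
      using x by (simp add: ext pow)
    also have "(a1 ^ q * c) * (b ^ q * e) ^ (q - 1) = (a1 * b ^ (q - 1)) ^ q * (c * e ^ (q - 1))"
      by (simp only: power_mult_distrib power_mult[symmetric] mult_ac)
    also have "\<phi> \<dots> = a1 * b ^ (q - 1) * \<phi> (c * e ^ (q - 1))"
      by (simp only: frob_lin_scale[OF \<phi>])
    also have "Fract (a1 * b ^ (q - 1) * \<phi> (c * e ^ (q - 1))) (b ^ q * e) = a * extend_fract q \<phi> x"
    proof -
      have "(a1 * b ^ (q - 1) * \<phi> (c * e ^ (q - 1))) * (b * e) = (a1 * \<phi> (c * e ^ (q - 1))) * (b ^ q * e)"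
        unfolding qq by (simp only: mult_ac)
      moreover have "b ^ q * e \<noteq> 0" "b * e \<noteq> 0" using x by simp_all
      ultimately show ?thesis unfolding x(1,2) ext[OF x(4)] mult_fract
        by (subst eq_fract(1)) simp_all
    qed
    finally show ?thesis by (simp add: \<psi>_def)
  qed
  have "\<psi> (Fract d 1) = 1"
    using d0 by (simp add: \<psi>_def ext One_fract_def eq_fract)
  then have one: "\<psi> (a ^ q * Fract d 1) = a" for a
    by (simp only: scale mult_1_right)
  show ?thesis unfolding splits_at_def linear_functionals_def
    by (rule bexI[of _ \<psi>])
      (use car add scale one in \<open>simp_all add: frobenius_pushforward_def localization_simps q_def\<close>)
qed

text \<open>Functional and element may be taken on the whole ring; the localization is dealt with
  here once and for all.\<close>

lemma F_pureI:
  fixes J :: "'a::idom set"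
  assumes "p > 0"
    and "\<And>M. prime_id M \<Longrightarrow> \<forall>\<^sub>F e in sequentially.
      \<exists>\<phi>. frob_lin (p ^ e) \<phi> \<and>
      (\<exists>d\<in>ideal_power (cring_class_ops :: 'a ring) J (nat \<lfloor>t * (real p ^ e - 1)\<rfloor>). \<phi> d \<notin> M)"
  shows "F_pure p J t"
  unfolding F_pure_def F_pure_local_def
proof (intro allI impI)
  fix M assume "maximalideal M (cring_class_ops :: 'a ring)"
  then have M: "prime_id M" by (rule maximalideal_class_prime)
  show "\<forall>\<^sub>F e in sequentially. \<exists>d\<in>ideal_power (localization M) (localized_ideal M J) (nat \<lfloor>t * (real p ^ e - 1)\<rfloor>).
           splits_at (localization M) (frobenius_pushforward p e (localization M)) d"
    using assms(2)[OF M]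
  proof (rule eventually_mono)
    fix e
    let ?N = "nat \<lfloor>t * (real p ^ e - 1)\<rfloor>"
    assume "\<exists>\<phi>. frob_lin (p ^ e) \<phi> \<and> (\<exists>d\<in>ideal_power (cring_class_ops :: 'a ring) J ?N. \<phi> d \<notin> M)"
    then obtain \<phi> d where "frob_lin (p ^ e) \<phi>" "d \<in> ideal_power (cring_class_ops :: 'a ring) J ?N" "\<phi> d \<notin> M"
      by blast
    then show "\<exists>d\<in>ideal_power (localization M) (localized_ideal M J) ?N.
        splits_at (localization M) (frobenius_pushforward p e (localization M)) d"
      using splits_atI[OF M _ \<open>p > 0\<close>] localized_power_contains[OF prime_id_one[OF M]] by blast
  qed
qed

text \<open>A local splitting spreads out, after clearing denominators, because the Frobenius
  pushforward is a finitely generated module.\<close>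

lemma splits_atD:
  fixes M :: "'a::idom set"
  assumes M: "prime_id M" and J: "idl.subspace J" and "p > 0"
    and d: "d \<in> ideal_power (localization M) (localized_ideal M J) n"
    and split: "splits_at (localization M) (frobenius_pushforward p e (localization M)) d"
    and add: "\<And>x y :: 'a. (x + y) ^ p ^ e = x ^ p ^ e + y ^ p ^ e"
    and G: "finite G" "\<And>z :: 'a. \<exists>c. z = (\<Sum>g\<in>G. c g ^ p ^ e * g)"
  shows "\<not> idl.span (mons J n) \<subseteq> frob_ideal (p ^ e) M"
proof -
  define q where "q = p ^ e"
  have q: "q > 0" using \<open>p > 0\<close> by (simp add: q_def)
  note mnz = prime_id_not_zero[OF M]
  let ?L = "localization M"
  let ?F = "frobenius_pushforward p e ?L"
  from split obtain \<psi> where \<psi>': "\<psi> \<in> linear_functionals ?L ?F"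
      "\<forall>a\<in>carrier ?L. \<psi> (a \<odot>\<^bsub>?F\<^esub> d) = a"
    unfolding splits_at_def by blast
  then have \<psi>: "\<And>x. x \<in> carrier ?L \<Longrightarrow> \<psi> x \<in> carrier ?L"
      "\<And>x y. x \<in> carrier ?L \<Longrightarrow> y \<in> carrier ?L \<Longrightarrow> \<psi> (x + y) = \<psi> x + \<psi> y"
      "\<And>a x. a \<in> carrier ?L \<Longrightarrow> x \<in> carrier ?L \<Longrightarrow> \<psi> (a ^ q * x) = a * \<psi> x"
      "\<And>a. a \<in> carrier ?L \<Longrightarrow> \<psi> (a ^ q * d) = a"
    unfolding linear_functionals_def
    by (simp_all add: frobenius_pushforward_def localization_simps(2-) q_def)
  have car: "Fract a 1 \<in> carrier (localization M)" for a
    using prime_id_one[OF M] unfolding localization_simps by blast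
  have pow1: "Fract a 1 ^ n = Fract (a ^ n) (1 :: 'a)" for a n
    by (induction n) (simp_all add: One_fract_def)
  have add1: "Fract a 1 + Fract b 1 = Fract (a + b) (1 :: 'a)" for a b by simp
  have "\<forall>g. \<exists>a b. \<psi> (Fract g 1) = Fract a b \<and> b \<notin> M"
    using \<psi>(1)[OF car] unfolding localization_simps by blast
  then obtain \<alpha> \<beta> where ab: "\<And>g. \<psi> (Fract g 1) = Fract (\<alpha> g) (\<beta> g)" "\<And>g. \<beta> g \<notin> M" by metis
  \<comment> \<open>A common denominator of the values of \<open>\<psi>\<close> on the finitely many
    module generators: \<open>B\<close> times \<open>\<psi>\<close> maps the whole ring into
    itself.\<close>
  define B where "B = prod \<beta> G"
  have B: "B \<notin> M"
    unfolding B_def using G(1) ab(2)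
    by (induction G rule: finite_induct) (simp_all add: prime_id_one[OF M] prime_id_mult[OF M])
  define R where "R = {x :: 'a fract. \<exists>a. x = Fract a 1}"
  have R_add: "x + y \<in> R" if "x \<in> R" "y \<in> R" for x y
    using that by (auto simp: R_def)
  have R_sum: "sum f A \<in> R" if "\<And>x. x \<in> A \<Longrightarrow> f x \<in> R" for f :: "'a \<Rightarrow> 'a fract" and A
    using that
  proof (induction A rule: infinite_finite_induct)
    case (insert x F)
    then show ?case by (simp add: R_add)
  qed (auto simp: R_def Zero_fract_def)
  have \<psi>_sum: "\<psi> (Fract (sum f A) 1) = (\<Sum>g\<in>A. \<psi> (Fract (f g) 1))" if "finite A" for f :: "'a \<Rightarrow> 'a" and A
    using that
  proof (induction A rule: finite_induct)
    case empty
    have "\<psi> (Fract 0 1 + Fract 0 1) = \<psi> (Fract 0 1) + \<psi> (Fract 0 1)" by (rule \<psi>(2)[OF car car])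
    then have "\<psi> (Fract 0 1) = \<psi> (Fract 0 1) + \<psi> (Fract 0 1)" by (simp only: add1 add_0)
    then show ?case by (simp only: sum.empty add_cancel_right_right)
  next
    case (insert x F)
    have "\<psi> (Fract (f x) 1 + Fract (sum f F) 1) = \<psi> (Fract (f x) 1) + \<psi> (Fract (sum f F) 1)"
      by (rule \<psi>(2)[OF car car])
    with insert show ?case by (simp add: add1)
  qed
  have int: "Fract B 1 * \<psi> (Fract z 1) \<in> R" for z
  proof -
    from G(2)[of z] obtain c where c: "z = (\<Sum>g\<in>G. c g ^ q * g)" unfolding q_def by blast
    have "\<psi> (Fract z 1) = (\<Sum>g\<in>G. \<psi> (Fract (c g) 1 ^ q * Fract g 1))"
      unfolding c by (subst \<psi>_sum[OF G(1)]) (simp add: pow1)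
    also have "\<dots> = (\<Sum>g\<in>G. Fract (c g) 1 * Fract (\<alpha> g) (\<beta> g))"
      by (intro sum.cong refl) (simp add: \<psi>(3)[OF car car] ab(1) del: mult_fract)
    finally have "Fract B 1 * \<psi> (Fract z 1) = (\<Sum>g\<in>G. Fract B 1 * (Fract (c g) 1 * Fract (\<alpha> g) (\<beta> g)))"
      by (simp only: sum_distrib_left)
    also have "\<dots> = (\<Sum>g\<in>G. Fract (B * c g * \<alpha> g) (\<beta> g))"
      by (intro sum.cong refl) (simp only: mult_fract mult_1_left mult.assoc)
    also have "\<dots> \<in> R"
    proof (rule R_sum)
      fix g assume g: "g \<in> G"
      have "B = \<beta> g * prod \<beta> (G - {g})" unfolding B_def by (rule prod.remove[OF G(1) g])
      then have "B * c g * \<alpha> g * 1 = (prod \<beta> (G - {g}) * c g * \<alpha> g) * \<beta> g"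
        by (simp only: mult_1_right) (simp only: mult_ac)
      then have "Fract (B * c g * \<alpha> g) (\<beta> g) = Fract (prod \<beta> (G - {g}) * c g * \<alpha> g) 1"
        using mnz[OF ab(2)[of g]] by (simp add: eq_fract)
      then show "Fract (B * c g * \<alpha> g) (\<beta> g) \<in> R" unfolding R_def by blast
    qed
    finally show ?thesis .
  qed
  then have "\<forall>z. \<exists>a. Fract B 1 * \<psi> (Fract z 1) = Fract a 1" unfolding R_def by blast
  then obtain \<phi> where \<phi>: "\<And>z. Fract B 1 * \<psi> (Fract z 1) = Fract (\<phi> z) 1" by metis
  have inj: "Fract a 1 = Fract b (1 :: 'a) \<Longrightarrow> a = b" for a b by (simp add: eq_fract)
  have "frob_lin q \<phi>" unfolding frob_lin_def
  proof (intro conjI allI)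
    fix x y
    have "Fract (\<phi> (x + y)) 1 = Fract (\<phi> x) 1 + Fract (\<phi> y) 1"
      unfolding \<phi>[symmetric] add1[symmetric] \<psi>(2)[OF car car] by (rule distrib_left)
    then show "\<phi> (x + y) = \<phi> x + \<phi> y" by (intro inj) simp
  next
    fix a x
    have "Fract (\<phi> (a ^ q * x)) 1 = Fract B 1 * \<psi> (Fract a 1 ^ q * Fract x 1)"
      unfolding \<phi>[symmetric] by (simp add: pow1)
    also have "\<dots> = Fract a 1 * Fract (\<phi> x) 1"
      unfolding \<psi>(3)[OF car car] \<phi>[symmetric] by (rule mult.left_commute)
    finally show "\<phi> (a ^ q * x) = a * \<phi> x" by (intro inj) simp
  qed
  moreover
  from localized_power_subset[OF M J d] obtain a b where a: "d = Fract a b" "b \<notin> M" "a \<in> idl.span (mons J n)"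
    by blast
  \<comment> \<open>The witness a / b is replaced by its multiple by b^q, which is a ring element.
    Its value under \<open>\<psi>\<close> is b, and B b lies outside \<open>M\<close>.\<close>
  have "Fract (a * b ^ (q - 1)) 1 = Fract b 1 ^ q * d"
  proof -
    have "b ^ q = b * b ^ (q - 1)" using q by (cases q) auto
    then have "a * b ^ (q - 1) * b = b ^ q * a" by (simp only: mult_ac)
    then show ?thesis using mnz[OF a(2)] unfolding a(1) pow1 by (simp add: eq_fract)
  qed
  then have "Fract (\<phi> (a * b ^ (q - 1))) 1 = Fract (B * b) 1"
    unfolding \<phi>[symmetric] using \<psi>(4)[OF car, of b] by simp
  then have "\<phi> (a * b ^ (q - 1)) = B * b" by (rule inj)
  then have "\<phi> (a * b ^ (q - 1)) \<notin> M" using prime_id_mult[OF M B a(2)] by simp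
  ultimately have "a * b ^ (q - 1) \<notin> frob_ideal q M" unfolding frob_ideal_def by blast
  moreover have "a * b ^ (q - 1) \<in> idl.span (mons J n)"
    using subspace_mult_right[OF idl.subspace_span a(3)] .
  ultimately show ?thesis unfolding q_def by blast
qed

lemma F_pureD:
  fixes J :: "'a::idom set"
  assumes "F_pure p J t" and M: "maximalideal M (cring_class_ops :: 'a ring)"
    and J: "idl.subspace J" and "p > 0"
    and add: "\<And>e x y. ((x :: 'a) + y) ^ p ^ e = x ^ p ^ e + y ^ p ^ e"
    and G: "\<And>e. \<exists>G. finite G \<and> (\<forall>z :: 'a. \<exists>c. z = (\<Sum>g\<in>G. c g ^ p ^ e * g))"
  shows "\<forall>\<^sub>F e in sequentially.
    \<not> idl.span (mons J (nat \<lfloor>t * (real p ^ e - 1)\<rfloor>)) \<subseteq> frob_ideal (p ^ e) M"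
proof -
  have "F_pure_local p (localization M) (localized_ideal M J) t"
    using assms(1) M by (simp add: F_pure_def)
  then show ?thesis unfolding F_pure_local_def
  proof (rule eventually_mono)
    fix e
    assume "\<exists>d\<in>ideal_power (localization M) (localized_ideal M J) (nat \<lfloor>t * (real p ^ e - 1)\<rfloor>).
        splits_at (localization M) (frobenius_pushforward p e (localization M)) d"
    with splits_atD[OF maximalideal_class_prime[OF M] J \<open>p > 0\<close> _ _ add] G[of e]
    show "\<not> idl.span (mons J (nat \<lfloor>t * (real p ^ e - 1)\<rfloor>)) \<subseteq> frob_ideal (p ^ e) M"
      by blast
  qed
qed

section \<open>Polynomial rings\<close>

abbreviation lookup where "lookup \<equiv> Poly_Mapping.lookup"
abbreviation single where "single \<equiv> Poly_Mapping.single"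
abbreviation keys where "keys \<equiv> Poly_Mapping.keys"

lemma poly_mapping_sum_singles: "(\<Sum>k\<in>keys z. single k (lookup z k)) = z"
  by (rule poly_mapping_eqI) (simp add: lookup_sum lookup_single when_def in_keys_iff)

lemma additive_0:
  fixes F :: "'b::monoid_add \<Rightarrow> 'c::cancel_comm_monoid_add"
  assumes "\<And>x y. F (x + y) = F x + F y"
  shows "F 0 = 0"
  using assms[of 0 0] by simp

lemma additive_sum:
  fixes F :: "'b::comm_monoid_add \<Rightarrow> 'c::cancel_comm_monoid_add"
  assumes "\<And>x y. F (x + y) = F x + F y"
  shows "F (sum f A) = (\<Sum>x\<in>A. F (f x))"
  by (induction A rule: infinite_finite_induct) (simp_all add: additive_0[of F, OF assms] assms)

text \<open>Reduces an identity of additive maps to monomials; for biadditive identities it is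
  applied to one argument after the other.\<close>

lemma additive_poly_mapping_eqI:
  fixes F G :: "('m \<Rightarrow>\<^sub>0 'a::comm_monoid_add) \<Rightarrow> 'c::cancel_comm_monoid_add"
  assumes "\<And>x y. F (x + y) = F x + F y" "\<And>x y. G (x + y) = G x + G y"
    and "\<And>k c. F (single k c) = G (single k c)"
  shows "F z = G z"
proof -
  have "F (\<Sum>k\<in>keys z. single k (lookup z k)) = G (\<Sum>k\<in>keys z. single k (lookup z k))"
    by (simp only: additive_sum[of F, OF assms(1)] additive_sum[of G, OF assms(2)] assms(3))
  then show ?thesis by (simp only: poly_mapping_sum_singles)
qed

lemma CHAR_poly_mapping: "CHAR('m::comm_monoid_add \<Rightarrow>\<^sub>0 'a::comm_ring_1) = CHAR('a)"
proof (rule dvd_antisym)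
  have eq: "(of_nat n :: 'm \<Rightarrow>\<^sub>0 'a) = 0 \<longleftrightarrow> (of_nat n :: 'a) = 0" for n
  proof
    assume "(of_nat n :: 'm \<Rightarrow>\<^sub>0 'a) = 0"
    then have "lookup (of_nat n :: 'm \<Rightarrow>\<^sub>0 'a) 0 = 0" by simp
    then show "(of_nat n :: 'a) = 0" by (simp add: lookup_of_nat)
  next
    assume "(of_nat n :: 'a) = 0"
    then have "single 0 (of_nat n :: 'a) = (0 :: 'm \<Rightarrow>\<^sub>0 'a)" by simp
    then show "(of_nat n :: 'm \<Rightarrow>\<^sub>0 'a) = 0" by (simp only: single_of_nat)
  qed
  show "CHAR('m \<Rightarrow>\<^sub>0 'a) dvd CHAR('a)" "CHAR('a) dvd CHAR('m \<Rightarrow>\<^sub>0 'a)"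
    by (simp_all add: eq flip: of_nat_eq_0_iff_char_dvd) (simp flip: eq)
qed

lemma frobenius_add:
  assumes "prime CHAR('a::comm_semiring_1)"
  shows "((x :: 'a) + y) ^ CHAR('a) ^ e = x ^ CHAR('a) ^ e + y ^ CHAR('a) ^ e"
  by (rule freshmans_dream'[OF assms refl])

section \<open>Exponents modulo q and Cartier-type operators\<close>

definition expo_scale :: "nat \<Rightarrow> ('v \<Rightarrow>\<^sub>0 nat) \<Rightarrow> ('v \<Rightarrow>\<^sub>0 nat)" where
  "expo_scale q \<nu> = Poly_Mapping.map ((*) q) \<nu>"

lemma lookup_expo_scale [simp]: "lookup (expo_scale q \<nu>) v = q * lookup \<nu> v"
  by (simp add: expo_scale_def Poly_Mapping.map.rep_eq when_def)

lemma expo_scale_add: "expo_scale q (\<mu> + \<nu>) = expo_scale q \<mu> + expo_scale q \<nu>"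
  by (rule poly_mapping_eqI) (simp add: lookup_add algebra_simps)

lemma expo_scale_inject: "q > 0 \<Longrightarrow> expo_scale q \<mu> = expo_scale q \<nu> \<longleftrightarrow> \<mu> = \<nu>"
  by (auto simp: poly_mapping_eq_iff fun_eq_iff)

lemma single_power: "single \<mu> a ^ n = single (expo_scale n \<mu>) (a ^ n :: 'a::comm_semiring_1)"
proof (induction n)
  case 0
  have "expo_scale 0 \<mu> = 0" by (rule poly_mapping_eqI) simp
  then show ?case by simp
next
  case (Suc n)
  have "\<mu> + expo_scale n \<mu> = expo_scale (Suc n) \<mu>"
    by (rule poly_mapping_eqI) (simp add: lookup_add)
  with Suc show ?case by (simp add: mult_single)
qed

text \<open>Keeps the exponents congruent to \<open>\<mu>\<close> modulo \<open>q\<close>, divides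
  their excess by \<open>q\<close> and applies \<open>\<psi>\<close> to the coefficients. With
  \<open>\<psi>\<close> a q-th root on a perfect field this is the q-th root of the coordinate at
  \<open>\<mu>\<close> in the monomial basis over q-th powers; with \<open>\<psi>\<close> a
  functional on R it extends that functional to S.\<close>

definition cart :: "nat \<Rightarrow> ('a::zero \<Rightarrow> 'a) \<Rightarrow> ('v \<Rightarrow>\<^sub>0 nat) \<Rightarrow> ('v, 'a) mpoly \<Rightarrow> ('v, 'a) mpoly" where
  "cart q \<psi> \<mu> z = Poly_Mapping.map \<psi> (Poly_Mapping.map_key (\<lambda>\<nu>. \<mu> + expo_scale q \<nu>) z)"

lemma lookup_cart:
  assumes "q > 0" "\<psi> 0 = 0"
  shows "lookup (cart q \<psi> \<mu> z) \<nu> = \<psi> (lookup z (\<mu> + expo_scale q \<nu>))"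
proof -
  have "inj (\<lambda>\<nu>. \<mu> + expo_scale q \<nu>)"
    using expo_scale_inject[OF assms(1)] by (auto simp: inj_def)
  then show ?thesis
    by (simp add: cart_def Poly_Mapping.map.rep_eq Poly_Mapping.map_key.rep_eq when_def assms(2))
qed

lemma cart_add:
  assumes "q > 0" "\<And>x y. \<psi> (x + y) = \<psi> x + \<psi> y"
  shows "cart q \<psi> \<mu> (x + y) = cart q \<psi> \<mu> x + cart q \<psi> \<mu> (y :: ('v, 'a::comm_ring_1) mpoly)"
proof -
  have "\<psi> 0 = 0" using assms(2) by (rule additive_0)
  then show ?thesis
    by (intro poly_mapping_eqI) (simp add: lookup_cart assms lookup_add)
qed

lemma cart_single:
  assumes "q > 0" "\<psi> 0 = 0"
  shows "cart q \<psi> \<mu> (single (\<mu> + expo_scale q \<nu>) c) = single \<nu> (\<psi> c)"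
  by (rule poly_mapping_eqI)
    (simp add: lookup_cart assms lookup_single when_def expo_scale_inject[OF assms(1)])

lemma cart_single_0:
  assumes "q > 0" "\<psi> 0 = 0" "\<And>\<nu>. \<zeta> \<noteq> \<mu> + expo_scale q \<nu>"
  shows "cart q \<psi> \<mu> (single \<zeta> c) = 0"
  by (rule poly_mapping_eqI)
    (use assms in \<open>auto simp: lookup_cart lookup_single when_def\<close>)

lemma frob_lin_cart:
  fixes \<psi> :: "'a::comm_ring_1 \<Rightarrow> 'a" and \<mu> :: "'v \<Rightarrow>\<^sub>0 nat"
  assumes q: "q > 0" and \<psi>: "frob_lin q \<psi>" and \<mu>: "\<And>v. lookup \<mu> v < q"
    and frob: "\<And>x y :: ('v, 'a) mpoly. (x + y) ^ q = x ^ q + y ^ q"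
  shows "frob_lin q (cart q \<psi> \<mu>)"
  unfolding frob_lin_def
proof (intro conjI allI)
  note [simp] = frob_lin_0[OF \<psi>]
  note add = cart_add[OF q frob_lin_add[OF \<psi>]]
  show "cart q \<psi> \<mu> (x + y) = cart q \<psi> \<mu> x + cart q \<psi> \<mu> y" for x y by (rule add)
  fix a z
  show "cart q \<psi> \<mu> (a ^ q * z) = a * cart q \<psi> \<mu> z"
  proof (rule additive_poly_mapping_eqI[of "\<lambda>a. cart q \<psi> \<mu> (a ^ q * z)"])
    fix \<alpha> and a0 :: 'a
    show "cart q \<psi> \<mu> (single \<alpha> a0 ^ q * z) = single \<alpha> a0 * cart q \<psi> \<mu> z"
    proof (rule additive_poly_mapping_eqI[of "\<lambda>z. cart q \<psi> \<mu> (single \<alpha> a0 ^ q * z)"])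
      fix \<zeta> and z0 :: 'a
      show "cart q \<psi> \<mu> (single \<alpha> a0 ^ q * single \<zeta> z0) = single \<alpha> a0 * cart q \<psi> \<mu> (single \<zeta> z0)"
      proof (cases "\<exists>\<nu>. \<zeta> = \<mu> + expo_scale q \<nu>")
        case True
        then obtain \<nu> where \<nu>: "\<zeta> = \<mu> + expo_scale q \<nu>" by blast
        then have "expo_scale q \<alpha> + \<zeta> = \<mu> + expo_scale q (\<alpha> + \<nu>)"
          by (simp add: expo_scale_add add_ac)
        then have "single \<alpha> a0 ^ q * single \<zeta> z0 = single (\<mu> + expo_scale q (\<alpha> + \<nu>)) (a0 ^ q * z0)"
          by (simp add: single_power mult_single)
        then have "cart q \<psi> \<mu> (single \<alpha> a0 ^ q * single \<zeta> z0) = single (\<alpha> + \<nu>) (a0 * \<psi> z0)"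
          by (simp add: cart_single q frob_lin_scale[OF \<psi>])
        then show ?thesis unfolding \<nu> by (simp add: cart_single q mult_single)
      next
        case False
        \<comment> \<open>Because \<open>\<mu>\<close> is below \<open>q\<close>, a solution has
          \<alpha> \<le> \<nu> in every variable, so \<open>\<zeta>\<close> itself would belong to
          the class of \<open>\<mu>\<close>.\<close>
        have "expo_scale q \<alpha> + \<zeta> \<noteq> \<mu> + expo_scale q \<nu>" for \<nu>
        proof
          assume eq: "expo_scale q \<alpha> + \<zeta> = \<mu> + expo_scale q \<nu>"
          have "lookup \<zeta> v = lookup (\<mu> + expo_scale q (\<nu> - \<alpha>)) v" for v
          proof -
            have e: "q * lookup \<alpha> v + lookup \<zeta> v = lookup \<mu> v + q * lookup \<nu> v"
              using arg_cong[OF eq, of "\<lambda>m. lookup m v"] by (simp add: lookup_add)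
            then have "q * lookup \<alpha> v < q * (lookup \<nu> v + 1)" using \<mu>[of v] by simp
            then have "lookup \<alpha> v \<le> lookup \<nu> v" unfolding mult_less_cancel1 by simp
            then have "q * (lookup \<nu> v - lookup \<alpha> v) + q * lookup \<alpha> v = q * lookup \<nu> v"
              by (simp flip: distrib_left)
            with e show ?thesis by (simp add: lookup_add lookup_minus)
          qed
          then have "\<zeta> = \<mu> + expo_scale q (\<nu> - \<alpha>)" by (rule poly_mapping_eqI)
          with False show False by blast
        qed
        then show ?thesis using False
          by (simp add: single_power mult_single cart_single_0 q)
      qed
    qed (simp_all add: add distrib_left)
  qed (simp_all add: add frob distrib_right)
qed

definition expo_box :: "nat \<Rightarrow> ('v \<Rightarrow>\<^sub>0 nat) set" where
  "expo_box N = {\<mu>. \<forall>v. lookup \<mu> v < N}"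

lemma bij_betw_expo_box:
  "bij_betw lookup (expo_box N :: ('v::finite \<Rightarrow>\<^sub>0 nat) set) (PiE UNIV (\<lambda>_. {..<N}))"
proof (rule bij_betw_imageI)
  show "inj_on lookup (expo_box N :: ('v \<Rightarrow>\<^sub>0 nat) set)"
    by (rule inj_onI) (simp only: Poly_Mapping.lookup_inject)
  show "lookup ` (expo_box N :: ('v \<Rightarrow>\<^sub>0 nat) set) = PiE UNIV (\<lambda>_. {..<N})"
  proof (intro subset_antisym subsetI)
    fix f :: "'v \<Rightarrow> nat" assume f: "f \<in> PiE UNIV (\<lambda>_. {..<N})"
    have "lookup (Abs_poly_mapping f) = f" by simp
    moreover have "Abs_poly_mapping f \<in> expo_box N" using f by (auto simp: expo_box_def)
    ultimately show "f \<in> lookup ` (expo_box N :: ('v \<Rightarrow>\<^sub>0 nat) set)" by (metis imageI)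
  next
    fix f assume "f \<in> lookup ` (expo_box N :: ('v \<Rightarrow>\<^sub>0 nat) set)"
    then show "f \<in> PiE UNIV (\<lambda>_. {..<N})" by (auto simp: expo_box_def)
  qed
qed

lemma finite_expo_box [simp]: "finite (expo_box N :: ('v::finite \<Rightarrow>\<^sub>0 nat) set)"
  using bij_betw_finite[OF bij_betw_expo_box[where ?'v = 'v, of N]] by (simp add: finite_PiE)

lemma card_expo_box: "card (expo_box N :: ('v::finite \<Rightarrow>\<^sub>0 nat) set) = N ^ CARD('v)"
  using bij_betw_same_card[OF bij_betw_expo_box[where ?'v = 'v, of N]] by (simp add: card_PiE)

text \<open>On a monomial this is division of the exponents by \<open>q\<close> with remainder,
  together with a q-th root of the coefficient.\<close>

lemma cart_expansion:
  fixes \<psi> :: "'a::comm_ring_1 \<Rightarrow> 'a" and z :: "('v::finite, 'a) mpoly"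
  assumes q: "q > 0" and \<psi>: "frob_lin q \<psi>" "\<And>c. \<psi> c ^ q = c"
    and frob: "\<And>x y :: ('v, 'a) mpoly. (x + y) ^ q = x ^ q + y ^ q"
  shows "z = (\<Sum>\<mu>\<in>expo_box q. cart q \<psi> \<mu> z ^ q * single \<mu> 1)"
proof (rule additive_poly_mapping_eqI[of "\<lambda>z. z"])
  note [simp] = frob_lin_0[OF \<psi>(1)]
  show "(\<Sum>\<mu>\<in>expo_box q. cart q \<psi> \<mu> (x + y) ^ q * single \<mu> 1) =
      (\<Sum>\<mu>\<in>expo_box q. cart q \<psi> \<mu> x ^ q * single \<mu> 1) +
      (\<Sum>\<mu>\<in>expo_box q. cart q \<psi> \<mu> y ^ q * single \<mu> 1)" for x y :: "('v, 'a) mpoly"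
    by (simp add: cart_add[OF q frob_lin_add[OF \<psi>(1)]] frob distrib_right sum.distrib)
  fix \<zeta> :: "'v \<Rightarrow>\<^sub>0 nat" and c :: 'a
  define \<nu> where "\<nu> = Abs_poly_mapping (\<lambda>v. lookup \<zeta> v div q)"
  define \<mu> where "\<mu> = Abs_poly_mapping (\<lambda>v. lookup \<zeta> v mod q)"
  have lk: "lookup \<nu> v = lookup \<zeta> v div q" "lookup \<mu> v = lookup \<zeta> v mod q" for v
    by (simp_all add: \<nu>_def \<mu>_def)
  have \<zeta>: "\<zeta> = \<mu> + expo_scale q \<nu>"
    by (rule poly_mapping_eqI) (simp add: lookup_add lk)
  have \<mu>: "\<mu> \<in> expo_box q" using q by (simp add: expo_box_def lk)
  have other: "cart q \<psi> \<mu>' (single \<zeta> c) = 0" if "\<mu>' \<in> expo_box q" "\<mu>' \<noteq> \<mu>" for \<mu>'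
  proof (rule cart_single_0[OF q])
    fix \<nu>' show "\<zeta> \<noteq> \<mu>' + expo_scale q \<nu>'"
    proof
      assume eq: "\<zeta> = \<mu>' + expo_scale q \<nu>'"
      have "lookup \<mu>' v = lookup \<mu> v" for v
        using that(1) unfolding lk(2) eq by (simp add: expo_box_def lookup_add)
      then have "\<mu>' = \<mu>" by (rule poly_mapping_eqI)
      with that show False by simp
    qed
  qed simp
  have "(\<Sum>\<mu>'\<in>expo_box q. cart q \<psi> \<mu>' (single \<zeta> c) ^ q * single \<mu>' 1) =
      (\<Sum>\<mu>'\<in>{\<mu>}. cart q \<psi> \<mu>' (single \<zeta> c) ^ q * single \<mu>' 1)"
    by (rule sum.mono_neutral_right) (use \<mu> other q in \<open>auto simp: zero_power\<close>)
  also have "\<dots> = single \<zeta> c"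
    by (simp add: \<zeta> cart_single q single_power \<psi>(2) mult_single add.commute)
  finally show "single \<zeta> c = (\<Sum>\<mu>'\<in>expo_box q. cart q \<psi> \<mu>' (single \<zeta> c) ^ q * single \<mu>' 1)" ..
qed (rule refl)

text \<open>Frobenius is injective on a field, so chosen roots are unique and inherit
  additivity.\<close>

lemma perfect_root:
  assumes "prime CHAR('k::field)" "perfect_field TYPE('k::field)"
  obtains \<psi> :: "'k::field \<Rightarrow> 'k" where "frob_lin (CHAR('k) ^ e) \<psi>" "\<And>c. \<psi> c ^ CHAR('k) ^ e = c" "\<psi> 1 = 1"
proof -
  let ?p = "CHAR('k)"
  let ?q = "?p ^ e"
  have p: "?p > 0" using assms(1) prime_gt_0_nat by blast
  then have "surj (\<lambda>x :: 'k. x ^ ?p)" using assms(2) by (simp add: perfect_field_def)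
  then have root: "\<exists>y. y ^ ?p = (x :: 'k)" for x by (metis surjD)
  have "\<exists>y. y ^ ?p ^ e = (x :: 'k)" for x
  proof (induction e arbitrary: x)
    case (Suc e)
    obtain y where "y ^ ?p = x" using root by blast
    moreover obtain z where "z ^ ?p ^ e = y" using Suc by blast
    ultimately have "z ^ ?p ^ Suc e = x" by (simp only: power_Suc2 power_mult)
    then show ?case by blast
  qed simp
  then obtain \<psi> where \<psi>: "\<And>c :: 'k. \<psi> c ^ ?q = c" by metis
  note frob = frobenius_add[OF assms(1), of _ _ e]
  have inj: "x = y" if "x ^ ?q = y ^ ?q" for x y :: 'k
  proof -
    have "x ^ ?q = (x - y) ^ ?q + y ^ ?q" using frob[of "x - y" y] by simp
    with that have "(x - y) ^ ?q = 0" by simp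
    then show ?thesis by simp
  qed
  have "frob_lin ?q \<psi>" unfolding frob_lin_def
  proof (intro conjI allI)
    show "\<psi> (x + y) = \<psi> x + \<psi> y" for x y by (rule inj) (simp add: \<psi> frob)
    show "\<psi> (a ^ ?q * x) = a * \<psi> x" for a x by (rule inj) (simp add: \<psi> power_mult_distrib)
  qed
  moreover have "\<psi> 1 = 1" by (rule inj) (simp add: \<psi>)
  ultimately show ?thesis using \<psi> that by blast
qed

section \<open>Linear dependence modulo a prime ideal\<close>

text \<open>Fraction-free Gaussian elimination over the domain R / P, carried out on
  representatives.\<close>

lemma linear_dependence_mod_prime:
  fixes a :: "'x \<Rightarrow> 'y \<Rightarrow> 'a::comm_ring_1"
  assumes "finite Y" "finite X" "card Y < card X" and P: "prime_id P"
  shows "\<exists>c. (\<exists>x\<in>X. c x \<notin> P) \<and> (\<forall>y\<in>Y. (\<Sum>x\<in>X. c x * a x y) \<in> P)"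
  using assms(1-3)
proof (induction Y arbitrary: X a rule: finite_induct)
  case empty
  then have "X \<noteq> {}" by auto
  then show ?case using prime_id_one[OF P] by (intro exI[of _ "\<lambda>_. 1"]) auto
next
  case (insert y Y)
  have sub: "idl.subspace P" using P by (simp add: prime_id_def)
  show ?case
  proof (cases "\<forall>x\<in>X. a x y \<in> P")
    case True
    from insert.IH[of X a] insert.prems insert.hyps obtain c
      where c: "\<exists>x\<in>X. c x \<notin> P" "\<forall>y\<in>Y. (\<Sum>x\<in>X. c x * a x y) \<in> P" by auto
    have "(\<Sum>x\<in>X. c x * a x y) \<in> P"
      using True by (intro idl.subspace_sum[OF sub] idl.subspace_scale[OF sub]) blast
    with c show ?thesis by blast
  next
    case False
    then obtain x0 where x0: "x0 \<in> X" "a x0 y \<notin> P" by blast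
    define X' where "X' = X - {x0}"
    have X': "finite X'" "x0 \<notin> X'" "X = insert x0 X'" using insert.prems x0 by (auto simp: X'_def)
    \<comment> \<open>Cross-multiplication with the pivot row eliminates equation \<open>y\<close>
      without division.\<close>
    define a' where "a' x z = a x0 y * a x z - a x y * a x0 z" for x z
    have "card Y < card X'" using insert.prems insert.hyps X' by simp
    from insert.IH[OF X'(1) this, of a'] obtain c
      where c: "\<exists>x\<in>X'. c x \<notin> P" "\<forall>z\<in>Y. (\<Sum>x\<in>X'. c x * a' x z) \<in> P" by blast
    define s where "s = (\<Sum>x\<in>X'. c x * a x y)"
    \<comment> \<open>The pivot coefficient is chosen to solve equation \<open>y\<close>; scaling
      the others by the pivot, which is outside the prime \<open>P\<close>, keeps a coefficient
      outside \<open>P\<close>.\<close>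
    define d where "d x = (if x = x0 then - s else a x0 y * c x)" for x
    have dX: "(\<Sum>x\<in>X. d x * a x z) = (\<Sum>x\<in>X'. c x * a' x z)" for z
    proof -
      have "(\<Sum>x\<in>X. d x * a x z) = - s * a x0 z + (\<Sum>x\<in>X'. d x * a x z)"
        unfolding X'(3) by (subst sum.insert[OF X'(1,2)]) (simp add: d_def)
      also have "(\<Sum>x\<in>X'. d x * a x z) = (\<Sum>x\<in>X'. a x0 y * c x * a x z)"
        using X'(2) by (intro sum.cong refl) (auto simp: d_def)
      finally have "(\<Sum>x\<in>X. d x * a x z) = (\<Sum>x\<in>X'. a x0 y * c x * a x z) - s * a x0 z"
        by simp
      also have "\<dots> = (\<Sum>x\<in>X'. a x0 y * c x * a x z - c x * a x y * a x0 z)"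
        by (simp only: sum_subtractf s_def sum_distrib_right)
      also have "\<dots> = (\<Sum>x\<in>X'. c x * a' x z)"
        by (intro sum.cong refl) (simp only: a'_def right_diff_distrib mult_ac)
      finally show ?thesis .
    qed
    have "(\<Sum>x\<in>X'. c x * a' x y) = 0"
      by (intro sum.neutral) (simp add: a'_def mult.commute)
    then have "\<forall>z\<in>insert y Y. (\<Sum>x\<in>X. d x * a x z) \<in> P"
      unfolding dX using c(2) idl.subspace_0[OF sub] by auto
    moreover from c(1) obtain x where "x \<in> X'" "c x \<notin> P" by blast
    then have "x \<in> X" "d x \<notin> P"
      using X' prime_id_mult[OF P x0(2)] by (auto simp: d_def)
    ultimately show ?thesis by blast
  qed
qed

lemma prime_id_zero: "prime_id {0 :: 'a::idom}"
  by (auto simp: prime_id_def)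

lemma linear_dependence:
  fixes a :: "'x \<Rightarrow> 'y \<Rightarrow> 'a::idom"
  assumes "finite Y" "finite X" "card Y < card X"
  obtains c where "\<exists>x\<in>X. c x \<noteq> 0" "\<And>y. y \<in> Y \<Longrightarrow> (\<Sum>x\<in>X. c x * a x y) = 0"
  using linear_dependence_mod_prime[OF assms prime_id_zero, of a] by auto

section \<open>Generation of a ring over its Frobenius powers\<close>

text \<open>Sums of an element of \<open>A\<close> and multiples of elements of \<open>B\<close> by \<open>q\<close>-th powers.\<close>

inductive_set fspan :: "nat \<Rightarrow> 'a::comm_ring_1 set \<Rightarrow> 'a set \<Rightarrow> 'a set" for q B A where
  base: "w \<in> A \<Longrightarrow> w \<in> fspan q B A"
| step: "b \<in> B \<Longrightarrow> x \<in> fspan q B A \<Longrightarrow> a ^ q * b + x \<in> fspan q B A"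

text \<open>For an ideal \<open>A\<close>, the quotient by \<open>A\<close> has at most
  \<open>m\<close> generators over the ring of q-th powers. Adding elements of \<open>A\<close>
  within \<open>fspan\<close> avoids forming the quotient.\<close>

definition frob_gen :: "nat \<Rightarrow> 'a::comm_ring_1 set \<Rightarrow> nat \<Rightarrow> bool" where
  "frob_gen q A m \<longleftrightarrow> (\<exists>B. finite B \<and> card B \<le> m \<and> fspan q B A = UNIV)"

lemma fspan_add:
  assumes A: "idl.subspace A" and "x \<in> fspan q B A" "y \<in> fspan q B A"
  shows "x + y \<in> fspan q B A"
  using assms(2)
proof (induction rule: fspan.induct)
  case (base w)
  from assms(3) show ?case
  proof (induction rule: fspan.induct)
    case (base v)
    then show ?case using \<open>w \<in> A\<close> by (intro fspan.base idl.subspace_add[OF A])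
  next
    case (step b x a)
    have "w + (a ^ q * b + x) = a ^ q * b + (w + x)" by simp
    then show ?case by (simp only: fspan.step[OF step(1,3)])
  qed
next
  case (step b x a)
  then show ?case by (simp only: add.assoc fspan.step[OF step(1,3)])
qed

lemma fspan_scale:
  assumes A: "idl.subspace A" and "x \<in> fspan q B A"
  shows "c ^ q * x \<in> fspan q B A"
  using assms(2)
proof (induction rule: fspan.induct)
  case (base w)
  then show ?case by (intro fspan.base idl.subspace_scale[OF A])
next
  case (step b x a)
  have "c ^ q * (a ^ q * b + x) = (c * a) ^ q * b + c ^ q * x"
    by (simp add: power_mult_distrib distrib_left mult.assoc)
  then show ?case by (simp only: fspan.step[OF step(1,3)])
qed

lemma fspan_base': "idl.subspace A \<Longrightarrow> b \<in> B \<Longrightarrow> a ^ q * b \<in> fspan q B A"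
proof -
  assume "idl.subspace A" "b \<in> B"
  then have "a ^ q * b + 0 \<in> fspan q B A" by (intro fspan.step fspan.base idl.subspace_0)
  then show ?thesis by simp
qed

lemma fspan_sum:
  assumes A: "idl.subspace A" and "\<And>i. i \<in> T \<Longrightarrow> f i \<in> fspan q B A"
  shows "sum f T \<in> fspan q B A"
  using assms(2)
proof (induction T rule: infinite_finite_induct)
  case (insert x F)
  then show ?case by (simp add: fspan_add[OF A])
qed (auto intro: fspan.base idl.subspace_0[OF A])

lemma fspan_mono:
  assumes "x \<in> fspan q B A" "B \<subseteq> B'" "A \<subseteq> A'"
  shows "x \<in> fspan q B' A'"
  using assms(1)
proof (induction rule: fspan.induct)
  case (base w)
  then show ?case using assms(3) by (intro fspan.base) blast
next
  case (step b x a)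
  then show ?case using assms(2) by (intro fspan.step) blast+
qed

text \<open>Repeated uses of a generator merge, since a^q b + c^q b = (a + c)^q b.\<close>

lemma fspan_explicit:
  assumes A: "idl.subspace A" and q: "q > 0"
    and frob: "\<And>x y :: 'a::comm_ring_1. (x + y) ^ q = x ^ q + y ^ q"
    and "finite B" and "x \<in> fspan q B A"
  shows "\<exists>a. x - (\<Sum>b\<in>B. a b ^ q * b) \<in> (A :: 'a set)"
  using assms(5)
proof (induction rule: fspan.induct)
  case (base w)
  then show ?case using q by (intro exI[of _ "\<lambda>_. 0"]) (simp add: zero_power)
next
  case (step b x a)
  then obtain c where c: "x - (\<Sum>b\<in>B. c b ^ q * b) \<in> A" by blast
  have "(\<Sum>b'\<in>B. (c b' + (if b' = b then a else 0)) ^ q * b') =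
      (\<Sum>b'\<in>B. c b' ^ q * b') + (\<Sum>b'\<in>B. if b' = b then a ^ q * b' else 0)"
    unfolding sum.distrib[symmetric] frob
    using q by (intro sum.cong refl) (auto simp: zero_power distrib_right)
  also have "(\<Sum>b'\<in>B. if b' = b then a ^ q * b' else 0) = a ^ q * b"
    using step(1) \<open>finite B\<close> by (simp add: sum.delta')
  finally have "a ^ q * b + x - (\<Sum>b'\<in>B. (c b' + (if b' = b then a else 0)) ^ q * b') =
      x - (\<Sum>b\<in>B. c b ^ q * b)" by simp
  with c show ?case
    by (intro exI[of _ "\<lambda>b'. c b' + (if b' = b then a else 0)"]) (simp only:)
qed

lemma frob_gen_mono: "frob_gen q A m \<Longrightarrow> A \<subseteq> A' \<Longrightarrow> m \<le> m' \<Longrightarrow> frob_gen q A' m'"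
proof -
  assume "frob_gen q A m" and le: "A \<subseteq> A'" "m \<le> m'"
  then obtain B where B: "finite B" "card B \<le> m" "fspan q B A = UNIV"
    unfolding frob_gen_def by blast
  have "z \<in> fspan q B A'" for z
    using fspan_mono[of z q B A B A'] B(3) le(1) by simp
  then show ?thesis unfolding frob_gen_def using B le(2) by (intro exI[of _ B]) auto
qed

text \<open>Tower argument: in a^q1 b the coefficient a is expanded over q2-th powers, which
  produces the generators b c^q1. Remainders of a in \<open>A\<close> stay in \<open>A\<close>, as
  q1 > 0.\<close>

lemma frob_gen_mult:
  assumes "frob_gen q1 A m1" "frob_gen q2 A m2" and A: "idl.subspace (A :: 'a::comm_ring_1 set)" and q: "q1 > 0"
    and frob: "\<And>x y :: 'a. (x + y) ^ q1 = x ^ q1 + y ^ q1"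
  shows "frob_gen (q1 * q2) A (m1 * m2)"
proof -
  from assms(1) obtain B1 where B1: "finite B1" "card B1 \<le> m1" "fspan q1 B1 A = UNIV"
    unfolding frob_gen_def by blast
  from assms(2) obtain B2 where B2: "finite B2" "card B2 \<le> m2" "fspan q2 B2 A = UNIV"
    unfolding frob_gen_def by blast
  define B where "B = (\<lambda>(b, c). b * c ^ q1) ` (B1 \<times> B2)"
  have card: "card B \<le> m1 * m2"
  proof -
    have "card B \<le> card (B1 \<times> B2)" unfolding B_def using B1(1) B2(1) by (intro card_image_le) simp
    also have "\<dots> = card B1 * card B2" by (rule card_cartesian_product)
    also have "\<dots> \<le> m1 * m2" using B1(2) B2(2) by (rule mult_le_mono)
    finally show ?thesis .
  qed
  have gen: "a ^ q1 * b \<in> fspan (q1 * q2) B A" if b: "b \<in> B1" for a b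
  proof -
    have "a \<in> fspan q2 B2 A" using B2(3) by simp
    then show ?thesis
    proof (induction rule: fspan.induct)
      case (base w)
      then show ?case
        using subspace_power[OF A base q] by (intro fspan.base subspace_mult_right[OF A])
    next
      case (step c x a)
      have "(a ^ q2 * c + x) ^ q1 * b = a ^ (q1 * q2) * (b * c ^ q1) + x ^ q1 * b"
        by (simp only: frob power_mult_distrib power_mult[symmetric] distrib_right mult.commute[of q2])
          (simp only: mult_ac)
      moreover have "b * c ^ q1 \<in> B" using b step(1) by (auto simp: B_def)
      ultimately show ?case using fspan.step[OF _ step(3)] by (simp only:)
    qed
  qed
  have "z \<in> fspan (q1 * q2) B A" for z
  proof -
    have "z \<in> fspan q1 B1 A" using B1(3) by simp
    then show ?thesis
      by (induction rule: fspan.induct) (auto intro: fspan.base fspan_add[OF A] gen)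
  qed
  then show ?thesis unfolding frob_gen_def using card B1(1) B2(1)
    by (intro exI[of _ B]) (auto simp: B_def)
qed

lemma frob_gen_1: "frob_gen 1 (A :: 'a::comm_ring_1 set) 1" if A: "idl.subspace A"
proof -
  have "z \<in> fspan 1 {1} A" for z
    using fspan_base'[OF A, of 1 "{1}" z 1] by simp
  then show ?thesis unfolding frob_gen_def by (intro exI[of _ "{1}"]) auto
qed

lemma frob_gen_power:
  assumes "frob_gen q A m" and A: "idl.subspace (A :: 'a::comm_ring_1 set)" and q: "q > 0"
    and frob: "\<And>x y :: 'a. (x + y) ^ q = x ^ q + y ^ q"
  shows "frob_gen (q ^ j) A (m ^ j)"
proof (induction j)
  case 0
  then show ?case using frob_gen_1[OF A] by simp
next
  case (Suc j)
  from frob_gen_mult[OF assms(1) Suc A q frob] show ?case by simp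
qed

text \<open>Subadditivity along the exact sequence 0 -> R/(A : a) -> R/A -> R/(A + (a)) -> 0, whose
  first map is multiplication by \<open>a\<close>.\<close>

lemma frob_gen_extension:
  assumes "frob_gen q (idl.span (insert a A)) m1" "frob_gen q {x. a * x \<in> A} m2"
    and A: "idl.subspace (A :: 'a::comm_ring_1 set)"
  shows "frob_gen q A (m1 + m2)"
proof -
  from assms(1) obtain B1 where B1: "finite B1" "card B1 \<le> m1" "fspan q B1 (idl.span (insert a A)) = UNIV"
    unfolding frob_gen_def by blast
  from assms(2) obtain B2 where B2: "finite B2" "card B2 \<le> m2" "fspan q B2 {x. a * x \<in> A} = UNIV"
    unfolding frob_gen_def by blast
  define B where "B = B1 \<union> (*) a ` B2"
  have card: "card B \<le> m1 + m2"
    unfolding B_def using card_Un_le[of B1 "(*) a ` B2"] card_image_le[OF B2(1), of "(*) a"] B1(2) B2(2)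
    by linarith
  have mult: "a * k \<in> fspan q B A" for k
  proof -
    have "k \<in> fspan q B2 {x. a * x \<in> A}" using B2(3) by simp
    then show ?thesis
    proof (induction rule: fspan.induct)
      case (base w)
      then show ?case by (intro fspan.base) simp
    next
      case (step b x c)
      have "a * (c ^ q * b + x) = c ^ q * (a * b) + a * x" by (simp only: distrib_left mult_ac)
      moreover have "a * b \<in> B" using step(1) by (auto simp: B_def)
      ultimately show ?case using fspan.step[OF _ step(3)] by (simp only:)
    qed
  qed
  have "z \<in> fspan q B A" for z
  proof -
    have "z \<in> fspan q B1 (idl.span (insert a A))" using B1(3) by simp
    then show ?thesis
    proof (induction rule: fspan.induct)
      case (base w)
      then obtain k where k: "w - k * a \<in> idl.span A"
        by (auto simp: idl.span_breakdown_eq)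
      then have "w - k * a \<in> A" by (simp only: idl.span_eq_iff[THEN iffD2, OF A])
      then have "(w - k * a) + a * k \<in> fspan q B A"
        by (intro fspan_add[OF A] mult fspan.base)
      then show ?case by (simp add: mult.commute)
    next
      case (step b x c)
      then show ?case by (intro fspan.step) (auto simp: B_def)
    qed
  qed
  then show ?thesis unfolding frob_gen_def using card B1(1) B2(1)
    by (intro exI[of _ B]) (auto simp: B_def)
qed

text \<open>Filtering R/A by powers of \<open>h\<close>, every layer is a quotient of R/(A + (h)),
  and there are only \<open>q\<close> layers because h^q lies in \<open>A\<close>.\<close>

lemma frob_gen_remove_generator:
  assumes "frob_gen q (idl.span (insert h A)) m" and A: "idl.subspace (A :: 'a::comm_ring_1 set)"
    and h: "h ^ q \<in> A"
  shows "frob_gen q A (q * m)"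
proof -
  \<comment> \<open>For t = 0 the ideal is the whole ring and no generator is required; for t = q it
    is \<open>A\<close> itself.\<close>
  have "frob_gen q (idl.span (insert (h ^ t) A)) (t * m)" for t
  proof (induction t)
    case 0
    have "z \<in> idl.span (insert 1 A)" for z
      using idl.span_scale[OF idl.span_base[of 1 "insert 1 A"], of z] by simp
    then have "fspan q {} (idl.span (insert 1 A)) = UNIV" by (auto intro: fspan.base)
    then show ?case unfolding frob_gen_def by (intro exI[of _ "{}"]) simp
  next
    case (Suc t)
    let ?A = "idl.span (insert (h ^ Suc t) A)"
    have "insert (h ^ t) A \<subseteq> idl.span (insert (h ^ t) ?A)"
      by (meson idl.span_base insert_subset insertCI subset_iff insertI1)
    then have "idl.span (insert (h ^ t) A) \<subseteq> idl.span (insert (h ^ t) ?A)"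
      by (rule idl.span_minimal) simp
    from frob_gen_mono[OF Suc this order_refl]
    have 1: "frob_gen q (idl.span (insert (h ^ t) ?A)) (t * m)" .
    have "idl.subspace {x. h ^ t * x \<in> ?A}"
      unfolding idl.subspace_def
      by (auto simp: distrib_left idl.span_zero idl.span_add mult.left_commute intro: idl.span_scale)
    moreover have "insert h A \<subseteq> {x. h ^ t * x \<in> ?A}"
      using idl.span_base[of "h ^ Suc t" "insert (h ^ Suc t) A"]
      by (auto simp: mult.commute intro!: idl.span_base idl.subspace_scale[OF A] subspace_mult_right[OF A])
    ultimately have "idl.span (insert h A) \<subseteq> {x. h ^ t * x \<in> ?A}"
      by (intro idl.span_minimal)
    from frob_gen_mono[OF assms(1) this order_refl]
    have 2: "frob_gen q {x. h ^ t * x \<in> ?A} m" .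
    from frob_gen_extension[OF 1 2] show ?case by (simp add: add.commute)
  qed
  from this[of q] show ?thesis
    using h by (simp only: insert_absorb idl.span_eq_iff[THEN iffD2, OF A])
qed

lemma frob_gen_remove_generators:
  assumes "frob_gen q (idl.span (set hs \<union> A)) m" and A: "idl.subspace (A :: 'a::comm_ring_1 set)"
    and "\<And>h. h \<in> set hs \<Longrightarrow> h ^ q \<in> A"
  shows "frob_gen q A (q ^ length hs * m)"
  using assms(1,3)
proof (induction hs arbitrary: m)
  case Nil
  then show ?case by (simp add: idl.span_eq_iff[THEN iffD2, OF A])
next
  case (Cons h hs)
  let ?A = "idl.span (set hs \<union> A)"
  have "h ^ q \<in> ?A" using Cons.prems(2)[of h] by (intro idl.span_base) simp
  moreover have "set (h # hs) \<union> A \<subseteq> idl.span (insert h ?A)"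
    by (auto intro: idl.span_base)
  then have "idl.span (set (h # hs) \<union> A) \<subseteq> idl.span (insert h ?A)"
    by (rule idl.span_minimal) simp
  from frob_gen_mono[OF Cons.prems(1) this order_refl]
  have "frob_gen q (idl.span (insert h ?A)) m" .
  ultimately have "frob_gen q ?A (q * m)" by (intro frob_gen_remove_generator) auto
  from Cons.IH[OF this] Cons.prems(2) show ?case by (simp add: mult_ac)
qed

section \<open>Heights in polynomial rings\<close>

lemma mconst_simps [simp]:
  "mconst 0 = 0" "mconst 1 = 1" "mconst (a + b) = mconst a + mconst b"
  "mconst (a * b) = mconst a * mconst b" "mconst (- a) = - mconst a"
  "mconst (a - b) = mconst a - mconst b"
  by (simp_all add: mconst_def single_add mult_single single_uminus single_diff)

lemma mconst_power: "mconst (a ^ n) = mconst a ^ n"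
  by (induction n) simp_all

lemma mconst_sum: "mconst (sum f A) = (\<Sum>x\<in>A. mconst (f x))"
  by (induction A rule: infinite_finite_induct) simp_all

lemma lookup_mconst_mult [simp]: "lookup (mconst c * z) \<mu> = c * lookup z \<mu>"
  unfolding mconst_def mult_map_scale_conv_mult[symmetric]
  by (simp add: Poly_Mapping.map.rep_eq when_def)

section \<open>Polynomials of bounded degree and their independence modulo primes\<close>

lemma frobenius_add_mpoly:
  fixes x y :: "('v, 'k::field) mpoly"
  assumes "prime CHAR('k)"
  shows "(x + y) ^ CHAR('k) ^ e = x ^ CHAR('k) ^ e + y ^ CHAR('k) ^ e"
  using frobenius_add[where ?'a = "('v, 'k) mpoly", of x y e] assms
  by (simp add: CHAR_poly_mapping)

text \<open>Degree at most \<open>N\<close> in each variable separately: in n variables there are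
  exactly (N + 1)^n monomials, and for N = q - 1 they are the monomial basis over q-th
  powers.\<close>

definition poly_box :: "nat \<Rightarrow> ('v, 'a::zero) mpoly set" where
  "poly_box N = {z. keys z \<subseteq> expo_box (Suc N)}"

lemma poly_box_mult: "z \<in> poly_box M \<Longrightarrow> w \<in> poly_box N \<Longrightarrow> z * w \<in> poly_box (M + N)"
proof -
  assume z: "z \<in> poly_box M" and w: "w \<in> poly_box N"
  have "\<kappa> \<in> expo_box (Suc (M + N))" if "\<kappa> \<in> keys (z * w)" for \<kappa>
  proof -
    from that keys_mult obtain a b where ab: "\<kappa> = a + b" "a \<in> keys z" "b \<in> keys w" by blast
    then have "lookup a v \<le> M" "lookup b v \<le> N" for v
      using z w by (auto simp: poly_box_def expo_box_def less_Suc_eq_le)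
    then show ?thesis
      unfolding ab(1) expo_box_def by (auto simp: lookup_add less_Suc_eq_le add_mono)
  qed
  then show ?thesis by (auto simp: poly_box_def)
qed

lemma poly_box_mono: "z \<in> poly_box M \<Longrightarrow> M \<le> N \<Longrightarrow> z \<in> poly_box N"
proof -
  assume z: "z \<in> poly_box M" and "M \<le> N"
  then have "expo_box (Suc M) \<subseteq> expo_box (Suc N)"
    by (auto simp: expo_box_def intro: less_le_trans)
  with z show ?thesis by (auto simp: poly_box_def)
qed

lemma poly_box_1: "1 \<in> poly_box N"
  by (simp add: poly_box_def expo_box_def)

lemma poly_box_power: "z \<in> poly_box D \<Longrightarrow> z ^ n \<in> poly_box (D * n)"
proof (induction n)
  case (Suc n)
  then show ?case using poly_box_mult[of z D "z ^ n" "D * n"] by simp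
qed (simp add: poly_box_1)

lemma poly_box_exists: "\<exists>N. (z :: ('v::finite, 'a::zero) mpoly) \<in> poly_box N"
proof -
  have "lookup \<mu> v < Suc (Max ((\<lambda>(\<mu>, v). lookup \<mu> v) ` (keys z \<times> UNIV)))" if "\<mu> \<in> keys z" for \<mu> v
    unfolding less_Suc_eq_le using that by (intro Max_ge) force+
  then show ?thesis unfolding poly_box_def expo_box_def by blast
qed

lemma lookup_outside_poly_box: "z \<in> poly_box N \<Longrightarrow> \<mu> \<notin> expo_box (Suc N) \<Longrightarrow> lookup z \<mu> = 0"
  by (auto simp: poly_box_def in_keys_iff)

text \<open>Linear independence over the field modulo \<open>P\<close>. The largest possible
  \<open>g\<close> is a Hilbert function of R/P for the filtration by boxes.\<close>

definition indep_mod :: "('v, 'k::field) mpoly set \<Rightarrow> nat \<Rightarrow> nat \<Rightarrow> (nat \<Rightarrow> ('v, 'k) mpoly) \<Rightarrow> bool" where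
  "indep_mod P N g b \<longleftrightarrow> (\<forall>i<g. b i \<in> poly_box N) \<and>
     (\<forall>c. (\<Sum>i<g. mconst (c i) * b i) \<in> P \<longrightarrow> (\<forall>i<g. c i = 0))"

lemma indep_mod_bound:
  fixes P :: "('v::finite, 'k::field) mpoly set"
  assumes P: "0 \<in> P" and ind: "indep_mod P N g b"
  shows "g \<le> (N + 1) ^ CARD('v)"
proof (rule ccontr)
  assume "\<not> ?thesis"
  then have "card (expo_box (Suc N) :: ('v \<Rightarrow>\<^sub>0 nat) set) < card {..<g}"
    by (simp add: card_expo_box)
  from linear_dependence[OF finite_expo_box finite_lessThan this, of "\<lambda>i. lookup (b i)"]
  obtain c where c: "\<exists>i\<in>{..<g}. c i \<noteq> 0"
    "\<And>\<mu>. \<mu> \<in> expo_box (Suc N) \<Longrightarrow> (\<Sum>i<g. c i * lookup (b i) \<mu>) = 0" by blast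
  have "(\<Sum>i<g. mconst (c i) * b i) = 0"
  proof (rule poly_mapping_eqI)
    fix \<mu>
    show "lookup (\<Sum>i<g. mconst (c i) * b i) \<mu> = lookup 0 \<mu>"
    proof (cases "\<mu> \<in> expo_box (Suc N)")
      case True
      then show ?thesis using c(2) by (simp add: lookup_sum)
    next
      case False
      then have "lookup (b i) \<mu> = 0" if "i < g" for i
        using ind that by (intro lookup_outside_poly_box) (auto simp: indep_mod_def)
      then show ?thesis by (simp add: lookup_sum)
    qed
  qed
  with ind P have "\<forall>i<g. c i = 0" unfolding indep_mod_def by metis
  with c(1) show False by auto
qed

text \<open>Modulo \<open>P'\<close> only the power y^0 survives, so its coefficients vanish; then a
  factor \<open>y\<close>, which is outside the prime \<open>P\<close>, is cancelled and the
  argument repeats.\<close>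

lemma indep_mod_powers:
  fixes y :: "('v, 'k::field) mpoly"
  assumes P: "prime_id P" and P': "idl.subspace P'" "P \<subseteq> P'" and y: "y \<in> P'" "y \<notin> P"
    and ind: "\<And>c. (\<Sum>t<g. mconst (c t) * b t) \<in> P' \<Longrightarrow> \<forall>t<g. c t = 0"
  shows "(\<Sum>j<J. y ^ j * (\<Sum>t<g. mconst (c j t) * b t)) \<in> P \<Longrightarrow> \<forall>j<J. \<forall>t<g. c j t = 0"
proof (induction J arbitrary: c)
  case (Suc J)
  define S where "S = (\<Sum>j<J. y ^ j * (\<Sum>t<g. mconst (c (Suc j) t) * b t))"
  have eq: "(\<Sum>j<Suc J. y ^ j * (\<Sum>t<g. mconst (c j t) * b t)) = (\<Sum>t<g. mconst (c 0 t) * b t) + y * S"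
    unfolding S_def sum_distrib_left by (simp add: sum.lessThan_Suc_shift mult.assoc del: sum.lessThan_Suc)
  have "(\<Sum>t<g. mconst (c 0 t) * b t) + y * S \<in> P'"
    using Suc.prems P'(2) unfolding eq by blast
  moreover have "y * S \<in> P'" by (rule subspace_mult_right[OF P'(1) y(1)])
  ultimately have "(\<Sum>t<g. mconst (c 0 t) * b t) \<in> P'"
    using idl.subspace_diff[OF P'(1)] by fastforce
  then have 0: "\<forall>t<g. c 0 t = 0" by (rule ind)
  then have "y * S \<in> P" using Suc.prems unfolding eq by simp
  then have "S \<in> P" using P y(2) by (auto simp: prime_id_def)
  then have "\<forall>j<J. \<forall>t<g. c (Suc j) t = 0" unfolding S_def by (rule Suc.IH)
  with 0 show ?case by (metis Suc_less_eq gr0_conv_Suc neq0_conv)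
qed simp

text \<open>One step down a chain multiplies the size of a family by \<open>J\<close> while its
  degree grows by at most D J. The index i encodes the pair (i div g, i mod g).\<close>

lemma indep_mod_step:
  fixes y :: "('v, 'k::field) mpoly"
  assumes P: "prime_id P" and P': "idl.subspace P'" "P \<subseteq> P'" and y: "y \<in> P'" "y \<notin> P" "y \<in> poly_box D"
    and ind: "indep_mod P' N g b"
  shows "indep_mod P (N + D * J) (J * g) (\<lambda>i. y ^ (i div g) * b (i mod g))"
  unfolding indep_mod_def
proof (intro conjI allI impI)
  fix i assume i: "i < J * g"
  then have "g > 0" by (cases g) simp_all
  with i have "i div g < J" "i mod g < g" by (simp_all add: less_mult_imp_div_less)
  then have "y ^ (i div g) * b (i mod g) \<in> poly_box (D * (i div g) + N)"
    using ind by (intro poly_box_mult poly_box_power y) (auto simp: indep_mod_def)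
  then show "y ^ (i div g) * b (i mod g) \<in> poly_box (N + D * J)"
    using \<open>i div g < J\<close> by (elim poly_box_mono) simp
next
  fix c i
  assume S: "(\<Sum>i<J * g. mconst (c i) * (y ^ (i div g) * b (i mod g))) \<in> P" and i: "i < J * g"
  then have "g > 0" by (cases g) simp_all
  with i have ig: "i div g < J" "i mod g < g" by (simp_all add: less_mult_imp_div_less)
  have "(\<Sum>i<J * g. mconst (c i) * (y ^ (i div g) * b (i mod g))) =
      (\<Sum>j<J. \<Sum>i\<in>{j * g..<j * g + g}. mconst (c i) * (y ^ (i div g) * b (i mod g)))"
    by (rule sum.nat_group[symmetric])
  also have "\<dots> = (\<Sum>j<J. y ^ j * (\<Sum>t<g. mconst (c (j * g + t)) * b t))"
  proof (intro sum.cong refl)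
    fix j
    have "(\<Sum>i\<in>{j * g..<j * g + g}. mconst (c i) * (y ^ (i div g) * b (i mod g))) =
        (\<Sum>t<g. mconst (c (j * g + t)) * (y ^ ((j * g + t) div g) * b ((j * g + t) mod g)))"
      by (rule sum.reindex_bij_witness[of _ "\<lambda>t. j * g + t" "\<lambda>i. i - j * g"]) auto
    also have "\<dots> = (\<Sum>t<g. y ^ j * (mconst (c (j * g + t)) * b t))"
      by (intro sum.cong refl) (simp add: mult.left_commute)
    finally show "(\<Sum>i\<in>{j * g..<j * g + g}. mconst (c i) * (y ^ (i div g) * b (i mod g))) =
        y ^ j * (\<Sum>t<g. mconst (c (j * g + t)) * b t)"
      by (simp add: sum_distrib_left)
  qed
  finally have "(\<Sum>j<J. y ^ j * (\<Sum>t<g. mconst (c (j * g + t)) * b t)) \<in> P" using S by simp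
  moreover have "\<forall>t<g. c t = 0" if "(\<Sum>t<g. mconst (c t) * b t) \<in> P'" for c
    using ind that by (auto simp: indep_mod_def)
  ultimately have "\<forall>j<J. \<forall>t<g. c (j * g + t) = 0"
    using indep_mod_powers[OF P P' y(1,2), where b = b and g = g and J = J and c = "\<lambda>j t. c (j * g + t)"] by blast
  with ig have "c (i div g * g + i mod g) = 0" by blast
  then show "c i = 0" by simp
qed

text \<open>Counting form of height P + dim R/P \<le> n, stated multiplicatively to avoid the
  exponent n - c. It iterates the step from one prime of the chain to the next smaller one.\<close>

lemma indep_mod_chain:
  fixes C :: "nat \<Rightarrow> ('v::finite, 'k::field) mpoly set"
  assumes C: "\<And>i. i \<le> c \<Longrightarrow> prime_id (C i)" "\<And>i. i < c \<Longrightarrow> C i \<subset> C (Suc i)"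
  shows "\<exists>D. \<forall>N g b. indep_mod (C c) N g b \<longrightarrow> g * (N + 1) ^ c \<le> D * (N + 1) ^ CARD('v)"
proof -
  have "\<exists>D. \<forall>N g b J. indep_mod (C i) N g b \<longrightarrow> g * J ^ i \<le> (N + D * J + 1) ^ CARD('v)" if "i \<le> c" for i
    using that
  proof (induction i)
    case 0
    have "0 \<in> C 0" using C(1)[of 0] by (simp add: prime_id_def idl.subspace_0)
    then have "\<forall>N g b J. indep_mod (C 0) N g b \<longrightarrow> g * J ^ 0 \<le> (N + 0 * J + 1) ^ CARD('v)"
      using indep_mod_bound[of "C 0"] by simp
    then show ?case by blast
  next
    case (Suc i)
    then obtain D where D: "\<And>N g b J. indep_mod (C i) N g b \<Longrightarrow> g * J ^ i \<le> (N + D * J + 1) ^ CARD('v)"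
      by auto
    obtain y where y: "y \<in> C (Suc i)" "y \<notin> C i" using C(2)[of i] Suc.prems by auto
    obtain D' where D': "y \<in> poly_box D'" using poly_box_exists by blast
    have "g * J ^ Suc i \<le> (N + (D + D') * J + 1) ^ CARD('v)" if "indep_mod (C (Suc i)) N g b" for N g b J
    proof -
      have "indep_mod (C i) (N + D' * J) (J * g) (\<lambda>i. y ^ (i div g) * b (i mod g))"
        using C(1)[of i] C(1)[of "Suc i"] C(2)[of i] Suc.prems y D' that
        by (intro indep_mod_step[of "C i" "C (Suc i)"]) (auto simp: prime_id_def)
      from D[OF this, of J] show ?thesis by (simp add: algebra_simps)
    qed
    then show ?case by blast
  qed
  from this[of c] obtain D where D: "\<And>N g b J. indep_mod (C c) N g b \<Longrightarrow> g * J ^ c \<le> (N + D * J + 1) ^ CARD('v)"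
    by auto
  \<comment> \<open>The free parameter J is set to N + 1, so that N + D J + 1 = (D + 1) (N +
    1).\<close>
  have "g * (N + 1) ^ c \<le> (D + 1) ^ CARD('v) * (N + 1) ^ CARD('v)" if "indep_mod (C c) N g b" for N g b
  proof -
    have "N + D * (N + 1) + 1 = (D + 1) * (N + 1)" by simp
    then show ?thesis using D[OF that, of "N + 1"] by (simp only: power_mult_distrib)
  qed
  then show ?thesis by blast
qed

text \<open>The single element 1 is independent modulo a prime, so (N + 1)^c \<le> D (N + 1)^n for
  all N; the choice N = D refutes c > n.\<close>

lemma chain_length_le_dim:
  fixes C :: "nat \<Rightarrow> ('v::finite, 'k::field) mpoly set"
  assumes C: "\<And>i. i \<le> c \<Longrightarrow> prime_id (C i)" "\<And>i. i < c \<Longrightarrow> C i \<subset> C (Suc i)"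
  shows "c \<le> CARD('v)"
proof (rule ccontr)
  assume "\<not> ?thesis"
  then have n: "Suc CARD('v) \<le> c" by simp
  have P: "prime_id (C c)" using C(1) by simp
  have ind: "indep_mod (C c) N 1 (\<lambda>_. 1)" for N
    unfolding indep_mod_def
  proof (intro conjI allI impI)
    fix a :: "nat \<Rightarrow> 'k" and i :: nat
    assume a: "(\<Sum>i<1. mconst (a i) * 1) \<in> C c" and i: "i < 1"
    show "a i = 0"
    proof (rule ccontr)
      assume a0: "a i \<noteq> 0"
      have "mconst (inverse (a i)) * mconst (a i) \<in> C c"
        using a i P by (intro idl.subspace_scale) (auto simp: prime_id_def)
      then have "mconst (inverse (a i) * a i) \<in> C c" by (simp only: mconst_simps)
      then show False using a0 prime_id_one[OF P] by simp
    qed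
  qed (simp add: poly_box_1)
  obtain D :: nat where D: "\<And>N. 1 * (N + 1) ^ c \<le> D * (N + 1) ^ CARD('v)"
    using indep_mod_chain[of c C, OF C] ind by blast
  have "(D + 1) ^ Suc CARD('v) \<le> (D + 1) ^ c" using n by (intro power_increasing) auto
  also have "\<dots> \<le> D * (D + 1) ^ CARD('v)" using D[of D] by simp
  finally show False by simp
qed

section \<open>Generators over Frobenius powers and Krull's height theorem\<close>

lemma single_expansion_UNIV:
  fixes A :: "('v::finite, 'k::field) mpoly set"
  assumes p: "prime CHAR('k)" and perf: "perfect_field TYPE('k)" and A: "idl.subspace A"
    and mem: "\<And>\<mu>. \<mu> \<in> expo_box (CHAR('k) ^ e) \<Longrightarrow> single \<mu> 1 \<in> fspan (CHAR('k) ^ e) B A"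
  shows "fspan (CHAR('k) ^ e) B A = UNIV"
proof -
  have q: "CHAR('k) ^ e > 0" using prime_gt_0_nat[OF p] by simp
  obtain \<psi> :: "'k \<Rightarrow> 'k" where \<psi>: "frob_lin (CHAR('k) ^ e) \<psi>" "\<And>c. \<psi> c ^ CHAR('k) ^ e = c"
    using perfect_root[OF p perf] by blast
  have "z \<in> fspan (CHAR('k) ^ e) B A" for z
    by (subst cart_expansion[OF q \<psi> frobenius_add_mpoly[OF p], of z])
      (intro fspan_sum[OF A] fspan_scale[OF A] mem)
  then show ?thesis by blast
qed

text \<open>A maximal independent family of degree q - 1 spans all box monomials over the field
  modulo the prime. Constants are q-th powers by perfectness, so the family generates over q-th
  powers.\<close>

lemma frob_gen_chain:
  fixes C :: "nat \<Rightarrow> ('v::finite, 'k::field) mpoly set"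
  assumes p: "prime CHAR('k)" and perf: "perfect_field TYPE('k)"
    and C: "\<And>i. i \<le> c \<Longrightarrow> prime_id (C i)" "\<And>i. i < c \<Longrightarrow> C i \<subset> C (Suc i)"
  shows "\<exists>D. \<forall>e. \<exists>m. frob_gen (CHAR('k) ^ e) (C c) m \<and>
    m * (CHAR('k) ^ e) ^ c \<le> D * (CHAR('k) ^ e) ^ CARD('v)"
proof -
  obtain D where D: "\<And>N g b. indep_mod (C c) N g b \<Longrightarrow> g * (N + 1) ^ c \<le> D * (N + 1) ^ CARD('v)"
    using indep_mod_chain[of c C, OF C] by blast
  have sub: "idl.subspace (C c)" using C(1)[of c] by (simp add: prime_id_def)
  have "\<exists>m. frob_gen (CHAR('k) ^ e) (C c) m \<and>
      m * (CHAR('k) ^ e) ^ c \<le> D * (CHAR('k) ^ e) ^ CARD('v)" for e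
  proof -
    let ?q = "CHAR('k) ^ e"
    have q: "?q > 0" using prime_gt_0_nat[OF p] by simp
    define N where "N = ?q - 1"
    have N: "N + 1 = ?q" "Suc N = ?q" using q by (simp_all add: N_def)
    define G where "G = {g. \<exists>b. indep_mod (C c) N g b}"
    have "G \<subseteq> {..(N + 1) ^ CARD('v)}"
      using indep_mod_bound[OF idl.subspace_0[OF sub]] by (auto simp: G_def)
    then have "finite G" using finite_subset by blast
    moreover have "0 \<in> G" by (simp add: G_def indep_mod_def)
    ultimately obtain g where g: "g \<in> G" "\<And>g'. g' \<in> G \<Longrightarrow> g' \<le> g"
      by (metis Max_ge Max_in empty_iff)
    then obtain b where b: "indep_mod (C c) N g b" unfolding G_def by blast
    obtain \<psi> :: "'k \<Rightarrow> 'k" where \<psi>: "frob_lin ?q \<psi>" "\<And>c. \<psi> c ^ ?q = c"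
      using perfect_root[OF p perf] by blast
    have const: "mconst a * b i \<in> fspan ?q (b ` {..<g}) (C c)" if "i < g" for a i
    proof -
      have "mconst (\<psi> a) ^ ?q * b i \<in> fspan ?q (b ` {..<g}) (C c)"
        using that by (intro fspan_base'[OF sub]) simp
      then show ?thesis by (simp only: mconst_power[symmetric] \<psi>(2))
    qed
    have "single \<mu> 1 \<in> fspan ?q (b ` {..<g}) (C c)" if \<mu>: "\<mu> \<in> expo_box ?q" for \<mu> :: "'v \<Rightarrow>\<^sub>0 nat"
    proof -
      \<comment> \<open>Appending the monomial contradicts maximality of \<open>g\<close> unless a
        dependence exists; its last coefficient is nonzero since \<open>b\<close> is
        independent.\<close>
      define b' where "b' = b(g := single \<mu> 1)"
      have "\<not> indep_mod (C c) N (Suc g) b'" using g(2)[of "Suc g"] by (auto simp: G_def)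
      moreover have "\<forall>i<Suc g. b' i \<in> poly_box N"
        using b \<mu> by (auto simp: b'_def indep_mod_def poly_box_def N less_Suc_eq)
      ultimately obtain a where a: "(\<Sum>i<Suc g. mconst (a i) * b' i) \<in> C c" "\<exists>i<Suc g. a i \<noteq> 0"
        unfolding indep_mod_def by blast
      have S: "(\<Sum>i<Suc g. mconst (a i) * b' i) = (\<Sum>i<g. mconst (a i) * b i) + mconst (a g) * single \<mu> 1"
        by (simp add: b'_def)
      have ag: "a g \<noteq> 0"
      proof
        assume "a g = 0"
        then have "\<forall>i<g. a i = 0" using a(1) b unfolding S indep_mod_def by simp
        with \<open>a g = 0\<close> a(2) show False by (auto simp: less_Suc_eq)
      qed
      have "mconst (inverse (a g)) * ((\<Sum>i<g. mconst (a i) * b i) + mconst (a g) * single \<mu> 1) +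
          (\<Sum>i<g. mconst (- (inverse (a g) * a i)) * b i) = mconst (inverse (a g) * a g) * single \<mu> 1"
        by (simp add: distrib_left sum_distrib_left sum_negf mult.assoc)
      then have eq: "single \<mu> 1 = mconst (inverse (a g)) * ((\<Sum>i<g. mconst (a i) * b i) + mconst (a g) * single \<mu> 1) +
          (\<Sum>i<g. mconst (- (inverse (a g) * a i)) * b i)" using ag by simp
      show ?thesis
        by (subst eq, intro fspan_add[OF sub] fspan_sum[OF sub] const fspan.base idl.subspace_scale[OF sub])
          (use a(1) in \<open>simp_all only: S lessThan_iff\<close>)
    qed
    then have "fspan ?q (b ` {..<g}) (C c) = UNIV" by (rule single_expansion_UNIV[OF p perf sub])
    then have "frob_gen ?q (C c) g"
      unfolding frob_gen_def using card_image_le[of "{..<g}" b] by (intro exI[of _ "b ` {..<g}"]) auto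
    moreover have "g * ?q ^ c \<le> D * ?q ^ CARD('v)" using D[OF b] by (simp only: N)
    ultimately show ?thesis by blast
  qed
  then show ?thesis by blast
qed

text \<open>A prime of height greater than \<open>r\<close> is small in this sense, a proper ideal with \<open>r\<close> generators is not.\<close>

definition small_frob_gen :: "nat \<Rightarrow> ('v, 'k::field) mpoly set \<Rightarrow> bool" where
  "small_frob_gen r A \<longleftrightarrow> (\<exists>e>0. \<exists>m. frob_gen (CHAR('k) ^ e) A m \<and>
     m * (CHAR('k) ^ e) ^ r < (CHAR('k) ^ e) ^ CARD('v))"

text \<open>High powers amplify a strict inequality enough to absorb the factor 2 that arises when
  two bounds are added.\<close>

lemma double_power_less:
  assumes "u1 < (v1 :: nat)" "u2 < (v2 :: nat)"
  shows "\<exists>j>0. 2 * u1 ^ j < v1 ^ j \<and> 2 * u2 ^ j < v2 ^ j"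
proof -
  have "eventually (\<lambda>j. 2 * u ^ j < v ^ j) sequentially" if "u < v" for u v :: nat
  proof -
    have "(\<lambda>j. (real u / real v) ^ j) \<longlonglongrightarrow> 0"
      using that by (intro LIMSEQ_power_zero) simp
    then have "eventually (\<lambda>j. (real u / real v) ^ j < 1 / 2) sequentially"
      by (rule order_tendstoD) simp
    then show ?thesis
    proof (rule eventually_mono)
      fix j assume "(real u / real v) ^ j < 1 / 2"
      then have "real (2 * u ^ j) < real (v ^ j)"
        using that by (simp add: power_divide field_simps)
      then show "2 * u ^ j < v ^ j" by (simp only: of_nat_less_iff)
    qed
  qed
  then have "eventually (\<lambda>j. 2 * u1 ^ j < v1 ^ j \<and> 2 * u2 ^ j < v2 ^ j) sequentially"
    using assms by (intro eventually_conj)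
  then obtain j where "2 * u1 ^ j < v1 ^ j \<and> 2 * u2 ^ j < v2 ^ j"
    unfolding eventually_sequentially by blast
  then show ?thesis by (intro exI[of _ j]) (cases j; simp)
qed

text \<open>Both bounds are raised to powers until they concern the same Frobenius exponent
  \<open>e = e1 * e2 * j\<close>; the extra \<open>j\<close> makes each count less than half of what
  is allowed.\<close>

lemma small_frob_gen_extension:
  fixes A :: "('v::finite, 'k::field) mpoly set"
  assumes p: "prime CHAR('k)" and A: "idl.subspace A"
    and 1: "small_frob_gen r (idl.span (insert a A))" and 2: "small_frob_gen r {x. a * x \<in> A}"
  shows "small_frob_gen r A"
proof -
  let ?p = "CHAR('k)" and ?n = "CARD('v)"
  have p0: "?p ^ e > 0" for e using prime_gt_0_nat[OF p] by simp
  note frob = frobenius_add_mpoly[OF p]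
  from 1 obtain e1 m1 where 1: "e1 > 0" "frob_gen (?p ^ e1) (idl.span (insert a A)) m1"
    "m1 * (?p ^ e1) ^ r < (?p ^ e1) ^ ?n" unfolding small_frob_gen_def by blast
  from 2 obtain e2 m2 where 2: "e2 > 0" "frob_gen (?p ^ e2) {x. a * x \<in> A} m2"
    "m2 * (?p ^ e2) ^ r < (?p ^ e2) ^ ?n" unfolding small_frob_gen_def by blast
  have "(m1 * (?p ^ e1) ^ r) ^ e2 < ((?p ^ e1) ^ ?n) ^ e2" "(m2 * (?p ^ e2) ^ r) ^ e1 < ((?p ^ e2) ^ ?n) ^ e1"
    using 1 2 by (simp_all add: power_strict_mono)
  from double_power_less[OF this] obtain j where j: "j > 0"
    "2 * ((m1 * (?p ^ e1) ^ r) ^ e2) ^ j < (((?p ^ e1) ^ ?n) ^ e2) ^ j"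
    "2 * ((m2 * (?p ^ e2) ^ r) ^ e1) ^ j < (((?p ^ e2) ^ ?n) ^ e1) ^ j" by blast
  define e where "e = e1 * e2 * j"
  have e: "(?p ^ e1) ^ (e2 * j) = ?p ^ e" "(?p ^ e2) ^ (e1 * j) = ?p ^ e"
    by (simp_all add: e_def power_mult[symmetric] mult_ac)
  have sub2: "idl.subspace {x. a * x \<in> A}"
    using A unfolding idl.subspace_def
    by (auto simp: distrib_left mult.left_commute[of a])
  have "frob_gen (?p ^ e) (idl.span (insert a A)) (m1 ^ (e2 * j))"
    using frob_gen_power[OF 1(2) idl.subspace_span p0 frob, of "e2 * j"] by (simp only: e)
  moreover have "frob_gen (?p ^ e) {x. a * x \<in> A} (m2 ^ (e1 * j))"
    using frob_gen_power[OF 2(2) sub2 p0 frob, of "e1 * j"] by (simp only: e)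
  ultimately have "frob_gen (?p ^ e) A (m1 ^ (e2 * j) + m2 ^ (e1 * j))"
    by (rule frob_gen_extension[OF _ _ A])
  moreover have "(m1 ^ (e2 * j) + m2 ^ (e1 * j)) * (?p ^ e) ^ r < (?p ^ e) ^ ?n"
  proof -
    have "((m1 * (?p ^ e1) ^ r) ^ e2) ^ j = m1 ^ (e2 * j) * ((?p ^ e1) ^ (e2 * j)) ^ r"
      by (simp only: power_mult[symmetric] power_mult_distrib mult_ac)
    moreover have "(((?p ^ e1) ^ ?n) ^ e2) ^ j = ((?p ^ e1) ^ (e2 * j)) ^ ?n"
      by (simp only: power_mult[symmetric] mult_ac)
    moreover have "((m2 * (?p ^ e2) ^ r) ^ e1) ^ j = m2 ^ (e1 * j) * ((?p ^ e2) ^ (e1 * j)) ^ r"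
      by (simp only: power_mult[symmetric] power_mult_distrib mult_ac)
    moreover have "(((?p ^ e2) ^ ?n) ^ e1) ^ j = ((?p ^ e2) ^ (e1 * j)) ^ ?n"
      by (simp only: power_mult[symmetric] mult_ac)
    ultimately show ?thesis using j(2,3) unfolding e by (simp add: distrib_right)
  qed
  moreover have "e > 0" using 1(1) 2(1) j(1) by (simp add: e_def)
  ultimately show ?thesis unfolding small_frob_gen_def by blast
qed

lemma fspan_Union:
  assumes "x \<in> fspan q B (\<Union>\<C>)"
  shows "\<exists>A\<in>\<C>. x \<in> fspan q B A"
  using assms
proof (induction rule: fspan.induct)
  case (base w)
  then show ?case by (auto intro: fspan.base)
next
  case (step b x a)
  then show ?case by (blast intro: fspan.step)
qed

text \<open>Generation is certified by finitely many box monomials, and one member of the chain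
  carries all their certificates. This makes Zorn's lemma applicable to ideals that are not
  small.\<close>

lemma small_frob_gen_Union:
  fixes \<C> :: "('v::finite, 'k::field) mpoly set set"
  assumes p: "prime CHAR('k)" and perf: "perfect_field TYPE('k)"
    and C: "subset.chain UNIV \<C>" "\<C> \<noteq> {}" "\<And>A. A \<in> \<C> \<Longrightarrow> idl.subspace A"
    and small: "small_frob_gen r (\<Union>\<C>)"
  shows "\<exists>A\<in>\<C>. small_frob_gen r A"
proof -
  from small obtain e m where e: "e > 0" "frob_gen (CHAR('k) ^ e) (\<Union>\<C>) m"
    "m * (CHAR('k) ^ e) ^ r < (CHAR('k) ^ e) ^ CARD('v)" unfolding small_frob_gen_def by blast
  from e(2) obtain B where B: "finite B" "card B \<le> m" "fspan (CHAR('k) ^ e) B (\<Union>\<C>) = UNIV"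
    unfolding frob_gen_def by blast
  have "\<exists>A\<in>\<C>. T \<subseteq> fspan (CHAR('k) ^ e) B A" if "finite T" for T
    using that
  proof (induction T rule: finite_induct)
    case empty
    then show ?case using C(2) by blast
  next
    case (insert x T)
    then obtain A1 where A1: "A1 \<in> \<C>" "T \<subseteq> fspan (CHAR('k) ^ e) B A1" by blast
    have "x \<in> fspan (CHAR('k) ^ e) B (\<Union>\<C>)" using B(3) by simp
    then obtain A2 where A2: "A2 \<in> \<C>" "x \<in> fspan (CHAR('k) ^ e) B A2" using fspan_Union by blast
    have "A1 \<subseteq> A2 \<or> A2 \<subseteq> A1" using C(1) A1(1) A2(1) by (auto simp: subset_chain_def)
    then obtain A where "A \<in> \<C>" "A1 \<subseteq> A" "A2 \<subseteq> A" using A1(1) A2(1) by blast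
    then have "insert x T \<subseteq> fspan (CHAR('k) ^ e) B A"
      using A1(2) A2(2) fspan_mono[of _ _ B A1 B A] fspan_mono[of _ _ B A2 B A] by auto
    with \<open>A \<in> \<C>\<close> show ?case by blast
  qed
  from this[of "(\<lambda>\<mu>. single \<mu> 1) ` expo_box (CHAR('k) ^ e)"] obtain A
    where A: "A \<in> \<C>" "(\<lambda>\<mu>. single \<mu> 1) ` expo_box (CHAR('k) ^ e) \<subseteq> fspan (CHAR('k) ^ e) B A"
    by auto
  then have "fspan (CHAR('k) ^ e) B A = UNIV"
    by (intro single_expansion_UNIV[OF p perf C(3)]) auto
  then have "frob_gen (CHAR('k) ^ e) A m" using B(1,2) unfolding frob_gen_def by blast
  with e A(1) show ?thesis unfolding small_frob_gen_def by blast
qed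

text \<open>An ideal maximal among those that are not small would be prime.\<close>

lemma small_frob_genI:
  fixes K :: "('v::finite, 'k::field) mpoly set"
  assumes p: "prime CHAR('k)" and perf: "perfect_field TYPE('k)" and K: "idl.subspace K"
    and primes: "\<And>P. prime_id P \<Longrightarrow> K \<subseteq> P \<Longrightarrow> small_frob_gen r P"
  shows "small_frob_gen r K"
proof (rule ccontr)
  assume nK: "\<not> small_frob_gen r K"
  define \<A> where "\<A> = {A. idl.subspace A \<and> K \<subseteq> A \<and> \<not> small_frob_gen r A}"
  have "\<exists>M\<in>\<A>. \<forall>X\<in>\<A>. M \<subseteq> X \<longrightarrow> X = M"
  proof (rule subset_Zorn_nonempty)
    show "\<A> \<noteq> {}" using K nK by (auto simp: \<A>_def)
    fix \<C> assume C: "\<C> \<noteq> {}" "subset.chain \<A> \<C>"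
    then have sub: "\<C> \<subseteq> \<A>" by (simp add: subset_chain_def)
    have "\<not> small_frob_gen r (\<Union>\<C>)"
      using small_frob_gen_Union[OF p perf _ C(1)] C(2) sub
      by (fastforce simp: \<A>_def subset_chain_def)
    moreover have "idl.subspace (\<Union>\<C>)"
      by (rule subspace_chain_Union[OF C]) (use sub in \<open>auto simp: \<A>_def\<close>)
    moreover have "K \<subseteq> \<Union>\<C>" using C(1) sub by (auto simp: \<A>_def)
    ultimately show "\<Union>\<C> \<in> \<A>" by (simp add: \<A>_def)
  qed
  then obtain A where A: "A \<in> \<A>" and max: "\<And>X. X \<in> \<A> \<Longrightarrow> A \<subseteq> X \<Longrightarrow> X = A" by blast
  then have sA: "idl.subspace A" "K \<subseteq> A" "\<not> small_frob_gen r A" by (auto simp: \<A>_def)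
  have bigger: "small_frob_gen r X" if "idl.subspace X" "A \<subseteq> X" "x \<in> X" "x \<notin> A" for X x
    using max[of X] that sA(2) by (auto simp: \<A>_def)
  have "1 \<notin> A"
  proof
    assume "1 \<in> A"
    then have "x \<in> A" for x using idl.subspace_scale[OF sA(1), of 1 x] by simp
    then have "fspan (CHAR('k) ^ 1) {} A = UNIV" by (auto intro: fspan.base)
    then have "frob_gen (CHAR('k) ^ 1) A 0" unfolding frob_gen_def by (intro exI[of _ "{}"]) simp
    moreover have "0 * (CHAR('k) ^ 1) ^ r < (CHAR('k) ^ 1) ^ CARD('v)"
      using prime_gt_0_nat[OF p] by simp
    ultimately show False using sA(3) unfolding small_frob_gen_def by (metis zero_less_one)
  qed
  moreover have "a \<in> A \<or> b \<in> A" if ab: "a * b \<in> A" for a b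
  proof (rule ccontr)
    assume n: "\<not> (a \<in> A \<or> b \<in> A)"
    \<comment> \<open>Both A + (a) and A : a strictly contain \<open>A\<close>, the latter because
      of \<open>b\<close>, and are small by maximality.\<close>
    have "small_frob_gen r (idl.span (insert a A))"
      by (rule bigger[of _ a]) (use n in \<open>auto intro: idl.span_base\<close>)
    moreover have "idl.subspace {x. a * x \<in> A}"
      using sA(1) unfolding idl.subspace_def by (auto simp: distrib_left mult.left_commute[of a])
    then have "small_frob_gen r {x. a * x \<in> A}"
      by (rule bigger[of _ b]) (use n ab in \<open>auto intro: idl.subspace_scale[OF sA(1)]\<close>)
    ultimately show False using small_frob_gen_extension[OF p sA(1)] sA(3) by blast
  qed
  ultimately have "prime_id A" using sA(1) by (auto simp: prime_id_def)
  from primes[OF this sA(2)] sA(3) show False by blast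
qed

text \<open>With fewer than q^n generators, the coordinate vectors of the q^n box monomials would be
  dependent modulo \<open>P\<close>. Cartier-type operators detect every coefficient of such a
  relation.\<close>

lemma frob_gen_frob_ideal_bound:
  fixes P :: "('v::finite, 'k::field) mpoly set"
  assumes p: "prime CHAR('k)" and perf: "perfect_field TYPE('k)" and P: "prime_id P"
    and gen: "frob_gen (CHAR('k) ^ e) (frob_ideal (CHAR('k) ^ e) P) m"
  shows "(CHAR('k) ^ e) ^ CARD('v) \<le> m"
proof (rule ccontr)
  let ?q = "CHAR('k) ^ e"
  let ?Q = "frob_ideal ?q P"
  assume less: "\<not> ?thesis"
  have q: "?q > 0" using prime_gt_0_nat[OF p] by simp
  have sP: "idl.subspace P" using P by (simp add: prime_id_def)
  note sQ = frob_ideal_subspace[OF sP, of ?q]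
  note frob = frobenius_add_mpoly[OF p, where ?'v = 'v and e = e]
  from gen obtain B where B: "finite B" "card B \<le> m" "fspan ?q B ?Q = UNIV"
    unfolding frob_gen_def by blast
  have "\<exists>a. single \<mu> 1 - (\<Sum>b\<in>B. a b ^ ?q * b) \<in> ?Q" for \<mu>
    by (rule fspan_explicit[OF sQ q frob B(1)]) (simp add: B(3))
  then have "\<forall>\<mu>. \<exists>a. single \<mu> 1 - (\<Sum>b\<in>B. a b ^ ?q * b) \<in> ?Q" ..
  from choice[OF this] obtain a where a: "\<forall>\<mu>. single \<mu> 1 - (\<Sum>b\<in>B. a \<mu> b ^ ?q * b) \<in> ?Q" ..
  have "card B < card (expo_box ?q :: ('v \<Rightarrow>\<^sub>0 nat) set)"
    using less B(2) by (simp add: card_expo_box)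
  from linear_dependence_mod_prime[OF B(1) finite_expo_box this P, of a] obtain c \<mu>0
    where c: "\<mu>0 \<in> expo_box ?q" "c \<mu>0 \<notin> P" "\<And>b. b \<in> B \<Longrightarrow> (\<Sum>\<mu>\<in>expo_box ?q. c \<mu> * a \<mu> b) \<in> P" by blast
  obtain \<psi> :: "'k \<Rightarrow> 'k" where \<psi>: "frob_lin ?q \<psi>" and \<psi>1: "\<psi> 1 = 1"
    using perfect_root[OF p perf] by blast
  have psum: "sum f T ^ ?q = (\<Sum>x\<in>T. f x ^ ?q)" for f :: "_ \<Rightarrow> ('v, 'k) mpoly" and T
    using additive_sum[of "\<lambda>x. x ^ ?q", OF frob] .
  \<comment> \<open>The dependence places this combination of monomials in the Frobenius ideal; the
    operator at \<open>\<mu>0\<close> then reads off \<open>c \<mu>0\<close>, which is outside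
    \<open>P\<close>.\<close>
  define S where "S = (\<Sum>\<mu>\<in>expo_box ?q. c \<mu> ^ ?q * single \<mu> (1 :: 'k))"
  have "S = (\<Sum>\<mu>\<in>expo_box ?q. c \<mu> ^ ?q * (single \<mu> 1 - (\<Sum>b\<in>B. a \<mu> b ^ ?q * b))) +
      (\<Sum>\<mu>\<in>expo_box ?q. \<Sum>b\<in>B. (c \<mu> * a \<mu> b) ^ ?q * b)"
    unfolding S_def sum.distrib[symmetric]
    by (intro sum.cong refl) (simp add: right_diff_distrib sum_distrib_left power_mult_distrib mult.assoc)
  also have "(\<Sum>\<mu>\<in>expo_box ?q. \<Sum>b\<in>B. (c \<mu> * a \<mu> b) ^ ?q * b) =
      (\<Sum>b\<in>B. (\<Sum>\<mu>\<in>expo_box ?q. c \<mu> * a \<mu> b) ^ ?q * b)"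
    unfolding psum sum_distrib_right by (rule sum.swap)
  finally have "S = (\<Sum>\<mu>\<in>expo_box ?q. c \<mu> ^ ?q * (single \<mu> 1 - (\<Sum>b\<in>B. a \<mu> b ^ ?q * b))) +
      (\<Sum>b\<in>B. (\<Sum>\<mu>\<in>expo_box ?q. c \<mu> * a \<mu> b) ^ ?q * b)" .
  moreover have "\<dots> \<in> ?Q"
    using spec[OF a] c(3) power_in_frob_ideal[OF sP]
    by (intro idl.subspace_add[OF sQ] idl.subspace_sum[OF sQ] idl.subspace_scale[OF sQ] subspace_mult_right[OF sQ]) auto
  ultimately have S: "S \<in> ?Q" by simp
  have "frob_lin ?q (cart ?q \<psi> \<mu>0 :: ('v, 'k) mpoly \<Rightarrow> _)"
    using c(1) by (intro frob_lin_cart[OF q \<psi> _ frob]) (auto simp: expo_box_def)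
  note cart = this
  have "cart ?q \<psi> \<mu>0 S \<in> P" using S cart unfolding frob_ideal_def by blast
  also have "cart ?q \<psi> \<mu>0 S = (\<Sum>\<mu>\<in>expo_box ?q. c \<mu> * cart ?q \<psi> \<mu>0 (single \<mu> 1))"
    unfolding S_def by (simp add: frob_lin_sum[OF cart] frob_lin_scale[OF cart])
  also have "\<dots> = (\<Sum>\<mu>\<in>expo_box ?q. if \<mu> = \<mu>0 then c \<mu> else 0)"
  proof (intro sum.cong refl)
    fix \<mu> :: "'v \<Rightarrow>\<^sub>0 nat" assume \<mu>: "\<mu> \<in> expo_box ?q"
    note [simp] = frob_lin_0[OF \<psi>]
    have z: "expo_scale ?q 0 = (0 :: 'v \<Rightarrow>\<^sub>0 nat)" by (rule poly_mapping_eqI) simp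
    show "c \<mu> * cart ?q \<psi> \<mu>0 (single \<mu> 1) = (if \<mu> = \<mu>0 then c \<mu> else 0)"
    proof (cases "\<mu> = \<mu>0")
      case True
      have "cart ?q \<psi> \<mu>0 (single (\<mu>0 + expo_scale ?q 0) 1) = single 0 (\<psi> 1)"
        by (rule cart_single[OF q]) simp
      then show ?thesis using True by (simp add: z \<psi>1)
    next
      case False
      have "cart ?q \<psi> \<mu>0 (single \<mu> 1) = 0"
      proof (rule cart_single_0[OF q])
        fix \<nu> show "\<mu> \<noteq> \<mu>0 + expo_scale ?q \<nu>"
        proof
          assume eq: "\<mu> = \<mu>0 + expo_scale ?q \<nu>"
          have "lookup \<mu> v = lookup \<mu>0 v" for v
          proof -
            have "lookup \<mu> v mod ?q = lookup \<mu>0 v mod ?q" unfolding eq by (simp add: lookup_add)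
            then show ?thesis using \<mu> c(1) by (simp add: expo_box_def)
          qed
          then have "\<mu> = \<mu>0" by (rule poly_mapping_eqI)
          with False show False ..
        qed
      qed simp
      then show ?thesis using False by simp
    qed
  qed
  also have "\<dots> = c \<mu>0" using c(1) by simp
  finally show False using c(2) by simp
qed

text \<open>\<open>chains\<close> expresses height at least \<open>c\<close>. If r < c, all primes
  over the r generators are small, hence so is their ideal. Adjoining the Frobenius ideal of
  \<open>P0\<close> and removing the generators again leaves fewer than q^n generators modulo that
  Frobenius ideal.\<close>

lemma krull_height_le_generators:
  fixes hs :: "('v::finite, 'k::field) mpoly list"
  assumes p: "prime CHAR('k)" and perf: "perfect_field TYPE('k)"
    and P0: "prime_id P0" "set hs \<subseteq> P0"
    and chains: "\<And>P. prime_id P \<Longrightarrow> set hs \<subseteq> P \<Longrightarrow>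
      \<exists>C. (\<forall>i\<le>c. prime_id (C i)) \<and> (\<forall>i<c. C i \<subset> C (Suc i)) \<and> C c = P"
  shows "c \<le> length hs"
proof (rule ccontr)
  define r where "r = length hs"
  assume "\<not> ?thesis"
  then have r: "Suc r \<le> c" by (simp add: r_def)
  let ?K = "idl.span (set hs)"
  have "small_frob_gen r ?K"
  proof (rule small_frob_genI[OF p perf idl.subspace_span])
    fix P assume P: "prime_id P" "?K \<subseteq> P"
    then have "set hs \<subseteq> P" using idl.span_superset by blast
    with chains P(1) obtain C where C: "\<And>i. i \<le> c \<Longrightarrow> prime_id (C i)" "\<And>i. i < c \<Longrightarrow> C i \<subset> C (Suc i)" "C c = P"
      by metis
    from frob_gen_chain[OF p perf, of c C, OF C(1,2)] obtain D where
      D: "\<And>e. \<exists>m. frob_gen (CHAR('k) ^ e) (C c) m \<and>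
        m * (CHAR('k) ^ e) ^ c \<le> D * (CHAR('k) ^ e) ^ CARD('v)" by blast
    \<comment> \<open>Ensures q \<ge> 2^e > D, so that the surplus factor q coming from c > r beats
      the constant D.\<close>
    define e where "e = Suc D"
    define q where "q = CHAR('k) ^ e"
    have q: "D < q"
    proof -
      have "D < 2 ^ D" by simp
      also have "(2 :: nat) ^ D \<le> 2 ^ e" by (simp add: e_def)
      also have "\<dots> \<le> q" unfolding q_def using prime_ge_2_nat[OF p] by (intro power_mono) auto
      finally show ?thesis .
    qed
    from D[of e] obtain m where m: "frob_gen q P m" "m * q ^ c \<le> D * q ^ CARD('v)"
      unfolding C(3) q_def by blast
    have "(m * q ^ r) * q = m * q ^ Suc r" by simp
    also have "\<dots> \<le> m * q ^ c" using r q by (intro mult_left_mono power_increasing) auto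
    also have "\<dots> \<le> D * q ^ CARD('v)" by (rule m(2))
    also have "\<dots> < q * q ^ CARD('v)" using q by (intro mult_strict_right_mono) auto
    finally have "m * q ^ r < q ^ CARD('v)" using q by (simp add: mult.commute)
    with m(1) show "small_frob_gen r P" unfolding small_frob_gen_def q_def e_def by blast
  qed
  then obtain e m where e: "frob_gen (CHAR('k) ^ e) ?K m"
    "m * (CHAR('k) ^ e) ^ r < (CHAR('k) ^ e) ^ CARD('v)" unfolding small_frob_gen_def by blast
  let ?Q = "frob_ideal (CHAR('k) ^ e) P0"
  have sP: "idl.subspace P0" using P0(1) by (simp add: prime_id_def)
  have "?K \<subseteq> idl.span (set hs \<union> ?Q)" by (intro idl.span_mono) auto
  from frob_gen_mono[OF e(1) this order_refl]
  have "frob_gen (CHAR('k) ^ e) ?Q ((CHAR('k) ^ e) ^ length hs * m)"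
    by (rule frob_gen_remove_generators)
      (use P0(2) power_in_frob_ideal[OF sP] frob_ideal_subspace[OF sP] in auto)
  from frob_gen_frob_ideal_bound[OF p perf P0(1) this] e(2) show False
    by (simp add: r_def mult.commute)
qed

section \<open>Coefficients of products of generic combinations\<close>

text \<open>A product of multinomial coefficients, one for each block of the partition of \<open>L\<close> by \<open>lab\<close>.\<close>

lemma card_prescribed_fibres:
  fixes lab :: "'l \<Rightarrow> 'd" and \<alpha> :: "'d \<Rightarrow> 's::finite \<Rightarrow> nat"
  assumes "finite L" "finite D" "lab ` L \<subseteq> D"
    and "\<And>d. d \<in> D \<Longrightarrow> (\<Sum>j\<in>UNIV. \<alpha> d j) = card {l \<in> L. lab l = d}"
  shows "card {\<sigma> \<in> L \<rightarrow>\<^sub>E UNIV. \<forall>d\<in>D. \<forall>j. card {l \<in> L. lab l = d \<and> \<sigma> l = j} = \<alpha> d j} *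
      (\<Prod>d\<in>D. \<Prod>j\<in>UNIV. fact (\<alpha> d j)) = (\<Prod>d\<in>D. fact (card {l \<in> L. lab l = d}) :: nat)"
  using assms(1,3,4)
proof (induction L arbitrary: \<alpha> rule: finite_induct)
  case empty
  then have "\<alpha> d j = 0" if "d \<in> D" for d j using that by simp
  then have "{\<sigma> \<in> {} \<rightarrow>\<^sub>E UNIV. \<forall>d\<in>D. \<forall>j. card {l \<in> {}. lab l = d \<and> \<sigma> l = j} = \<alpha> d j} = {\<lambda>_. undefined}"
    by auto
  with \<open>\<And>j d. d \<in> D \<Longrightarrow> \<alpha> d j = 0\<close> show ?case by simp
next
  case (insert l0 L)
  define d0 where "d0 = lab l0"
  have d0: "d0 \<in> D" using insert.prems(1) by (simp add: d0_def)
  define Y where "Y \<alpha> = {\<sigma> \<in> L \<rightarrow>\<^sub>E UNIV. \<forall>d\<in>D. \<forall>j. card {l \<in> L. lab l = d \<and> \<sigma> l = j} = \<alpha> d j}"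
    for \<alpha> :: "'d \<Rightarrow> 's \<Rightarrow> nat"
  define Y' where "Y' = {\<sigma> \<in> insert l0 L \<rightarrow>\<^sub>E UNIV. \<forall>d\<in>D. \<forall>j. card {l \<in> insert l0 L. lab l = d \<and> \<sigma> l = j} = \<alpha> d j}"
  \<comment> \<open>The counts still to be realized on \<open>L\<close> once \<open>l0\<close> has
    received the value \<open>j0\<close>.\<close>
  define \<beta> where "\<beta> j0 = (\<lambda>d j. if d = d0 \<and> j = j0 then \<alpha> d j - 1 else \<alpha> d j)" for j0
  define Z where "Z = {j. \<alpha> d0 j > 0}"
  have finY: "finite (Y a)" for a
    unfolding Y_def using insert.hyps(1) by (intro finite_subset[OF _ finite_PiE[of L "\<lambda>_. UNIV"]]) auto
  have count: "card {l \<in> insert l0 L. lab l = d \<and> \<sigma> l = j} =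
      card {l \<in> L. lab l = d \<and> \<sigma> l = j} + (if d = d0 \<and> j = \<sigma> l0 then 1 else 0)" for \<sigma> :: "'l \<Rightarrow> 's" and d j
  proof -
    have "{l \<in> insert l0 L. lab l = d \<and> \<sigma> l = j} =
        (if d = d0 \<and> j = \<sigma> l0 then insert l0 {l \<in> L. lab l = d \<and> \<sigma> l = j} else {l \<in> L. lab l = d \<and> \<sigma> l = j})"
      by (auto simp: d0_def)
    then show ?thesis using insert.hyps by simp
  qed
  have cardL: "card {l \<in> insert l0 L. lab l = d} = card {l \<in> L. lab l = d} + (if d = d0 then 1 else 0)" for d
  proof -
    have "{l \<in> insert l0 L. lab l = d} = (if d = d0 then insert l0 {l \<in> L. lab l = d} else {l \<in> L. lab l = d})"
      by (auto simp: d0_def)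
    then show ?thesis using insert.hyps by simp
  qed
  have upd: "\<sigma>(l0 := j) \<in> Y' \<longleftrightarrow> j \<in> Z \<and> \<sigma> \<in> Y (\<beta> j)" if \<sigma>: "\<sigma> \<in> L \<rightarrow>\<^sub>E UNIV" for \<sigma> j
  proof -
    have same: "{l \<in> L. lab l = d \<and> (\<sigma>(l0 := j)) l = i} = {l \<in> L. lab l = d \<and> \<sigma> l = i}" for d i
      using insert.hyps(2) by auto
    have mem: "\<sigma>(l0 := j) \<in> insert l0 L \<rightarrow>\<^sub>E UNIV"
      using \<sigma> by (auto simp: PiE_def extensional_def)
    have "\<sigma>(l0 := j) \<in> Y' \<longleftrightarrow>
        (\<forall>d\<in>D. \<forall>i. card {l \<in> L. lab l = d \<and> \<sigma> l = i} + (if d = d0 \<and> i = j then 1 else 0) = \<alpha> d i)"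
      using mem unfolding Y'_def mem_Collect_eq count same by (simp only: fun_upd_same simp_thms)
    also have "\<dots> \<longleftrightarrow> j \<in> Z \<and> (\<forall>d\<in>D. \<forall>i. card {l \<in> L. lab l = d \<and> \<sigma> l = i} = \<beta> j d i)"
    proof safe
      assume h: "\<forall>d\<in>D. \<forall>i. card {l \<in> L. lab l = d \<and> \<sigma> l = i} + (if d = d0 \<and> i = j then 1 else 0) = \<alpha> d i"
      from spec[OF bspec[OF h d0], of j] have "card {l \<in> L. lab l = d0 \<and> \<sigma> l = j} + 1 = \<alpha> d0 j" by simp
      then show "j \<in> Z" by (simp add: Z_def)
      fix d i assume "d \<in> D"
      with h have "card {l \<in> L. lab l = d \<and> \<sigma> l = i} + (if d = d0 \<and> i = j then 1 else 0) = \<alpha> d i" by blast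
      then show "card {l \<in> L. lab l = d \<and> \<sigma> l = i} = \<beta> j d i" by (auto simp: \<beta>_def split: if_splits)
    next
      fix d i
      assume h: "j \<in> Z" "\<forall>d\<in>D. \<forall>i. card {l \<in> L. lab l = d \<and> \<sigma> l = i} = \<beta> j d i" and d: "d \<in> D"
      then show "card {l \<in> L. lab l = d \<and> \<sigma> l = i} + (if d = d0 \<and> i = j then 1 else 0) = \<alpha> d i"
        by (auto simp: \<beta>_def Z_def)
    qed
    finally show ?thesis using \<sigma> by (simp add: Y_def)
  qed
  \<comment> \<open>Maps are sorted by their value at \<open>l0\<close>; only values with a positive
    prescribed count in its block occur.\<close>
  have "Y' = (\<Union>j\<in>Z. (\<lambda>\<sigma>. \<sigma>(l0 := j)) ` Y (\<beta> j))"
  proof (intro subset_antisym subsetI)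
    fix \<sigma> assume \<sigma>: "\<sigma> \<in> Y'"
    then have PiE: "\<sigma> \<in> insert l0 L \<rightarrow>\<^sub>E UNIV" by (simp add: Y'_def)
    define \<tau> where "\<tau> = \<sigma>(l0 := undefined)"
    have \<tau>: "\<tau> \<in> L \<rightarrow>\<^sub>E UNIV" "\<tau>(l0 := \<sigma> l0) = \<sigma>"
      using PiE insert.hyps(2) by (auto simp: \<tau>_def PiE_def extensional_def)
    with upd[OF \<tau>(1), of "\<sigma> l0"] \<sigma> have in_Y: "\<sigma> l0 \<in> Z" "\<tau> \<in> Y (\<beta> (\<sigma> l0))" by auto
    show "\<sigma> \<in> (\<Union>j\<in>Z. (\<lambda>\<sigma>. \<sigma>(l0 := j)) ` Y (\<beta> j))"
      by (rule UN_I[OF in_Y(1)], rule image_eqI[where x = \<tau>])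
        (simp_all only: \<tau>(2) in_Y(2))
  next
    fix \<sigma> assume "\<sigma> \<in> (\<Union>j\<in>Z. (\<lambda>\<sigma>. \<sigma>(l0 := j)) ` Y (\<beta> j))"
    then obtain j \<tau> where "j \<in> Z" "\<tau> \<in> Y (\<beta> j)" "\<sigma> = \<tau>(l0 := j)" by blast
    then show "\<sigma> \<in> Y'" using upd[of \<tau> j] by (simp add: Y_def)
  qed
  moreover have "card (\<Union>j\<in>Z. (\<lambda>\<sigma>. \<sigma>(l0 := j)) ` Y (\<beta> j)) = (\<Sum>j\<in>Z. card ((\<lambda>\<sigma>. \<sigma>(l0 := j)) ` Y (\<beta> j)))"
  proof (intro card_UN_disjoint ballI impI)
    fix i j :: 's assume "i \<noteq> j"
    then show "(\<lambda>\<sigma>. \<sigma>(l0 := i)) ` Y (\<beta> i) \<inter> (\<lambda>\<sigma>. \<sigma>(l0 := j)) ` Y (\<beta> j) = {}"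
      by (auto dest: fun_cong[of _ _ l0])
  qed (use finY in auto)
  moreover have "card ((\<lambda>\<sigma>. \<sigma>(l0 := j)) ` Y (\<beta> j)) = card (Y (\<beta> j))" for j
  proof (rule card_image, rule inj_onI)
    fix \<sigma> \<tau> assume st: "\<sigma> \<in> Y (\<beta> j)" "\<tau> \<in> Y (\<beta> j)" "\<sigma>(l0 := j) = \<tau>(l0 := j)"
    then have "\<sigma> l0 = \<tau> l0" using insert.hyps(2) by (auto simp: Y_def PiE_def extensional_def)
    moreover have "\<sigma> l = \<tau> l" if "l \<noteq> l0" for l using fun_cong[OF st(3), of l] that by simp
    ultimately show "\<sigma> = \<tau>" by (metis ext)
  qed
  ultimately have cardY': "card Y' = (\<Sum>j\<in>Z. card (Y (\<beta> j)))" by simp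
  define X where "X = (\<Prod>d\<in>D. fact (card {l \<in> L. lab l = d}) :: nat)"
  define A where "A a = (\<Prod>d\<in>D. \<Prod>j\<in>UNIV. fact (a d j) :: nat)" for a :: "'d \<Rightarrow> 's \<Rightarrow> nat"
  have A: "A \<alpha> = \<alpha> d0 j * A (\<beta> j)" if "j \<in> Z" for j
  proof -
    have "A \<alpha> = (\<Prod>i\<in>UNIV. fact (\<alpha> d0 i)) * (\<Prod>d\<in>D - {d0}. \<Prod>i\<in>UNIV. fact (\<alpha> d i))"
      unfolding A_def by (rule prod.remove[OF \<open>finite D\<close> d0])
    also have "(\<Prod>i\<in>UNIV. fact (\<alpha> d0 i)) = fact (\<alpha> d0 j) * (\<Prod>i\<in>UNIV - {j}. fact (\<alpha> d0 i) :: nat)"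
      by (rule prod.remove) auto
    also have "fact (\<alpha> d0 j) = \<alpha> d0 j * (fact (\<beta> j d0 j) :: nat)"
      using that by (simp add: \<beta>_def Z_def fact_reduce)
    also have "(\<Prod>i\<in>UNIV - {j}. fact (\<alpha> d0 i) :: nat) = (\<Prod>i\<in>UNIV - {j}. fact (\<beta> j d0 i))"
      by (intro prod.cong refl) (simp add: \<beta>_def)
    also have "(\<Prod>d\<in>D - {d0}. \<Prod>i\<in>UNIV. fact (\<alpha> d i) :: nat) = (\<Prod>d\<in>D - {d0}. \<Prod>i\<in>UNIV. fact (\<beta> j d i))"
      by (intro prod.cong refl) (simp add: \<beta>_def)
    also have "\<alpha> d0 j * fact (\<beta> j d0 j) * (\<Prod>i\<in>UNIV - {j}. fact (\<beta> j d0 i)) = \<alpha> d0 j * (\<Prod>i\<in>UNIV. fact (\<beta> j d0 i) :: nat)"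
      by (subst (2) prod.remove[of _ j]) auto
    also have "\<dots> * (\<Prod>d\<in>D - {d0}. \<Prod>i\<in>UNIV. fact (\<beta> j d i)) = \<alpha> d0 j * A (\<beta> j)"
      unfolding A_def prod.remove[OF \<open>finite D\<close> d0, of "\<lambda>d. \<Prod>i\<in>UNIV. fact (\<beta> j d i)"] by (rule mult.assoc)
    finally show ?thesis .
  qed
  have IH: "card (Y (\<beta> j)) * A (\<beta> j) = X" if j: "j \<in> Z" for j
    unfolding Y_def A_def X_def
  proof (rule insert.IH)
    show "lab ` L \<subseteq> D" using insert.prems(1) by auto
    fix d assume d: "d \<in> D"
    have "(\<Sum>i\<in>UNIV. \<alpha> d i) = (\<Sum>i\<in>UNIV. \<beta> j d i + (if i = j then (if d = d0 then 1 else 0) else 0))"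
      using j by (intro sum.cong refl) (auto simp: \<beta>_def Z_def)
    then have "(\<Sum>i\<in>UNIV. \<alpha> d i) = (\<Sum>i\<in>UNIV. \<beta> j d i) + (if d = d0 then 1 else 0)"
      by (simp add: sum.distrib)
    with insert.prems(2)[OF d] cardL[of d]
    show "(\<Sum>i\<in>UNIV. \<beta> j d i) = card {l \<in> L. lab l = d}" by simp
  qed
  have "card Y' * A \<alpha> = (\<Sum>j\<in>Z. card (Y (\<beta> j)) * A \<alpha>)"
    by (simp add: cardY' sum_distrib_right)
  also have "\<dots> = (\<Sum>j\<in>Z. \<alpha> d0 j * X)"
  proof (intro sum.cong refl)
    fix j assume "j \<in> Z"
    from A[OF this] IH[OF this] show "card (Y (\<beta> j)) * A \<alpha> = \<alpha> d0 j * X" by simp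
  qed
  also have "\<dots> = (\<Sum>j\<in>UNIV. \<alpha> d0 j) * X"
    unfolding sum_distrib_right[symmetric] by (intro arg_cong2[of _ _ _ _ "(*)"] sum.mono_neutral_left refl) (auto simp: Z_def)
  also have "\<dots> = Suc (card {l \<in> L. lab l = d0}) * X"
    using insert.prems(2)[OF d0] cardL[of d0] by simp
  also have "\<dots> = (\<Prod>d\<in>D. fact (card {l \<in> insert l0 L. lab l = d}))"
  proof -
    have "(\<Prod>d\<in>D. fact (card {l \<in> insert l0 L. lab l = d}) :: nat) =
        fact (card {l \<in> insert l0 L. lab l = d0}) * (\<Prod>d\<in>D - {d0}. fact (card {l \<in> insert l0 L. lab l = d}))"
      by (rule prod.remove[OF \<open>finite D\<close> d0])
    also have "\<dots> = Suc (card {l \<in> L. lab l = d0}) * (fact (card {l \<in> L. lab l = d0}) * (\<Prod>d\<in>D - {d0}. fact (card {l \<in> L. lab l = d})))"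
      unfolding cardL by (simp add: distrib_right mult.assoc)
    also have "fact (card {l \<in> L. lab l = d0}) * (\<Prod>d\<in>D - {d0}. fact (card {l \<in> L. lab l = d})) = X"
      unfolding X_def by (rule prod.remove[OF \<open>finite D\<close> d0, symmetric])
    finally show ?thesis by simp
  qed
  finally show ?case unfolding Y'_def A_def .
qed

text \<open>The number of maps divides the product of the factorials of the block sizes, and blocks
  smaller than p have factorials prime to p.\<close>

lemma prime_not_dvd_card_prescribed_fibres:
  fixes lab :: "'l \<Rightarrow> 'd" and \<sigma>0 :: "'l \<Rightarrow> 's::finite"
  assumes "finite L" and p: "prime p" and small: "\<And>d. card {l \<in> L. lab l = d} < p"
  shows "\<not> p dvd card {\<sigma> \<in> L \<rightarrow>\<^sub>E UNIV. \<forall>d\<in>lab ` L. \<forall>j.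
    card {l \<in> L. lab l = d \<and> \<sigma> l = j} = card {l \<in> L. lab l = d \<and> \<sigma>0 l = j}}" (is "\<not> p dvd card ?Y")
proof
  assume dvd: "p dvd card ?Y"
  have "(\<Sum>j\<in>UNIV. card {l \<in> L. lab l = d \<and> \<sigma>0 l = j}) = card {l \<in> L. lab l = d}" for d
  proof -
    have "card (\<Union>j. {l \<in> L. lab l = d \<and> \<sigma>0 l = j}) = (\<Sum>j\<in>UNIV. card {l \<in> L. lab l = d \<and> \<sigma>0 l = j})"
      using assms(1) by (intro card_UN_disjoint) auto
    moreover have "(\<Union>j. {l \<in> L. lab l = d \<and> \<sigma>0 l = j}) = {l \<in> L. lab l = d}" by auto
    ultimately show ?thesis by simp
  qed
  note count = card_prescribed_fibres[OF assms(1) finite_imageI[OF assms(1)] subset_refl,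
      where \<alpha> = "\<lambda>d j. card {l \<in> L. lab l = d \<and> \<sigma>0 l = j}", OF this]
  have "p dvd (\<Prod>d\<in>lab ` L. fact (card {l \<in> L. lab l = d}) :: nat)"
    unfolding count[symmetric] by (rule dvd_mult2[OF dvd])
  then have "\<exists>d\<in>lab ` L. p dvd (fact (card {l \<in> L. lab l = d}) :: nat)"
    by (simp only: prime_dvd_prod_iff[OF finite_imageI[OF assms(1)] p])
  then obtain d where "p dvd (fact (card {l \<in> L. lab l = d}) :: nat)" ..
  then show False using small[of d] by (simp add: prime_dvd_fact_iff[OF p])
qed

section \<open>Base-p digits and the expansion of the product\<close>

lemma base_expansion_unique:
  fixes a b :: "nat \<Rightarrow> nat"
  assumes "p > 0" "\<And>k. k < e \<Longrightarrow> a k < p" "\<And>k. k < e \<Longrightarrow> b k < p"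
    and "(\<Sum>k<e. a k * p ^ k) = (\<Sum>k<e. b k * p ^ k)" "k < e"
  shows "a k = b k"
  using assms(2-)
proof (induction e arbitrary: a b k)
  case (Suc e)
  have S: "(\<Sum>k<Suc e. c k * p ^ k) = c 0 + p * (\<Sum>k<e. c (Suc k) * p ^ k)" for c :: "nat \<Rightarrow> nat"
    by (simp add: sum.lessThan_Suc_shift sum_distrib_left mult_ac del: sum.lessThan_Suc)
  have eq: "a 0 + p * (\<Sum>k<e. a (Suc k) * p ^ k) = b 0 + p * (\<Sum>k<e. b (Suc k) * p ^ k)"
    using Suc.prems(3) unfolding S .
  have ab: "a 0 < p" "b 0 < p" using Suc.prems(1,2) by auto
  have 0: "a 0 = b 0" using arg_cong[OF eq, of "\<lambda>x. x mod p"] ab by simp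
  with eq assms(1) have eq': "(\<Sum>k<e. a (Suc k) * p ^ k) = (\<Sum>k<e. b (Suc k) * p ^ k)" by simp
  have "a (Suc k) = b (Suc k)" if "k < e" for k
    by (rule Suc.IH[of "\<lambda>k. a (Suc k)" "\<lambda>k. b (Suc k)", OF _ _ eq' that])
      (simp_all add: Suc.prems(1,2))
  with 0 show ?case using Suc.prems(4) by (cases k) auto
qed simp

lemma prod_single: "finite L \<Longrightarrow> (\<Prod>l\<in>L. single (b l) (a l)) = single (sum b L) (prod a L :: 'a::comm_semiring_1)"
  by (induction L rule: finite_induct) (simp_all add: mult_single)

lemma sum_level_sets:
  fixes k :: "'l \<Rightarrow> nat" and p :: nat
  assumes "finite L" "\<And>l. l \<in> L \<Longrightarrow> k l < e"
  shows "(\<Sum>l\<in>L. p ^ k l) = (\<Sum>\<kappa><e. card {l \<in> L. k l = \<kappa>} * p ^ \<kappa>)"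
proof -
  have "(\<Sum>l\<in>L. p ^ k l) = (\<Sum>\<kappa><e. \<Sum>l\<in>{l \<in> L. k l = \<kappa>}. p ^ k l)"
    using assms by (intro sum.group[symmetric]) auto
  then show ?thesis by simp
qed

lemma geometric_digits: "p > 0 \<Longrightarrow> (\<Sum>\<kappa><e. (p - 1) * p ^ \<kappa>) = p ^ e - (1 :: nat)"
proof (induction e)
  case (Suc e)
  have "p ^ e - 1 + (p - 1) * p ^ e = p ^ Suc e - 1"
    using Suc.prems by (cases p) auto
  with Suc show ?case by simp
qed simp

text \<open>Every choice of one summand per factor contributes a monomial. The base-p digits of its
  exponents count the factors of given row, level and choice, since fewer than p share a row and a
  level. Hence the choices with the monomial of \<open>\<sigma>0\<close> are exactly those with the
  same counts, and their number is prime to p.\<close>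

lemma product_coefficient:
  fixes f :: "'s::finite \<Rightarrow> 'a::comm_ring_1" and i :: "'l \<Rightarrow> 'c" and k :: "'l \<Rightarrow> nat" and \<sigma>0 :: "'l \<Rightarrow> 's"
  defines "p \<equiv> CHAR('a)"
  assumes p: "prime p" and L: "finite L" "\<And>l. l \<in> L \<Longrightarrow> k l < e"
    and small: "\<And>\<gamma> \<kappa>. card {l \<in> L. i l = \<gamma> \<and> k l = \<kappa>} < p"
  defines "G \<equiv> (\<Prod>l\<in>L. generic_combination f (i l) ^ p ^ k l)"
  obtains \<beta>0 n where "lookup G \<beta>0 = of_nat n * (\<Prod>l\<in>L. f (\<sigma>0 l) ^ p ^ k l)" "\<not> p dvd n"
    "\<And>\<mu> v. \<mu> \<in> keys G \<Longrightarrow> lookup \<mu> v < p ^ e" "\<And>v. lookup \<beta>0 v < p ^ e"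
proof -
  have frob: "(x + y) ^ p ^ m = x ^ p ^ m + y ^ p ^ m" for x y :: "('c \<times> 's, 'a) mpoly" and m
    using frobenius_add[where ?'a = "('c \<times> 's, 'a) mpoly", of x y m] p
    by (simp add: CHAR_poly_mapping p_def)
  have p0: "p > 0" using p prime_gt_0_nat by blast
  define \<beta> where "\<beta> \<sigma> = (\<Sum>l\<in>L. single (i l, \<sigma> l) (p ^ k l))" for \<sigma> :: "'l \<Rightarrow> 's"
  define F where "F \<sigma> = (\<Prod>l\<in>L. f (\<sigma> l) ^ p ^ k l)" for \<sigma> :: "'l \<Rightarrow> 's"
  have gen: "generic_combination f \<gamma> ^ p ^ m = (\<Sum>j\<in>UNIV. single (single (\<gamma>, j) (p ^ m)) (f j ^ p ^ m))" for \<gamma> :: 'c and m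
  proof -
    have "expo_scale (p ^ m) (single (\<gamma>, j) 1) = single (\<gamma>, j) (p ^ m)" for j :: 's
      by (rule poly_mapping_eqI) (simp add: lookup_single when_def)
    then show ?thesis
      unfolding generic_combination_def additive_sum[of "\<lambda>x. x ^ p ^ m", OF frob] mvar_def mconst_def
      by (simp add: mult_single single_power)
  qed
  have G: "G = (\<Sum>\<sigma>\<in>L \<rightarrow>\<^sub>E UNIV. single (\<beta> \<sigma>) (F \<sigma>))"
    unfolding G_def gen \<beta>_def F_def
    by (subst prod_sum_PiE[OF L(1)]) (simp_all add: prod_single[OF L(1)])
  have \<beta>: "lookup (\<beta> \<sigma>) (\<gamma>, j) = (\<Sum>\<kappa><e. card {l \<in> L. (i l, k l) = (\<gamma>, \<kappa>) \<and> \<sigma> l = j} * p ^ \<kappa>)" for \<sigma> \<gamma> j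
  proof -
    have "lookup (\<beta> \<sigma>) (\<gamma>, j) = (\<Sum>l\<in>{l \<in> L. i l = \<gamma> \<and> \<sigma> l = j}. p ^ k l)"
      unfolding \<beta>_def lookup_sum by (simp add: lookup_single when_def sum.inter_filter[OF L(1)])
    also have "\<dots> = (\<Sum>\<kappa><e. card {l \<in> {l \<in> L. i l = \<gamma> \<and> \<sigma> l = j}. k l = \<kappa>} * p ^ \<kappa>)"
      by (rule sum_level_sets) (use L in auto)
    finally show ?thesis by (simp add: conj_ac)
  qed
  have le: "card {l \<in> L. (i l, k l) = (\<gamma>, \<kappa>) \<and> \<sigma> l = j} \<le> p - 1" for \<sigma> :: "'l \<Rightarrow> 's" and \<gamma> \<kappa> j
  proof -
    have "card {l \<in> L. (i l, k l) = (\<gamma>, \<kappa>) \<and> \<sigma> l = j} \<le> card {l \<in> L. i l = \<gamma> \<and> k l = \<kappa>}"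
      using L(1) by (intro card_mono) auto
    with small[of \<gamma> \<kappa>] show ?thesis by linarith
  qed
  have \<beta>_less: "lookup (\<beta> \<sigma>) v < p ^ e" for \<sigma> v
  proof (cases v)
    case (Pair \<gamma> j)
    have "lookup (\<beta> \<sigma>) v \<le> (\<Sum>\<kappa><e. (p - 1) * p ^ \<kappa>)"
      unfolding Pair \<beta> by (intro sum_mono mult_right_mono le) simp
    also have "\<dots> = p ^ e - 1" by (rule geometric_digits[OF p0])
    also have "\<dots> < p ^ e" using p0 by simp
    finally show ?thesis .
  qed
  define lab where "lab l = (i l, k l)" for l
  define Y where "Y = {\<sigma> \<in> L \<rightarrow>\<^sub>E UNIV. \<forall>d\<in>lab ` L. \<forall>j.
    card {l \<in> L. lab l = d \<and> \<sigma> l = j} = card {l \<in> L. lab l = d \<and> \<sigma>0 l = j}}"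
  have Y: "\<beta> \<sigma> = \<beta> \<sigma>0 \<longleftrightarrow> \<sigma> \<in> Y" if \<sigma>: "\<sigma> \<in> L \<rightarrow>\<^sub>E UNIV" for \<sigma>
  proof
    assume eq: "\<beta> \<sigma> = \<beta> \<sigma>0"
    have "card {l \<in> L. (i l, k l) = (\<gamma>, \<kappa>) \<and> \<sigma> l = j} = card {l \<in> L. (i l, k l) = (\<gamma>, \<kappa>) \<and> \<sigma>0 l = j}"
      if "\<kappa> < e" for \<gamma> \<kappa> j
    proof (rule base_expansion_unique[OF p0 _ _ _ that,
        where a = "\<lambda>\<kappa>. card {l \<in> L. (i l, k l) = (\<gamma>, \<kappa>) \<and> \<sigma> l = j}"
          and b = "\<lambda>\<kappa>. card {l \<in> L. (i l, k l) = (\<gamma>, \<kappa>) \<and> \<sigma>0 l = j}"])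
      show "card {l \<in> L. (i l, k l) = (\<gamma>, \<kappa>) \<and> \<sigma> l = j} < p" for \<kappa>
        using le[of \<gamma> \<kappa> \<sigma> j] p0 by linarith
      show "card {l \<in> L. (i l, k l) = (\<gamma>, \<kappa>) \<and> \<sigma>0 l = j} < p" for \<kappa>
        using le[of \<gamma> \<kappa> \<sigma>0 j] p0 by linarith
      show "(\<Sum>\<kappa><e. card {l \<in> L. (i l, k l) = (\<gamma>, \<kappa>) \<and> \<sigma> l = j} * p ^ \<kappa>) =
          (\<Sum>\<kappa><e. card {l \<in> L. (i l, k l) = (\<gamma>, \<kappa>) \<and> \<sigma>0 l = j} * p ^ \<kappa>)"
        unfolding \<beta>[symmetric] eq ..
    qed
    then show "\<sigma> \<in> Y" using \<sigma> L(2) unfolding Y_def lab_def by auto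
  next
    assume \<sigma>Y: "\<sigma> \<in> Y"
    show "\<beta> \<sigma> = \<beta> \<sigma>0"
    proof (rule poly_mapping_eqI)
      fix v :: "'c \<times> 's"
      obtain \<gamma> j where v: "v = (\<gamma>, j)" by (cases v)
      have "card {l \<in> L. (i l, k l) = (\<gamma>, \<kappa>) \<and> \<sigma> l = j} = card {l \<in> L. (i l, k l) = (\<gamma>, \<kappa>) \<and> \<sigma>0 l = j}" for \<kappa>
      proof (cases "(\<gamma>, \<kappa>) \<in> lab ` L")
        case True
        then show ?thesis using \<sigma>Y unfolding Y_def lab_def by blast
      next
        case False
        then have "{l \<in> L. (i l, k l) = (\<gamma>, \<kappa>) \<and> \<tau> l = j} = {}" for \<tau> :: "'l \<Rightarrow> 's" by (auto simp: lab_def)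
        then show ?thesis by (simp only:)
      qed
      then show "lookup (\<beta> \<sigma>) v = lookup (\<beta> \<sigma>0) v" unfolding v \<beta> by (simp only:)
    qed
  qed
  \<comment> \<open>The product depends only on the multiset of pairs of label and value, which the
    counts determine.\<close>
  have FY: "F \<sigma> = F \<sigma>0" if \<sigma>: "\<sigma> \<in> Y" for \<sigma>
  proof -
    have "image_mset (\<lambda>l. (lab l, \<sigma> l)) (mset_set L) = image_mset (\<lambda>l. (lab l, \<sigma>0 l)) (mset_set L)"
    proof (rule multiset_eqI)
      fix x :: "('c \<times> nat) \<times> 's"
      obtain d j where x: "x = (d, j)" by (cases x)
      have c: "count (image_mset (\<lambda>l. (lab l, \<tau> l)) (mset_set L)) x = card {l \<in> L. lab l = d \<and> \<tau> l = j}" for \<tau> :: "'l \<Rightarrow> 's"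
        using L(1) unfolding count_image_mset x
        by (simp add: sum.If_cases vimage_def) (rule arg_cong[of _ _ card], auto)
      show "count (image_mset (\<lambda>l. (lab l, \<sigma> l)) (mset_set L)) x = count (image_mset (\<lambda>l. (lab l, \<sigma>0 l)) (mset_set L)) x"
      proof (cases "d \<in> lab ` L")
        case True
        then show ?thesis using \<sigma> unfolding c Y_def by blast
      next
        case False
        then have "{l \<in> L. lab l = d \<and> \<tau> l = j} = {}" for \<tau> :: "'l \<Rightarrow> 's" by auto
        then show ?thesis unfolding c by (simp only:)
      qed
    qed
    then have "prod_mset (image_mset (\<lambda>(d, j). f j ^ p ^ snd d) (image_mset (\<lambda>l. (lab l, \<sigma> l)) (mset_set L))) =
        prod_mset (image_mset (\<lambda>(d, j). f j ^ p ^ snd d) (image_mset (\<lambda>l. (lab l, \<sigma>0 l)) (mset_set L)))"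
      by (simp only:)
    then show ?thesis by (simp add: F_def prod_unfold_prod_mset image_mset.compositionality comp_def lab_def)
  qed
  have "lookup G (\<beta> \<sigma>0) = (\<Sum>\<sigma>\<in>L \<rightarrow>\<^sub>E UNIV. if \<sigma> \<in> Y then F \<sigma>0 else 0)"
    unfolding G lookup_sum using Y FY by (intro sum.cong refl) (auto simp: lookup_single when_def)
  also have "\<dots> = (\<Sum>\<sigma>\<in>Y. F \<sigma>0)"
    using L(1) by (subst sum.inter_filter[symmetric]) (auto simp: finite_PiE Y_def intro!: sum.cong)
  finally have "lookup G (\<beta> \<sigma>0) = of_nat (card Y) * F \<sigma>0" by simp
  moreover have "\<not> p dvd card Y"
    unfolding Y_def
  proof (rule prime_not_dvd_card_prescribed_fibres[OF L(1) p])
    fix d show "card {l \<in> L. lab l = d} < p" using small[of "fst d" "snd d"] by (cases d) (simp add: lab_def)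
  qed
  moreover have "lookup \<mu> v < p ^ e" if "\<mu> \<in> keys G" for \<mu> v
  proof -
    have "keys G \<subseteq> (\<Union>\<sigma>\<in>L \<rightarrow>\<^sub>E UNIV. keys (single (\<beta> \<sigma>) (F \<sigma>)))" unfolding G by (rule keys_sum)
    with that obtain \<sigma> where "\<mu> \<in> keys (single (\<beta> \<sigma>) (F \<sigma>))" by blast
    then have "\<mu> = \<beta> \<sigma>" by (simp split: if_splits)
    then show ?thesis using \<beta>_less by simp
  qed
  ultimately show ?thesis using that \<beta>_less unfolding F_def by blast
qed

text \<open>Since the exponents stay below \<open>q\<close>, the Cartier-type map attached to a monomial sends the product
  to a constant.\<close>

lemma product_functional:
  fixes f :: "'s::finite \<Rightarrow> ('v, 'k::field) mpoly" and i :: "'l \<Rightarrow> 'c" and k :: "'l \<Rightarrow> nat" and \<sigma>0 :: "'l \<Rightarrow> 's"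
  defines "p \<equiv> CHAR('k)"
  assumes p: "prime p" and L: "finite L" "\<And>l. l \<in> L \<Longrightarrow> k l < e"
    and small: "\<And>\<gamma> \<kappa>. card {l \<in> L. i l = \<gamma> \<and> k l = \<kappa>} < p"
    and M: "idl.subspace M"
    and notin: "(\<Prod>l\<in>L. f (\<sigma>0 l) ^ p ^ k l) \<notin> frob_ideal (p ^ e) M"
  obtains \<Phi> a where "frob_lin (p ^ e) \<Phi>" "\<Phi> (\<Prod>l\<in>L. generic_combination f (i l) ^ p ^ k l) = mconst a" "a \<notin> M"
proof -
  have char: "CHAR(('v, 'k) mpoly) = p" by (simp add: CHAR_poly_mapping p_def)
  define G where "G = (\<Prod>l\<in>L. generic_combination f (i l) ^ p ^ k l)"
  have q: "p ^ e > 0" using prime_gt_0_nat[OF p] by simp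
  obtain \<beta>0 n where \<beta>0: "lookup G \<beta>0 = of_nat n * (\<Prod>l\<in>L. f (\<sigma>0 l) ^ p ^ k l)" "\<not> p dvd n"
    "\<And>\<mu> v. \<mu> \<in> keys G \<Longrightarrow> lookup \<mu> v < p ^ e" "\<And>v. lookup \<beta>0 v < p ^ e"
    using product_coefficient[where ?'a = "('v, 'k) mpoly", unfolded char, OF p L small, of f \<sigma>0]
    unfolding G_def by blast
  \<comment> \<open>The multiplicity \<open>n\<close> is a unit of the field, so it does not affect
    membership.\<close>
  have "lookup G \<beta>0 \<notin> frob_ideal (p ^ e) M"
  proof
    assume in_ideal: "lookup G \<beta>0 \<in> frob_ideal (p ^ e) M"
    have "(of_nat n :: 'k) \<noteq> 0" using \<beta>0(2) by (simp add: of_nat_eq_0_iff_char_dvd p_def)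
    moreover have "(of_nat n :: ('v, 'k) mpoly) = mconst (of_nat n)" by (simp add: mconst_def)
    ultimately have "mconst (inverse (of_nat n)) * (of_nat n :: ('v, 'k) mpoly) = 1"
      by (metis left_inverse mconst_simps(2,4))
    then have "(\<Prod>l\<in>L. f (\<sigma>0 l) ^ p ^ k l) = mconst (inverse (of_nat n)) * lookup G \<beta>0"
      unfolding \<beta>0(1) mult.assoc[symmetric] by simp
    then show False
      using notin idl.subspace_scale[OF frob_ideal_subspace[OF M] in_ideal] by metis
  qed
  then obtain \<phi> where \<phi>: "frob_lin (p ^ e) \<phi>" "\<phi> (lookup G \<beta>0) \<notin> M"
    unfolding frob_ideal_def by blast
  have frob: "(x + y) ^ p ^ e = x ^ p ^ e + y ^ p ^ e" for x y :: "('c \<times> 's, ('v, 'k) mpoly) mpoly"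
    using frobenius_add[where ?'a = "('c \<times> 's, ('v, 'k) mpoly) mpoly", of x y e] p
    by (simp add: CHAR_poly_mapping p_def)
  have "frob_lin (p ^ e) (cart (p ^ e) \<phi> \<beta>0)"
    by (rule frob_lin_cart[OF q \<phi>(1) \<beta>0(4) frob])
  moreover have "cart (p ^ e) \<phi> \<beta>0 G = mconst (\<phi> (lookup G \<beta>0))"
  proof (rule poly_mapping_eqI)
    fix \<nu>
    note [simp] = frob_lin_0[OF \<phi>(1)]
    show "lookup (cart (p ^ e) \<phi> \<beta>0 G) \<nu> = lookup (mconst (\<phi> (lookup G \<beta>0))) \<nu>"
    proof (cases "\<nu> = 0")
      case True
      have "expo_scale (p ^ e) 0 = (0 :: 'c \<times> 's \<Rightarrow>\<^sub>0 nat)" by (rule poly_mapping_eqI) simp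
      then show ?thesis unfolding True lookup_cart[of "p ^ e" \<phi>, OF q frob_lin_0[OF \<phi>(1)]]
        by (simp add: mconst_def)
    next
      case False
      \<comment> \<open>A nonzero \<open>\<nu>\<close> asks for an exponent of at least q in some
        variable, which no monomial of \<open>G\<close> has.\<close>
      then obtain v where v: "lookup \<nu> v > 0" by (metis gr0I lookup_zero poly_mapping_eqI)
      have "p ^ e \<le> p ^ e * lookup \<nu> v" using v by simp
      then have "\<not> lookup (\<beta>0 + expo_scale (p ^ e) \<nu>) v < p ^ e"
        unfolding lookup_add lookup_expo_scale by linarith
      then have "\<beta>0 + expo_scale (p ^ e) \<nu> \<notin> keys G" using \<beta>0(3) by blast
      then have "lookup G (\<beta>0 + expo_scale (p ^ e) \<nu>) = 0" by (simp add: in_keys_iff)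
      then show ?thesis using False unfolding lookup_cart[of "p ^ e" \<phi>, OF q frob_lin_0[OF \<phi>(1)]]
        by (simp add: mconst_def lookup_single)
    qed
  qed
  ultimately show ?thesis using that \<phi>(2) unfolding G_def by blast
qed

section \<open>Digit expansions of powers of an ideal\<close>

text \<open>An ideal with a reduction generated by \<open>\<rho>\<close> elements \<open>spreads\<close>: modulo \<open>Q\<close> the exponents of these elements are
  below \<open>p ^ e\<close>, and each of their base-\<open>p\<close> digits is at most \<open>p - 1\<close>.\<close>

definition digit_spread :: "nat \<Rightarrow> nat \<Rightarrow> ('s \<Rightarrow> 'a::comm_ring_1) \<Rightarrow> nat \<Rightarrow> 'a set \<Rightarrow> nat \<Rightarrow> bool" where
  "digit_spread p \<rho> f e Q N \<longleftrightarrow> (\<exists>(L :: (nat \<times> nat \<times> nat) set) j k. finite L \<and> (\<forall>l\<in>L. k l < e) \<and>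
     (\<forall>\<kappa>. card {l \<in> L. k l = \<kappa>} \<le> \<rho> * (p - 1)) \<and> (\<Sum>l\<in>L. p ^ k l) = N \<and>
     (\<Prod>l\<in>L. f (j l) ^ p ^ k l) \<notin> Q)"

text \<open>The loss \<open>m\<close> is chosen before \<open>e\<close>, \<open>Q\<close> and
  \<open>N\<close>; this uniformity is what makes it negligible against p^e.\<close>

definition spreads :: "nat \<Rightarrow> nat \<Rightarrow> ('s \<Rightarrow> 'a::comm_ring_1) \<Rightarrow> bool" where
  "spreads p \<rho> f \<longleftrightarrow> (\<exists>m. \<forall>e Q N. idl.subspace Q \<longrightarrow> (\<forall>j. f j ^ p ^ e \<in> Q) \<longrightarrow>
     \<not> mons (range f) (N + m) \<subseteq> Q \<longrightarrow> digit_spread p \<rho> f e Q N)"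

section \<open>From the generators of a reduction to the given generators\<close>

lemma span_frobenius_power:
  fixes F :: "'a::comm_ring_1 set"
  assumes frob: "\<And>x y :: 'a. (x + y) ^ q = x ^ q + y ^ q" and "q > 0" and "x \<in> idl.span F"
  shows "x ^ q \<in> idl.span ((\<lambda>a. a ^ q) ` F)"
  using assms(3)
proof (induction rule: idl.span_induct_alt)
  case base
  then show ?case using \<open>q > 0\<close> by (simp add: zero_power idl.span_zero)
next
  case (step c x y)
  then have "x ^ q \<in> idl.span ((\<lambda>a. a ^ q) ` F)" "y ^ q \<in> idl.span ((\<lambda>a. a ^ q) ` F)"
    by (auto intro: idl.span_base)
  then show ?case unfolding frob power_mult_distrib by (intro idl.span_add idl.span_scale)
qed

text \<open>Replaces one factor at a time. As the Frobenius power is additive, if every generator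
  sent the product into \<open>Q\<close>, so would any element of their span.\<close>

lemma select_generators:
  fixes F :: "'a::comm_ring_1 set" and q :: "'l \<Rightarrow> nat"
  assumes frob: "\<And>l x y. (x + y :: 'a) ^ q l = x ^ q l + y ^ q l" and "\<And>l. q l > 0"
    and Q: "idl.subspace Q" and "finite L" and "\<And>l. l \<in> L \<Longrightarrow> g l \<in> idl.span F"
    and "z * (\<Prod>l\<in>L. g l ^ q l) \<notin> Q"
  shows "\<exists>g'. (\<forall>l\<in>L. g' l \<in> F) \<and> z * (\<Prod>l\<in>L. g' l ^ q l) \<notin> Q"
  using assms(4-6)
proof (induction L arbitrary: z rule: finite_induct)
  case (insert l0 L)
  let ?R = "z * (\<Prod>l\<in>L. g l ^ q l)"
  have "\<exists>a\<in>F. ?R * a ^ q l0 \<notin> Q"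
  proof (rule ccontr)
    assume "\<not> ?thesis"
    then have "(\<lambda>a. a ^ q l0) ` F \<subseteq> {x. ?R * x \<in> Q}" by auto
    moreover have "idl.subspace {x. ?R * x \<in> Q}"
      using Q unfolding idl.subspace_def by (auto simp: distrib_left mult.left_commute[of ?R])
    ultimately have "idl.span ((\<lambda>a. a ^ q l0) ` F) \<subseteq> {x. ?R * x \<in> Q}" by (rule idl.span_minimal)
    moreover have "g l0 ^ q l0 \<in> idl.span ((\<lambda>a. a ^ q l0) ` F)"
      using insert.prems(1) by (intro span_frobenius_power frob assms(2)) auto
    ultimately have "?R * g l0 ^ q l0 \<in> Q" by blast
    moreover have "?R * g l0 ^ q l0 = z * (\<Prod>l\<in>insert l0 L. g l ^ q l)"
      using insert.hyps by (simp add: mult_ac)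
    ultimately show False using insert.prems(2) by simp
  qed
  then obtain a where a: "a \<in> F" "?R * a ^ q l0 \<notin> Q" by blast
  have "(z * a ^ q l0) * (\<Prod>l\<in>L. g l ^ q l) \<notin> Q" using a(2) by (simp add: mult_ac)
  with insert.IH[of "z * a ^ q l0"] insert.prems(1)
  obtain g' where g': "\<forall>l\<in>L. g' l \<in> F" "(z * a ^ q l0) * (\<Prod>l\<in>L. g' l ^ q l) \<notin> Q" by auto
  have "(\<Prod>l\<in>insert l0 L. (g'(l0 := a)) l ^ q l) = a ^ q l0 * (\<Prod>l\<in>L. (g'(l0 := a)) l ^ q l)"
    using insert.hyps by simp
  also have "(\<Prod>l\<in>L. (g'(l0 := a)) l ^ q l) = (\<Prod>l\<in>L. g' l ^ q l)"
    using insert.hyps by (intro prod.cong refl) auto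
  finally have "z * (\<Prod>l\<in>insert l0 L. (g'(l0 := a)) l ^ q l) \<notin> Q"
    using g'(2) by (simp add: mult.assoc)
  moreover have "\<forall>l\<in>insert l0 L. (g'(l0 := a)) l \<in> F" using g'(1) a(1) by auto
  ultimately show ?case by blast
qed simp

lemma base_expansion:
  assumes "p > 0" "b < p ^ e"
  shows "(\<Sum>\<kappa><e. (b div p ^ \<kappa>) mod p * p ^ \<kappa>) = (b :: nat)"
  using assms(2)
proof (induction e arbitrary: b)
  case (Suc e)
  have "b div p < p ^ e" using Suc.prems assms(1) by (simp add: less_mult_imp_div_less mult.commute)
  note IH = Suc.IH[OF this]
  have "(\<Sum>\<kappa><Suc e. (b div p ^ \<kappa>) mod p * p ^ \<kappa>) = b mod p + p * (\<Sum>\<kappa><e. (b div p div p ^ \<kappa>) mod p * p ^ \<kappa>)"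
    by (simp add: sum.lessThan_Suc_shift sum_distrib_left mult_ac div_mult2_eq del: sum.lessThan_Suc)
  then show ?case unfolding IH by simp
qed simp

text \<open>A base-p digit d of the exponent of \<open>h l\<close> at level \<kappa> becomes d
  indices, namely triples of generator, level and copy. Exchanging the \<open>h l\<close> for
  elements \<open>f j\<close> afterwards keeps all levels.\<close>

lemma digit_spreadI:
  fixes f :: "'s \<Rightarrow> 'a::comm_ring_1" and h :: "nat \<Rightarrow> 'a"
  assumes p: "prime p" "CHAR('a) = p" and Q: "idl.subspace Q"
    and h: "\<And>l. l < r \<Longrightarrow> h l \<in> idl.span (range f)" and f: "\<And>j. f j ^ p ^ e \<in> Q"
    and notin: "(\<Prod>l<r. h l ^ \<beta> l) \<notin> Q"
  shows "digit_spread p r f e Q (\<Sum>l<r. \<beta> l)"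
proof -
  have p0: "p > 0" using p prime_gt_0_nat by blast
  have frob: "(x + y) ^ p ^ m = x ^ p ^ m + y ^ p ^ m" for x y :: 'a and m
    using frobenius_add[where ?'a = 'a, of x y m] p by simp
  \<comment> \<open>A larger exponent would contain h l ^ p ^ e, a combination of the elements f j ^
    p ^ e of \<open>Q\<close>.\<close>
  have \<beta>: "\<beta> l < p ^ e" if l: "l < r" for l
  proof (rule ccontr)
    assume "\<not> \<beta> l < p ^ e"
    then have "\<beta> l = p ^ e + (\<beta> l - p ^ e)" by simp
    then have pow: "h l ^ \<beta> l = h l ^ p ^ e * h l ^ (\<beta> l - p ^ e)" by (metis power_add)
    have "h l ^ p ^ e \<in> idl.span ((\<lambda>a. a ^ p ^ e) ` range f)"
      using p0 by (intro span_frobenius_power frob h[OF l]) simp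
    also have "\<dots> \<subseteq> Q" using f by (intro idl.span_minimal Q) auto
    finally have "h l ^ \<beta> l \<in> Q" unfolding pow by (rule subspace_mult_right[OF Q])
    then have "h l ^ \<beta> l * (\<Prod>l\<in>{..<r} - {l}. h l ^ \<beta> l) \<in> Q" by (rule subspace_mult_right[OF Q])
    moreover have "(\<Prod>l<r. h l ^ \<beta> l) = h l ^ \<beta> l * (\<Prod>l\<in>{..<r} - {l}. h l ^ \<beta> l)"
      using l by (intro prod.remove) auto
    ultimately show False using notin by simp
  qed
  define d where "d l \<kappa> = (\<beta> l div p ^ \<kappa>) mod p" for l \<kappa>
  have d: "d l \<kappa> \<le> p - 1" for l \<kappa> using p0 mod_less_divisor[of p "\<beta> l div p ^ \<kappa>"] unfolding d_def by linarith
  have \<beta>_sum: "\<beta> l = (\<Sum>\<kappa><e. d l \<kappa> * p ^ \<kappa>)" if "l < r" for l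
    unfolding d_def using base_expansion[OF p0 \<beta>[OF that]] by simp
  define L where "L = (SIGMA l:{..<r}. SIGMA \<kappa>:{..<e}. {..<d l \<kappa>})"
  have finL: "finite L" by (simp add: L_def)
  define k where "k x = fst (snd x)" for x :: "nat \<times> nat \<times> nat"
  have prod: "(\<Prod>x\<in>L. h (fst x) ^ p ^ k x) = (\<Prod>l<r. h l ^ \<beta> l)"
  proof -
    have "(\<Prod>x\<in>L. h (fst x) ^ p ^ k x) =
        (\<Prod>l<r. \<Prod>y\<in>(SIGMA \<kappa>:{..<e}. {..<d l \<kappa>}). h l ^ p ^ fst y)"
      unfolding L_def k_def by (simp add: prod.Sigma case_prod_unfold)
    also have "\<dots> = (\<Prod>l<r. \<Prod>\<kappa><e. \<Prod>t<d l \<kappa>. h l ^ p ^ \<kappa>)"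
      by (intro prod.cong refl, subst prod.Sigma) (simp_all add: case_prod_unfold)
    also have "\<dots> = (\<Prod>l<r. h l ^ \<beta> l)"
    proof (intro prod.cong refl)
      fix l assume "l \<in> {..<r}"
      have "(\<Prod>\<kappa><e. \<Prod>t<d l \<kappa>. h l ^ p ^ \<kappa>) = (\<Prod>\<kappa><e. h l ^ (d l \<kappa> * p ^ \<kappa>))"
        by (intro prod.cong refl) (simp add: power_mult[symmetric] mult.commute)
      also have "\<dots> = h l ^ (\<Sum>\<kappa><e. d l \<kappa> * p ^ \<kappa>)" by (rule power_sum[symmetric])
      finally show "(\<Prod>\<kappa><e. \<Prod>t<d l \<kappa>. h l ^ p ^ \<kappa>) = h l ^ \<beta> l"
        using \<beta>_sum \<open>l \<in> {..<r}\<close> by simp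
    qed
    finally show ?thesis .
  qed
  have sum: "(\<Sum>x\<in>L. p ^ k x) = (\<Sum>l<r. \<beta> l)"
  proof -
    have "(\<Sum>x\<in>L. p ^ k x) = (\<Sum>l<r. \<Sum>y\<in>(SIGMA \<kappa>:{..<e}. {..<d l \<kappa>}). p ^ fst y)"
      unfolding L_def k_def by (simp add: sum.Sigma case_prod_unfold)
    also have "\<dots> = (\<Sum>l<r. \<Sum>\<kappa><e. \<Sum>t<d l \<kappa>. p ^ \<kappa>)"
      by (intro sum.cong refl, subst sum.Sigma) (simp_all add: case_prod_unfold)
    finally show ?thesis using \<beta>_sum by simp
  qed
  have level: "card {x \<in> L. k x = \<kappa>} \<le> r * (p - 1)" for \<kappa>
  proof -
    have "{x \<in> L. k x = \<kappa>} \<subseteq> (SIGMA l:{..<r}. {\<kappa>} \<times> {..<p - 1})"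
    proof
      fix x assume "x \<in> {x \<in> L. k x = \<kappa>}"
      then have "fst x < r" "fst (snd x) = \<kappa>" "snd (snd x) < d (fst x) (fst (snd x))" by (auto simp: L_def k_def)
      with d[of "fst x" "fst (snd x)"] show "x \<in> (SIGMA l:{..<r}. {\<kappa>} \<times> {..<p - 1})"
        by (cases x; cases "snd x") auto
    qed
    then have "card {x \<in> L. k x = \<kappa>} \<le> card (SIGMA l:{..<r}. {\<kappa>} \<times> {..<p - 1})"
      by (rule card_mono[rotated]) simp
    then show ?thesis by simp
  qed
  have "1 * (\<Prod>x\<in>L. h (fst x) ^ p ^ k x) \<notin> Q" using notin prod by simp
  moreover have "h (fst x) \<in> idl.span (range f)" if "x \<in> L" for x using that h by (auto simp: L_def)
  ultimately have "\<exists>g'. (\<forall>x\<in>L. g' x \<in> range f) \<and> 1 * (\<Prod>x\<in>L. g' x ^ p ^ k x) \<notin> Q"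
    by (intro select_generators[where g = "\<lambda>x. h (fst x)"] frob Q finL) (use p0 in simp_all)
  then obtain g' where g': "\<forall>x\<in>L. g' x \<in> range f" "1 * (\<Prod>x\<in>L. g' x ^ p ^ k x) \<notin> Q" by blast
  from g'(1) have "\<forall>x\<in>L. \<exists>j. g' x = f j" by auto
  from bchoice[OF this] obtain j where j: "\<forall>x\<in>L. g' x = f (j x)" ..
  have "(\<Prod>x\<in>L. g' x ^ p ^ k x) = (\<Prod>x\<in>L. f (j x) ^ p ^ k x)" using j by (intro prod.cong) auto
  then have "(\<Prod>x\<in>L. f (j x) ^ p ^ k x) \<notin> Q" using g'(2) by simp
  moreover have "\<forall>x\<in>L. k x < e" by (auto simp: L_def k_def)
  ultimately show ?thesis unfolding digit_spread_def using finL level sum by blast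
qed

lemma mons_list:
  assumes "x \<in> mons (set hs) N"
  shows "\<exists>\<beta>. x = (\<Prod>l<length hs. (hs ! l) ^ \<beta> l) \<and> (\<Sum>l<length hs. \<beta> l) = N"
  using assms
proof (induction N arbitrary: x)
  case 0
  then show ?case by (intro exI[of _ "\<lambda>_. 0"]) simp
next
  case (Suc N)
  then obtain a b where ab: "x = a * b" "a \<in> set hs" "b \<in> mons (set hs) N" unfolding mons.simps by blast
  from Suc.IH[OF ab(3)] obtain \<beta> where \<beta>: "b = (\<Prod>l<length hs. (hs ! l) ^ \<beta> l)" "(\<Sum>l<length hs. \<beta> l) = N" by blast
  from ab(2) obtain i where i: "i < length hs" "hs ! i = a" by (auto simp: in_set_conv_nth)
  define \<gamma> where "\<gamma> = \<beta>(i := Suc (\<beta> i))"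
  have "(\<Prod>l<length hs. (hs ! l) ^ \<gamma> l) = hs ! i ^ \<gamma> i * (\<Prod>l\<in>{..<length hs} - {i}. (hs ! l) ^ \<gamma> l)"
    using i(1) by (intro prod.remove) auto
  also have "(\<Prod>l\<in>{..<length hs} - {i}. (hs ! l) ^ \<gamma> l) = (\<Prod>l\<in>{..<length hs} - {i}. (hs ! l) ^ \<beta> l)"
    by (intro prod.cong refl) (auto simp: \<gamma>_def)
  also have "hs ! i ^ \<gamma> i * \<dots> = a * (hs ! i ^ \<beta> i * (\<Prod>l\<in>{..<length hs} - {i}. (hs ! l) ^ \<beta> l))"
    by (simp add: \<gamma>_def i(2) mult.assoc)
  also have "hs ! i ^ \<beta> i * (\<Prod>l\<in>{..<length hs} - {i}. (hs ! l) ^ \<beta> l) = b"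
    unfolding \<beta>(1) using i(1) by (intro prod.remove[symmetric]) auto
  finally have "x = (\<Prod>l<length hs. (hs ! l) ^ \<gamma> l)" using ab(1) by simp
  moreover have "(\<Sum>l<length hs. \<gamma> l) = Suc N"
  proof -
    have "(\<Sum>l<length hs. \<gamma> l) = (\<Sum>l<length hs. \<beta> l + (if l = i then 1 else 0))"
      by (intro sum.cong refl) (auto simp: \<gamma>_def)
    then show ?thesis using i(1) \<beta>(2) by (simp add: sum.distrib)
  qed
  ultimately show ?case by blast
qed

text \<open>Iterates I^(m+1) = H I^m: each step trades a factor from \<open>I\<close> for one from
  \<open>H\<close>, while m factors remain in reserve.\<close>

lemma reduction_power_subset:
  fixes I :: "'a::comm_ring_1 set"
  assumes "idl.span {a * b | a b. a \<in> idl.span H \<and> b \<in> idl.span (mons I m)} = idl.span (mons I (Suc m))"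
  shows "mons I (N + m) \<subseteq> idl.span {h * b | h b. h \<in> mons H N \<and> b \<in> idl.span (mons I m)}" (is "_ \<subseteq> ?S N")
proof (induction N)
  case 0
  have "x \<in> ?S 0" if "x \<in> mons I m" for x
  proof (rule idl.span_base)
    have "x \<in> idl.span (mons I m)" "x = 1 * x" using that by (simp_all add: idl.span_base)
    then show "x \<in> {h * b | h b. h \<in> mons H 0 \<and> b \<in> idl.span (mons I m)}" unfolding mons.simps by blast
  qed
  then show ?case by auto
next
  case (Suc N)
  show ?case
  proof
    fix x assume "x \<in> mons I (Suc N + m)"
    then obtain a b where ab: "x = a * b" "a \<in> I" "b \<in> mons I (N + m)" unfolding add_Suc mons.simps by blast
    then have "b \<in> ?S N" using Suc by blast
    then have "a * b \<in> ?S (Suc N)"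
      using idl.span_base[of a "{a}"]
    proof (intro span_times[of a "{a}" b _ ])
      fix s t assume "s \<in> {a}" "t \<in> {h * b | h b. h \<in> mons H N \<and> b \<in> idl.span (mons I m)}"
      then obtain h c where t: "s = a" "t = h * c" "h \<in> mons H N" "c \<in> idl.span (mons I m)" by blast
      have "a * c \<in> idl.span (mons I (Suc m))"
      proof (rule span_times[OF idl.span_base[of a "{a}"] t(4)])
        fix u v assume "u \<in> {a}" "v \<in> mons I m"
        then show "u * v \<in> idl.span (mons I (Suc m))"
          using ab(2) by (intro idl.span_base) (unfold mons.simps, blast)
      qed simp
      then have "a * c \<in> idl.span {a * b | a b. a \<in> idl.span H \<and> b \<in> idl.span (mons I m)}"
        using assms by simp
      then have "h * (a * c) \<in> ?S (Suc N)"
      proof (rule span_times[OF idl.span_base[of h "{h}"], rotated])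
        fix u v assume "u \<in> {h}" "v \<in> {a * b | a b. a \<in> idl.span H \<and> b \<in> idl.span (mons I m)}"
        then obtain a' b' where v: "u = h" "v = a' * b'" "a' \<in> idl.span H" "b' \<in> idl.span (mons I m)" by blast
        have "a' * (h * b') \<in> ?S (Suc N)"
        proof (rule span_times[OF v(3) idl.span_base[of "h * b'" "{h * b'}"]])
          fix x y assume "x \<in> H" "y \<in> {h * b'}"
          then have "x * y = (x * h) * b'" "x * h \<in> mons H (Suc N)"
            using t(3) unfolding mons.simps by (auto simp: mult.assoc)
          then show "x * y \<in> ?S (Suc N)" using v(4) by (intro idl.span_base) blast
        qed simp
        then show "u * v \<in> ?S (Suc N)" unfolding v by (simp add: mult.left_commute)
      qed simp
      then show "s * t \<in> ?S (Suc N)" unfolding t by (simp add: mult.left_commute)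
    qed auto
    then show "x \<in> ?S (Suc N)" unfolding ab(1) .
  qed
qed

text \<open>As I^(N+m) lies in the ideal of degree N products of \<open>hs\<close>, one of these
  products must avoid \<open>Q\<close>; the uniform loss is the exponent of the reduction.\<close>

lemma spreads_reduction:
  fixes f :: "'s \<Rightarrow> 'a::comm_ring_1"
  assumes p: "prime p" "CHAR('a) = p"
    and hs: "set hs \<subseteq> idl.span (range f)"
    and red: "idl.span {a * b | a b. a \<in> idl.span (set hs) \<and> b \<in> idl.span (mons (idl.span (range f)) m)} =
      idl.span (mons (idl.span (range f)) (Suc m))"
  shows "spreads p (length hs) f"
  unfolding spreads_def
proof (intro exI[of _ m] allI impI)
  fix e Q N
  assume Q: "idl.subspace Q" and f: "\<forall>j. f j ^ p ^ e \<in> Q" and notsub: "\<not> mons (range f) (N + m) \<subseteq> Q"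
  have "\<not> mons (set hs) N \<subseteq> Q"
  proof
    assume "mons (set hs) N \<subseteq> Q"
    then have "{h * b | h b. h \<in> mons (set hs) N \<and> b \<in> idl.span (mons (idl.span (range f)) m)} \<subseteq> Q"
      using subspace_mult_right[OF Q] by blast
    then have "mons (idl.span (range f)) (N + m) \<subseteq> Q"
      using reduction_power_subset[OF red, of N] idl.span_minimal[OF _ Q] by blast
    then show False using notsub mons_mono[OF idl.span_superset, of "range f" "N + m"] by blast
  qed
  then obtain x where x: "x \<in> mons (set hs) N" "x \<notin> Q" by blast
  from mons_list[OF x(1)] obtain \<beta> where \<beta>: "x = (\<Prod>l<length hs. (hs ! l) ^ \<beta> l)" "(\<Sum>l<length hs. \<beta> l) = N" by blast
  have "digit_spread p (length hs) f e Q (\<Sum>l<length hs. \<beta> l)"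
    by (rule digit_spreadI[OF p Q]) (use hs f x(2) \<beta>(1) in \<open>auto simp: subset_iff\<close>)
  then show "digit_spread p (length hs) f e Q N" by (simp only: \<beta>(2))
qed

section \<open>Reductions up to a power of a nonzero element\<close>

text \<open>\<open>P\<close> marks the nontrivial coefficient vectors, whose sum \<open>S a\<close>
  may still be zero. At the lowest marked index y^a cancels, and all later terms retain a factor
  \<open>y\<close>.\<close>

lemma first_nonzero_coefficient:
  fixes y :: "'a::idom"
  assumes V: "idl.subspace V" and y: "y \<noteq> 0"
    and "\<And>a. S a \<in> V" "\<And>a. \<not> P a \<Longrightarrow> S a = 0" "\<exists>a<A. P a" "(\<Sum>a<A. y ^ a * S a) = 0"
  shows "\<exists>a<A. P a \<and> (\<exists>w\<in>V. S a = y * w)"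
  using assms(3-6)
proof (induction A arbitrary: S P)
  case (Suc A)
  define W where "W = (\<Sum>a<A. y ^ a * S (Suc a))"
  have W: "W \<in> V" unfolding W_def using Suc.prems(1) by (intro idl.subspace_sum[OF V] idl.subspace_scale[OF V])
  have eq: "S 0 + y * W = 0"
    using Suc.prems(4) unfolding W_def sum_distrib_left
    by (simp add: sum.lessThan_Suc_shift mult.assoc del: sum.lessThan_Suc)
  show ?case
  proof (cases "P 0")
    case True
    have "S 0 = y * (- W)" using eq by (simp add: eq_neg_iff_add_eq_0)
    moreover have "- W \<in> V" using idl.subspace_neg[OF V W] .
    ultimately show ?thesis using True by blast
  next
    case False
    then have "S 0 = 0" using Suc.prems(2) by blast
    with eq y have "(\<Sum>a<A. y ^ a * S (Suc a)) = 0" unfolding W_def by simp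
    moreover have "\<exists>a<A. P (Suc a)" using Suc.prems(3) False by (metis less_Suc_eq_0_disj)
    ultimately have "\<exists>a<A. P (Suc a) \<and> (\<exists>w\<in>V. S (Suc a) = y * w)"
      using Suc.IH[of "\<lambda>a. S (Suc a)" "\<lambda>a. P (Suc a)"] Suc.prems(1,2) by blast
    then show ?thesis by blast
  qed
qed simp

lemma poly_box_prod:
  fixes f :: "'i \<Rightarrow> ('v, 'a::comm_ring_1) mpoly"
  shows "finite T \<Longrightarrow> (\<And>j. j \<in> T \<Longrightarrow> f j \<in> poly_box (D j)) \<Longrightarrow> prod f T \<in> poly_box (sum D T)"
  by (induction T rule: finite_induct) (auto intro: poly_box_1 poly_box_mult)

lemma poly_boxes_exist:
  fixes T :: "('v::finite, 'a::zero) mpoly set"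
  assumes "finite T"
  shows "\<exists>D. T \<subseteq> poly_box D"
  using assms
proof (induction T rule: finite_induct)
  case (insert x T)
  then obtain D where "T \<subseteq> poly_box D" by blast
  moreover obtain D' where "x \<in> poly_box D'" using poly_box_exists by blast
  ultimately have "insert x T \<subseteq> poly_box (max D D')" 
    using poly_box_mono[of _ D "max D D'"] poly_box_mono[of x D' "max D D'"] by auto
  then show ?case by blast
qed simp

text \<open>There are more products \<open>y ^ a * f ^ \<beta>\<close> in \<open>n + 1\<close> elements \<open>f j\<close> than monomials in \<open>n\<close> variables.\<close>

lemma homogeneous_relation:
  fixes f :: "nat \<Rightarrow> ('v::{finite,linorder}, 'a::idom) mpoly"
  defines "n \<equiv> CARD('v)"
  assumes y: "y \<noteq> 0"
  obtains A c where "A > 0" "\<exists>\<beta>\<in>{..<n} \<rightarrow>\<^sub>E {..A}. c \<beta> \<noteq> 0"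
    "\<exists>w\<in>idl.span (mons (f ` {..n}) (n * A)).
      (\<Sum>\<beta>\<in>{..<n} \<rightarrow>\<^sub>E {..A}. mconst (c \<beta>) * ((\<Prod>j<n. f (Suc j) ^ \<beta> j) * f 0 ^ (n * A - sum \<beta> {..<n}))) = y * w"
proof -
  obtain D where D: "insert y (f ` {..n}) \<subseteq> poly_box D" using poly_boxes_exist[of "insert y (f ` {..n})"] by auto
  \<comment> \<open>Calibrated for the count: with E = D (n + 1) A one gets (E + 1)^n \<le> A (A +
    1)^n < (A + 1)^(n+1), the number of pairs of a power of \<open>y\<close> and an exponent
    vector.\<close>
  define A where "A = (D * (n + 1) + 1) ^ n"
  have n: "n > 0" by (simp add: n_def)
  define T where "T = {..<n} \<rightarrow>\<^sub>E {..A}"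
  have finT: "finite T" by (simp add: T_def finite_PiE)
  have \<beta>_le: "sum \<beta> {..<n} \<le> n * A" if "\<beta> \<in> T" for \<beta>
    using sum_bounded_above[of "{..<n}" \<beta> A] that by (auto simp: T_def PiE_iff)
  \<comment> \<open>The factor \<open>f 0\<close> pads every product to the common degree n A, which
    makes the relation homogeneous.\<close>
  define mon where "mon \<beta> = (\<Prod>j<n. f (Suc j) ^ \<beta> j) * f 0 ^ (n * A - sum \<beta> {..<n})" for \<beta>
  define E where "E = D * (n + 1) * A"
  have mon_box: "mon \<beta> \<in> poly_box (D * (n * A))" if \<beta>: "\<beta> \<in> T" for \<beta>
  proof -
    have "(\<Prod>j<n. f (Suc j) ^ \<beta> j) \<in> poly_box (\<Sum>j<n. D * \<beta> j)"
      using D by (intro poly_box_prod poly_box_power) auto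
    moreover have "f 0 ^ (n * A - sum \<beta> {..<n}) \<in> poly_box (D * (n * A - sum \<beta> {..<n}))"
      using D by (intro poly_box_power) auto
    ultimately have "mon \<beta> \<in> poly_box ((\<Sum>j<n. D * \<beta> j) + D * (n * A - sum \<beta> {..<n}))"
      unfolding mon_def by (rule poly_box_mult)
    also have "(\<Sum>j<n. D * \<beta> j) + D * (n * A - sum \<beta> {..<n}) = D * (n * A)"
      unfolding sum_distrib_left[symmetric] distrib_left[symmetric] using \<beta>_le[OF \<beta>] by simp
    finally show ?thesis .
  qed
  have mon_mons: "mon \<beta> \<in> mons (f ` {..n}) (n * A)" if \<beta>: "\<beta> \<in> T" for \<beta>
  proof -
    have "(\<Prod>j<n. f (Suc j) ^ \<beta> j) \<in> mons (f ` {..n}) (sum \<beta> {..<n})"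
      by (intro mons_prod mons_power) auto
    moreover have "f 0 ^ (n * A - sum \<beta> {..<n}) \<in> mons (f ` {..n}) (n * A - sum \<beta> {..<n})"
      by (intro mons_power) auto
    ultimately have "mon \<beta> \<in> mons (f ` {..n}) (sum \<beta> {..<n} + (n * A - sum \<beta> {..<n}))"
      unfolding mon_def by (rule mons_mult)
    then show ?thesis using \<beta>_le[OF \<beta>] by simp
  qed
  define X where "X = {..<Suc A} \<times> T"
  have box: "y ^ a * mon \<beta> \<in> poly_box E" if "a < Suc A" "\<beta> \<in> T" for a \<beta>
  proof -
    have "y ^ a * mon \<beta> \<in> poly_box (D * a + D * (n * A))"
      using D by (intro poly_box_mult poly_box_power mon_box that) auto
    moreover have "D * a + D * (n * A) \<le> D * A + D * (n * A)" using that(1) by simp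
    then have "D * a + D * (n * A) \<le> E" unfolding E_def by (simp add: algebra_simps)
    ultimately show ?thesis by (rule poly_box_mono)
  qed
  have "card (expo_box (Suc E) :: ('v \<Rightarrow>\<^sub>0 nat) set) = (E + 1) ^ n"
    by (simp add: card_expo_box n_def)
  also have "\<dots> \<le> ((D * (n + 1) + 1) * (A + 1)) ^ n"
    unfolding E_def by (intro power_mono) (simp_all add: algebra_simps)
  also have "\<dots> = A * (A + 1) ^ n" by (simp only: power_mult_distrib A_def)
  also have "\<dots> < (A + 1) * (A + 1) ^ n" by simp
  also have "\<dots> = card X"
    by (simp add: X_def T_def card_cartesian_product card_PiE)
  finally have "card (expo_box (Suc E) :: ('v \<Rightarrow>\<^sub>0 nat) set) < card X" .
  moreover have "finite X" using finT by (simp add: X_def)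
  ultimately obtain c where c: "\<exists>x\<in>X. c x \<noteq> 0"
    "\<And>\<mu>. \<mu> \<in> expo_box (Suc E) \<Longrightarrow> (\<Sum>x\<in>X. c x * lookup (y ^ fst x * mon (snd x)) \<mu>) = 0"
    using linear_dependence[OF finite_expo_box, of X "Suc E" "\<lambda>x. lookup (y ^ fst x * mon (snd x))"] by blast
  have zero: "(\<Sum>x\<in>X. mconst (c x) * (y ^ fst x * mon (snd x))) = 0"
  proof (rule poly_mapping_eqI)
    fix \<mu>
    show "lookup (\<Sum>x\<in>X. mconst (c x) * (y ^ fst x * mon (snd x))) \<mu> = lookup 0 \<mu>"
    proof (cases "\<mu> \<in> expo_box (Suc E)")
      case True
      then show ?thesis using c(2) by (simp add: lookup_sum)
    next
      case False
      then have "lookup (y ^ fst x * mon (snd x)) \<mu> = 0" if "x \<in> X" for x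
        using that by (intro lookup_outside_poly_box[OF box]) (auto simp: X_def)
      then show ?thesis by (simp add: lookup_sum)
    qed
  qed
  \<comment> \<open>The dependence is grouped by powers of \<open>y\<close>; its lowest nontrivial
    group is the relation modulo \<open>y\<close>.\<close>
  define S where "S a = (\<Sum>\<beta>\<in>T. mconst (c (a, \<beta>)) * mon \<beta>)" for a
  have "(\<Sum>a<Suc A. y ^ a * S a) = (\<Sum>x\<in>X. mconst (c x) * (y ^ fst x * mon (snd x)))"
    unfolding X_def S_def sum_distrib_left
    by (subst sum.Sigma) (use finT in \<open>simp_all add: case_prod_unfold mult.left_commute del: sum.lessThan_Suc\<close>)
  with zero have "(\<Sum>a<Suc A. y ^ a * S a) = 0" by simp
  moreover have "S a \<in> idl.span (mons (f ` {..n}) (n * A))" for a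
    unfolding S_def by (intro idl.span_sum idl.span_scale idl.span_base mon_mons)
  moreover have "\<exists>a<Suc A. \<exists>\<beta>\<in>T. c (a, \<beta>) \<noteq> 0" using c(1) by (auto simp: X_def)
  moreover have "S a = 0" if "\<not> (\<exists>\<beta>\<in>T. c (a, \<beta>) \<noteq> 0)" for a
    unfolding S_def using that by (intro sum.neutral) auto
  ultimately have "\<exists>a<Suc A. (\<exists>\<beta>\<in>T. c (a, \<beta>) \<noteq> 0) \<and>
      (\<exists>w\<in>idl.span (mons (f ` {..n}) (n * A)). S a = y * w)"
    by (intro first_nonzero_coefficient[OF idl.subspace_span y]) blast+
  then obtain a where a: "\<exists>\<beta>\<in>T. c (a, \<beta>) \<noteq> 0" "\<exists>w\<in>idl.span (mons (f ` {..n}) (n * A)). S a = y * w"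
    by blast
  have "A > 0" by (simp add: A_def)
  then show ?thesis using that[of A "\<lambda>\<beta>. c (a, \<beta>)"] a unfolding S_def T_def mon_def by blast
qed

text \<open>\<open>tail_ideal X F N\<close> is \<open>X * F ^ (N - 1)\<close>, and zero for \<open>N = 0\<close>.\<close>

definition tail_ideal :: "'a::comm_ring_1 set \<Rightarrow> 'a set \<Rightarrow> nat \<Rightarrow> 'a set" where
  "tail_ideal X F N = idl.span {x * b | x b M. x \<in> X \<and> b \<in> mons F M \<and> Suc M = N}"

text \<open>Congruence in degree \<open>N\<close> up to products with a factor from
  \<open>X\<close>. Both sides are required to lie in the degree \<open>N\<close> span, so that
  congruences multiply with degrees adding.\<close>

definition tail_cong :: "'a::comm_ring_1 set \<Rightarrow> 'a set \<Rightarrow> nat \<Rightarrow> 'a \<Rightarrow> 'a \<Rightarrow> bool" where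
  "tail_cong X F N a b \<longleftrightarrow> a \<in> idl.span (mons F N) \<and> b \<in> idl.span (mons F N) \<and> a - b \<in> tail_ideal X F N"

lemma tail_ideal_mult:
  assumes "a \<in> idl.span (mons F M)" "t \<in> tail_ideal X F N"
  shows "a * t \<in> tail_ideal X F (M + N)"
  using assms unfolding tail_ideal_def
proof (rule span_times)
  fix s t assume "s \<in> mons F M" "t \<in> {x * b | x b M. x \<in> X \<and> b \<in> mons F M \<and> Suc M = N}"
  then obtain x b K where t: "s \<in> mons F M" "t = x * b" "x \<in> X" "b \<in> mons F K" "Suc K = N" by blast
  have "s * t = x * (s * b)" unfolding t(2) by (rule mult.left_commute)
  moreover have "s * b \<in> mons F (M + K)" using t by (intro mons_mult)
  moreover have "Suc (M + K) = M + N" using t(5) by simp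
  ultimately show "s * t \<in> idl.span {x * b | x b K. x \<in> X \<and> b \<in> mons F K \<and> Suc K = M + N}"
    using t(3) by (intro idl.span_base) blast
qed

lemma tail_cong_mult:
  assumes "tail_cong X F M a b" "tail_cong X F N c d"
  shows "tail_cong X F (M + N) (a * c) (b * d)"
  unfolding tail_cong_def
proof (intro conjI)
  have prod: "x * y \<in> idl.span (mons F (M + N))" if "x \<in> idl.span (mons F M)" "y \<in> idl.span (mons F N)" for x y
    using that by (rule span_times) (auto intro: idl.span_base mons_mult)
  show "a * c \<in> idl.span (mons F (M + N))" "b * d \<in> idl.span (mons F (M + N))"
    using assms by (auto simp: tail_cong_def intro: prod)
  have "a * (c - d) \<in> tail_ideal X F (M + N)" "d * (a - b) \<in> tail_ideal X F (N + M)"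
    using assms by (auto simp: tail_cong_def intro: tail_ideal_mult)
  then have "a * (c - d) + d * (a - b) \<in> tail_ideal X F (M + N)"
    unfolding tail_ideal_def by (simp add: add.commute idl.span_add)
  moreover have "a * c - b * d = a * (c - d) + d * (a - b)" by (simp add: algebra_simps)
  ultimately show "a * c - b * d \<in> tail_ideal X F (M + N)" by simp
qed

lemma tail_cong_refl: "a \<in> idl.span (mons F N) \<Longrightarrow> tail_cong X F N a a"
  by (simp add: tail_cong_def tail_ideal_def idl.span_zero)

lemma tail_cong_power: "tail_cong X F 1 a b \<Longrightarrow> tail_cong X F n (a ^ n) (b ^ n)"
proof (induction n)
  case 0
  then show ?case by (simp add: tail_cong_refl idl.span_base)
next
  case (Suc n)
  then show ?case using tail_cong_mult[of X F 1 a b n] by simp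
qed

lemma tail_cong_prod:
  assumes "finite T" "\<And>j. j \<in> T \<Longrightarrow> tail_cong X F (N j) (a j) (b j)"
  shows "tail_cong X F (sum N T) (prod a T) (prod b T)"
  using assms
proof (induction T rule: finite_induct)
  case empty
  then show ?case by (simp add: tail_cong_refl idl.span_base)
next
  case (insert x T)
  then show ?case by (simp add: tail_cong_mult)
qed

section \<open>Elimination of one generator\<close>

lemma nonroot_exists:
  fixes c :: "'i \<Rightarrow> 'a::idom"
  assumes "infinite (UNIV :: 'a set)" "finite T" "inj_on \<kappa> T" "i \<in> T" "c i \<noteq> 0"
  obtains z where "(\<Sum>i\<in>T. c i * z ^ \<kappa> i) \<noteq> 0"
proof -
  define g where "g = (\<Sum>i\<in>T. monom (c i) (\<kappa> i))"
  have "coeff g (\<kappa> i) = (\<Sum>j\<in>T. if j = i then c j else 0)"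
    unfolding g_def coeff_sum using assms(3,4)
    by (intro sum.cong refl) (auto dest: inj_onD)
  then have "g \<noteq> 0" using assms(2,4,5) by auto
  then have "finite {z. poly g z = 0}" by (rule poly_roots_finite)
  with assms(1) obtain z where "poly g z \<noteq> 0"
    using infinite_UNIV_listI ex_new_if_finite[of "{z. poly g z = 0}"] by auto
  then show ?thesis using that unfolding g_def by (simp add: poly_sum poly_monom)
qed

text \<open>A change of generators as in Noether normalization: modulo the differences with
  multiples of \<open>x0\<close>, every product in the homogeneous relation becomes a constant times
  x0^\<delta>, and the constants add up to \<open>D\<close>. A suitable z makes \<open>D\<close>
  nonzero.\<close>

lemma eliminate_generator:
  fixes x0 :: "('v::{finite,linorder}, 'a::idom) mpoly"
  assumes inf: "infinite (UNIV :: 'a set)" and y: "y \<noteq> 0" and len: "CARD('v) \<le> length rest"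
  obtains w D \<delta> where "D \<noteq> 0" "\<delta> > 0"
    "mconst D * x0 ^ \<delta> \<in> idl.span
      (tail_ideal (set (map (\<lambda>j. rest ! j - mconst (w j) * x0) [0..<length rest])) (set (x0 # rest)) \<delta> \<union>
       (*) y ` mons (set (x0 # rest)) \<delta>)"
proof -
  define n where "n = CARD('v)"
  define f where "f j = (x0 # rest) ! j" for j
  define F where "F = set (x0 # rest)"
  have f: "f 0 = x0" "f (Suc j) = rest ! j" for j by (simp_all add: f_def)
  have fF: "f ` {..n} \<subseteq> F"
    unfolding f_def F_def by (intro image_subsetI nth_mem) (use len in \<open>simp add: n_def\<close>)
  obtain A c where A: "A > 0" and c: "\<exists>\<beta>\<in>{..<n} \<rightarrow>\<^sub>E {..A}. c \<beta> \<noteq> 0"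
    and ex: "\<exists>w\<in>idl.span (mons (f ` {..n}) (n * A)).
      (\<Sum>\<beta>\<in>{..<n} \<rightarrow>\<^sub>E {..A}. mconst (c \<beta>) * ((\<Prod>j<n. f (Suc j) ^ \<beta> j) * f 0 ^ (n * A - sum \<beta> {..<n}))) = y * w"
    by (rule homogeneous_relation[OF y, of f, folded n_def])
  from ex obtain w0 where w0: "w0 \<in> idl.span (mons (f ` {..n}) (n * A))"
      "(\<Sum>\<beta>\<in>{..<n} \<rightarrow>\<^sub>E {..A}. mconst (c \<beta>) * ((\<Prod>j<n. f (Suc j) ^ \<beta> j) * f 0 ^ (n * A - sum \<beta> {..<n}))) = y * w0" ..
  define T where "T = {..<n} \<rightarrow>\<^sub>E {..A}"
  have finT: "finite T" by (simp add: T_def finite_PiE)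
  \<comment> \<open>The entries of \<open>\<beta>\<close> are at most A, hence digits in base A + 1;
    distinct vectors give distinct powers of z, and D is a nonzero polynomial in z.\<close>
  define \<kappa> where "\<kappa> \<beta> = (\<Sum>j<n. \<beta> j * (A + 1) ^ j)" for \<beta> :: "nat \<Rightarrow> nat"
  have inj: "inj_on \<kappa> T"
  proof (rule inj_onI)
    fix \<beta> \<gamma> assume bg: "\<beta> \<in> T" "\<gamma> \<in> T" "\<kappa> \<beta> = \<kappa> \<gamma>"
    have "\<beta> j = \<gamma> j" if "j < n" for j
      by (rule base_expansion_unique[of "A + 1" n \<beta> \<gamma> j])
        (use bg that in \<open>auto simp: T_def PiE_iff \<kappa>_def less_Suc_eq_le\<close>)
    then show "\<beta> = \<gamma>" using bg(1,2) unfolding T_def by (intro PiE_ext) auto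
  qed
  obtain \<beta>1 where "\<beta>1 \<in> T" "c \<beta>1 \<noteq> 0" using c by (auto simp: T_def)
  from nonroot_exists[where c = c, OF inf finT inj this] obtain z where z: "(\<Sum>\<beta>\<in>T. c \<beta> * z ^ \<kappa> \<beta>) \<noteq> 0" by blast
  \<comment> \<open>With these weights the product of the (w j)^(\<beta> j) is z^(\<kappa>
    \<beta>).\<close>
  define w where "w j = z ^ ((A + 1) ^ j)" for j :: nat
  define D where "D = (\<Sum>\<beta>\<in>T. c \<beta> * z ^ \<kappa> \<beta>)"
  define \<delta> where "\<delta> = n * A"
  have \<delta>: "\<delta> > 0" using A by (simp add: \<delta>_def n_def)
  have main: "mconst D * x0 ^ \<delta> \<in> idl.span (tail_ideal X F \<delta> \<union> (*) y ` mons F \<delta>)"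
    if X: "X = set (map (\<lambda>j. rest ! j - mconst (w j) * x0) [0..<length rest])" for X
  proof -
    have x0F: "x0 \<in> idl.span (mons F 1)" by (intro idl.span_base mons_base) (simp add: F_def)
    have diff: "rest ! j - mconst (w j) * x0 \<in> X" if "j < n" for j
      unfolding X using that len by (auto simp: n_def)
    have "1 \<in> mons F 0" by simp
    have cong1: "tail_cong X F 1 (rest ! j) (mconst (w j) * x0)" if j: "j < n" for j
      unfolding tail_cong_def
    proof (intro conjI)
      show "rest ! j \<in> idl.span (mons F 1)"
        using j len by (intro idl.span_base mons_base) (simp add: F_def n_def)
      show "mconst (w j) * x0 \<in> idl.span (mons F 1)" by (intro idl.span_scale x0F)
      have "(rest ! j - mconst (w j) * x0) * 1 \<in> {x * b | x b M. x \<in> X \<and> b \<in> mons F M \<and> Suc M = 1}"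
        using diff[OF j] \<open>1 \<in> mons F 0\<close>
        by (intro CollectI exI[of _ "rest ! j - mconst (w j) * x0"] exI[of _ 1] exI[of _ 0]) auto
      then show "rest ! j - mconst (w j) * x0 \<in> tail_ideal X F 1"
        unfolding tail_ideal_def by (intro idl.span_base) simp
    qed
    have mon: "(\<Prod>j<n. f (Suc j) ^ \<beta> j) * f 0 ^ (n * A - sum \<beta> {..<n}) - mconst (z ^ \<kappa> \<beta>) * x0 ^ \<delta> \<in> tail_ideal X F \<delta>"
      if \<beta>: "\<beta> \<in> T" for \<beta>
    proof -
      have le: "sum \<beta> {..<n} \<le> n * A"
        using sum_bounded_above[of "{..<n}" \<beta> A] \<beta> by (auto simp: T_def PiE_iff)
      have "tail_cong X F (sum \<beta> {..<n}) (\<Prod>j<n. (rest ! j) ^ \<beta> j) (\<Prod>j<n. (mconst (w j) * x0) ^ \<beta> j)"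
        by (intro tail_cong_prod tail_cong_power cong1) auto
      moreover have "tail_cong X F (n * A - sum \<beta> {..<n}) (x0 ^ (n * A - sum \<beta> {..<n})) (x0 ^ (n * A - sum \<beta> {..<n}))"
        by (intro tail_cong_power tail_cong_refl x0F)
      ultimately have "tail_cong X F (sum \<beta> {..<n} + (n * A - sum \<beta> {..<n}))
          ((\<Prod>j<n. (rest ! j) ^ \<beta> j) * x0 ^ (n * A - sum \<beta> {..<n}))
          ((\<Prod>j<n. (mconst (w j) * x0) ^ \<beta> j) * x0 ^ (n * A - sum \<beta> {..<n}))"
        by (rule tail_cong_mult)
      moreover have "(\<Prod>j<n. (mconst (w j) * x0) ^ \<beta> j) * x0 ^ (n * A - sum \<beta> {..<n}) = mconst (z ^ \<kappa> \<beta>) * x0 ^ \<delta>"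
      proof -
        have "(\<Prod>j<n. (mconst (w j) * x0) ^ \<beta> j) = (\<Prod>j<n. mconst (z ^ (\<beta> j * (A + 1) ^ j))) * (\<Prod>j<n. x0 ^ \<beta> j)"
          by (simp add: power_mult_distrib prod.distrib w_def mconst_power[symmetric] power_mult[symmetric] mult.commute)
        also have "(\<Prod>j<n. mconst (z ^ (\<beta> j * (A + 1) ^ j))) = mconst (z ^ \<kappa> \<beta>)"
          unfolding \<kappa>_def mconst_power by (rule power_sum[symmetric])
        also have "(\<Prod>j<n. x0 ^ \<beta> j) = x0 ^ sum \<beta> {..<n}" by (rule power_sum[symmetric])
        finally show ?thesis using le by (simp add: mult.assoc power_add[symmetric] \<delta>_def)
      qed
      ultimately show ?thesis using le by (simp add: tail_cong_def f \<delta>_def)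
    qed
    define U where "U = idl.span (tail_ideal X F \<delta> \<union> (*) y ` mons F \<delta>)"
    have U: "idl.subspace U" unfolding U_def by simp
    have tU: "tail_ideal X F \<delta> \<subseteq> U" unfolding U_def using idl.span_superset by blast
    have "y * w0 \<in> U"
    proof -
      have "idl.subspace {x. y * x \<in> U}"
        using U unfolding idl.subspace_def by (auto simp: distrib_left mult.left_commute[of y])
      moreover have "mons (f ` {..n}) \<delta> \<subseteq> {x. y * x \<in> U}"
        using mons_mono[OF fF, of \<delta>] unfolding U_def by (auto intro!: idl.span_base)
      ultimately have "idl.span (mons (f ` {..n}) \<delta>) \<subseteq> {x. y * x \<in> U}" by (rule idl.span_minimal[rotated])
      then show ?thesis using w0(1) unfolding \<delta>_def by blast
    qed
    moreover have "(\<Sum>\<beta>\<in>T. mconst (c \<beta>) * ((\<Prod>j<n. f (Suc j) ^ \<beta> j) * f 0 ^ (n * A - sum \<beta> {..<n}) - mconst (z ^ \<kappa> \<beta>) * x0 ^ \<delta>)) \<in> U"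
      using mon tU by (intro idl.subspace_sum[OF U] idl.subspace_scale[OF U]) blast
    moreover have "(\<Sum>\<beta>\<in>T. mconst (c \<beta>) * ((\<Prod>j<n. f (Suc j) ^ \<beta> j) * f 0 ^ (n * A - sum \<beta> {..<n}) - mconst (z ^ \<kappa> \<beta>) * x0 ^ \<delta>))
        = y * w0 - mconst D * x0 ^ \<delta>"
      unfolding w0(2)[symmetric] T_def[symmetric] D_def mconst_sum sum_distrib_right right_diff_distrib sum_subtractf
      by (simp add: mult.assoc)
    ultimately have "y * w0 - (y * w0 - mconst D * x0 ^ \<delta>) \<in> U" by (metis idl.subspace_diff[OF U])
    then show ?thesis unfolding U_def by simp
  qed
  show ?thesis by (rule that[of D \<delta> w]) (use z \<delta> main[OF refl] in \<open>simp_all add: D_def F_def\<close>)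
qed

text \<open>Substitute for dividing by the constant \<open>D\<close>, which is nonzero but in k[T]
  need not be a unit.\<close>

definition saturated :: "('v, 'a::comm_ring_1) mpoly set \<Rightarrow> bool" where
  "saturated Q \<longleftrightarrow> (\<forall>E z. E \<noteq> 0 \<longrightarrow> mconst E * z \<in> Q \<longrightarrow> z \<in> Q)"

lemma mons_insert_decompose:
  assumes "x \<in> mons F M" and F: "\<And>a. a \<in> F \<Longrightarrow> a \<in> idl.span (insert x0 X)"
  shows "x \<in> idl.span {x * x0 ^ i | x i K. x \<in> mons X K \<and> K + i = M}"
  using assms(1)
proof (induction M arbitrary: x)
  case 0
  then show ?case
    by (intro idl.span_base CollectI exI[of _ 1] exI[of _ 0]) simp
next
  case (Suc M)
  then obtain a b where ab: "x = a * b" "a \<in> F" "b \<in> mons F M" unfolding mons.simps by blast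
  show ?case unfolding ab(1)
  proof (rule span_times[OF F[OF ab(2)] Suc.IH[OF ab(3)]])
    fix s t assume s: "s \<in> insert x0 X" and "t \<in> {x * x0 ^ i | x i K. x \<in> mons X K \<and> K + i = M}"
    then obtain u i K where t: "t = u * x0 ^ i" "u \<in> mons X K" "K + i = M" by blast
    show "s * t \<in> idl.span {x * x0 ^ i | x i K. x \<in> mons X K \<and> K + i = Suc M}"
    proof (cases "s = x0")
      case True
      then have "s * t = u * x0 ^ Suc i" "K + Suc i = Suc M" using t by (simp_all add: mult.left_commute)
      then show ?thesis using t(2) by (intro idl.span_base) blast
    next
      case False
      then have "s * u \<in> mons X (Suc K)" unfolding mons.simps using s t(2) by blast
      moreover have "s * t = (s * u) * x0 ^ i" "Suc K + i = Suc M" using t by (simp_all add: mult.assoc)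
      ultimately show ?thesis by (intro idl.span_base) blast
    qed
  qed
qed

text \<open>Up to the constant \<open>D\<close>, a factor x0^\<delta> is traded for terms with a
  factor from \<open>X\<close> or with an additional \<open>y\<close>. The process ends when y^J or
  \<open>N\<close> factors from \<open>X\<close> have accumulated.\<close>

lemma eliminate_generator_subset:
  fixes x0 :: "('v, 'a::comm_ring_1) mpoly"
  assumes Q: "idl.subspace Q" "saturated Q" "y ^ J \<in> Q" and "D \<noteq> 0" "\<delta> > 0"
    and rel: "mconst D * x0 ^ \<delta> \<in> idl.span (tail_ideal X F \<delta> \<union> (*) y ` mons F \<delta>)"
    and F: "\<And>a. a \<in> F \<Longrightarrow> a \<in> idl.span (insert x0 X)"
    and sub: "mons X N \<subseteq> Q"
  shows "mons F (N + \<delta>) \<subseteq> Q"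
proof -
  have claim: "y ^ j * (x * x0 ^ b) \<in> Q" if "x \<in> mons X a" "a + b = N + \<delta>" for j x a b
    using that
  \<comment> \<open>An additional \<open>y\<close> lowers the first component; a new factor from
    \<open>X\<close> lowers the power of \<open>x0\<close> with the first component fixed.\<close>
  proof (induction "(J - j, b)" arbitrary: j x a b rule: wf_induct_rule[OF wf_lex_prod[OF wf_less_than wf_less_than]])
    case 1
    note IH = "1"(1)
    show ?case
    proof (cases "J \<le> j \<or> N \<le> a")
      case True
      then show ?thesis
      proof
        assume "J \<le> j"
        then have "y ^ j = y ^ J * y ^ (j - J)" by (simp flip: power_add)
        then show ?thesis using subspace_mult_right[OF Q(1,3)] by (simp add: mult.assoc)
      next
        assume "N \<le> a"
        then have "x \<in> mons X (N + (a - N))" using "1.prems" by simp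
        from mons_split[OF this] obtain u v where "u \<in> Q" "x = u * v" using sub by blast
        then show ?thesis
          by (metis mult.assoc idl.subspace_scale[OF Q(1)] subspace_mult_right[OF Q(1)])
      qed
    next
      case False
      \<comment> \<open>Fewer than \<open>N\<close> factors from \<open>X\<close> leave at least
        \<open>\<delta>\<close> factors \<open>x0\<close>, so the relation can be applied.\<close>
      then have b: "\<delta> \<le> b" using "1.prems" by linarith
      have IH': "y ^ j' * (x' * x0 ^ b') \<in> Q" if "x' \<in> mons X a'" "a' + b' = N + \<delta>" "j < j' \<or> (j = j' \<and> b' < b)"
        for j' x' a' b'
        by (rule IH[of j' b' x' a']) (use that False in auto)
      let ?R = "{r. y ^ j * (x * x0 ^ (b - \<delta>)) * r \<in> Q}"
      have R: "idl.subspace ?R"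
        using Q(1) unfolding idl.subspace_def by (auto simp: distrib_left mult.left_commute[of "y ^ j * (x * x0 ^ (b - \<delta>))"])
      have step: "y ^ j' * (x * x0 ^ (b - \<delta>)) * (s * m) \<in> Q"
        if m: "m \<in> mons F M" and s: "s \<in> mons X K" and eq: "K + M = \<delta>" and j': "j < j' \<or> (j = j' \<and> M < \<delta>)" for j' s m K M
      proof -
        let ?c = "y ^ j' * (x * x0 ^ (b - \<delta>)) * s"
        have "{u * x0 ^ i | u i L. u \<in> mons X L \<and> L + i = M} \<subseteq> {r. ?c * r \<in> Q}"
        proof safe
          fix u i L assume u: "u \<in> mons X L" "M = L + i"
          have "x * s * u \<in> mons X (a + K + L)" using "1.prems"(1) s u(1) by (intro mons_mult)
          moreover have "a + K + L + (b - \<delta> + i) = N + \<delta>" using "1.prems"(2) b eq u(2) by linarith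
          moreover have "j < j' \<or> (j = j' \<and> b - \<delta> + i < b)" using j' u(2) b by linarith
          ultimately have "y ^ j' * ((x * s * u) * x0 ^ (b - \<delta> + i)) \<in> Q" by (rule IH')
          moreover have "y ^ j' * ((x * s * u) * x0 ^ (b - \<delta> + i)) = ?c * (u * x0 ^ i)"
            by (simp only: power_add mult_ac)
          ultimately show "?c * (u * x0 ^ i) \<in> Q" by simp
        qed
        moreover have "idl.subspace {r. ?c * r \<in> Q}"
          using Q(1) unfolding idl.subspace_def by (auto simp: distrib_left mult.left_commute[of ?c])
        ultimately have "idl.span {u * x0 ^ i | u i L. u \<in> mons X L \<and> L + i = M} \<subseteq> {r. ?c * r \<in> Q}"
          by (rule idl.span_minimal)
        with mons_insert_decompose[OF m F] have "?c * m \<in> Q" by blast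
        then show ?thesis by (simp only: mult.assoc)
      qed
      have "tail_ideal X F \<delta> \<subseteq> ?R"
        unfolding tail_ideal_def
      proof (rule idl.span_minimal[OF _ R], safe)
        fix s m M assume "s \<in> X" "m \<in> mons F M" "\<delta> = Suc M"
        then show "y ^ j * (x * x0 ^ (b - Suc M)) * (s * m) \<in> Q"
          using step[of m M s 1 j] mons_base[of s X] by (simp del: mons.simps)
      qed
      moreover have "(*) y ` mons F \<delta> \<subseteq> ?R"
      proof safe
        fix m assume "m \<in> mons F \<delta>"
        then have "y ^ Suc j * (x * x0 ^ (b - \<delta>)) * (1 * m) \<in> Q" by (intro step[of m \<delta> 1 0]) auto
        moreover have "y ^ Suc j * (x * x0 ^ (b - \<delta>)) * (1 * m) = y ^ j * (x * x0 ^ (b - \<delta>)) * (y * m)"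
          by (simp only: power_Suc mult_1_left mult_ac)
        ultimately show "y ^ j * (x * x0 ^ (b - \<delta>)) * (y * m) \<in> Q" by (simp only:)
      qed
      ultimately have "idl.span (tail_ideal X F \<delta> \<union> (*) y ` mons F \<delta>) \<subseteq> ?R"
        by (intro idl.span_minimal R) blast
      with rel have "y ^ j * (x * x0 ^ (b - \<delta>)) * (mconst D * x0 ^ \<delta>) \<in> Q" by blast
      moreover have "y ^ j * (x * x0 ^ (b - \<delta>)) * (mconst D * x0 ^ \<delta>) = mconst D * (y ^ j * (x * (x0 ^ (b - \<delta>) * x0 ^ \<delta>)))"
        by (simp only: mult_ac)
      moreover have "x0 ^ (b - \<delta>) * x0 ^ \<delta> = x0 ^ b" using b by (simp flip: power_add)
      ultimately have "mconst D * (y ^ j * (x * x0 ^ b)) \<in> Q" by simp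
      then show ?thesis using Q(2) \<open>D \<noteq> 0\<close> unfolding saturated_def by blast
    qed
  qed
  show ?thesis
  proof
    fix x assume "x \<in> mons F (N + \<delta>)"
    from mons_insert_decompose[OF this F]
    have "x \<in> idl.span {x * x0 ^ i | x i K. x \<in> mons X K \<and> K + i = N + \<delta>}" .
    moreover have "{x * x0 ^ i | x i K. x \<in> mons X K \<and> K + i = N + \<delta>} \<subseteq> Q"
      using claim[where j = 0] by auto
    ultimately show "x \<in> Q" using idl.span_minimal[OF _ Q(1)] by blast
  qed
qed

text \<open>Generators are eliminated one by one, and the shifts \<delta> add up to
  \<open>m\<close>. The result is tested on ideals \<open>Q\<close> because the relations hold only
  up to nonzero constants and powers of \<open>y\<close>.\<close>

lemma reduction_to_dimension:
  fixes fs :: "('v::{finite,linorder}, 'a::idom) mpoly list"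
  assumes inf: "infinite (UNIV :: 'a set)" and y: "y \<noteq> 0"
  shows "\<exists>hs m. length hs \<le> CARD('v) \<and> set hs \<subseteq> idl.span (set fs) \<and>
    (\<forall>Q J N. idl.subspace Q \<longrightarrow> saturated Q \<longrightarrow> y ^ J \<in> Q \<longrightarrow> mons (set hs) N \<subseteq> Q \<longrightarrow> mons (set fs) (N + m) \<subseteq> Q)"
proof (induction "length fs" arbitrary: fs rule: less_induct)
  case less
  show ?case
  proof (cases "length fs \<le> CARD('v)")
    case True
    then show ?thesis
      by (intro exI[of _ fs] exI[of _ 0]) (auto simp: idl.span_superset)
  next
    case False
    then obtain x0 rest where fs: "fs = x0 # rest" by (cases fs) auto
    then have len: "CARD('v) \<le> length rest" using False by simp
    obtain w D \<delta> where D: "D \<noteq> 0" "\<delta> > 0"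
      "mconst D * x0 ^ \<delta> \<in> idl.span
        (tail_ideal (set (map (\<lambda>j. rest ! j - mconst (w j) * x0) [0..<length rest])) (set (x0 # rest)) \<delta> \<union>
         (*) y ` mons (set (x0 # rest)) \<delta>)"
      by (rule eliminate_generator[OF inf y len, of x0])
    define rest' where "rest' = map (\<lambda>j. rest ! j - mconst (w j) * x0) [0..<length rest]"
    have "length rest' < length fs" by (simp add: rest'_def fs)
    from less[OF this] obtain hs m where hs: "length hs \<le> CARD('v)" "set hs \<subseteq> idl.span (set rest')"
      "\<And>Q J N. idl.subspace Q \<Longrightarrow> saturated Q \<Longrightarrow> y ^ J \<in> Q \<Longrightarrow> mons (set hs) N \<subseteq> Q \<Longrightarrow> mons (set rest') (N + m) \<subseteq> Q"
      by blast
    have "set rest' \<subseteq> idl.span (set fs)"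
      unfolding rest'_def fs by (auto intro!: idl.span_diff idl.span_scale intro: idl.span_base)
    then have "idl.span (set rest') \<subseteq> idl.span (set fs)" by (rule idl.span_minimal) simp
    with hs(2) have sub: "set hs \<subseteq> idl.span (set fs)" by blast
    have F: "a \<in> idl.span (insert x0 (set rest'))" if a: "a \<in> set (x0 # rest)" for a
    proof (cases "a = x0")
      case True
      then show ?thesis by (simp add: idl.span_base)
    next
      case False
      then obtain j where j: "j < length rest" "a = rest ! j" using a by (auto simp: in_set_conv_nth)
      then have "a - mconst (w j) * x0 \<in> set rest'" by (auto simp: rest'_def)
      then have "(a - mconst (w j) * x0) + mconst (w j) * x0 \<in> idl.span (insert x0 (set rest'))"
        by (intro idl.span_add idl.span_scale) (auto intro: idl.span_base)
      then show ?thesis by simp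
    qed
    have "mons (set fs) (N + (m + \<delta>)) \<subseteq> Q"
      if "idl.subspace Q" "saturated Q" "y ^ J \<in> Q" "mons (set hs) N \<subseteq> Q" for Q J N
      using eliminate_generator_subset[OF that(1,2,3) D(1,2) D(3)[folded rest'_def] F hs(3)[OF that]]
      by (simp add: fs add.assoc)
    with hs(1) sub show ?thesis by blast
  qed
qed

section \<open>Extension of scalars to a polynomial ring\<close>

definition const_map :: "('v, 'k::comm_ring_1) mpoly \<Rightarrow> ('v, 'k poly) mpoly" where
  "const_map x = Poly_Mapping.map (\<lambda>c. [:c:]) x"

definition coeff_map :: "nat \<Rightarrow> ('v, 'k::comm_ring_1 poly) mpoly \<Rightarrow> ('v, 'k) mpoly" where
  "coeff_map i z = Poly_Mapping.map (\<lambda>g. coeff g i) z"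

lemma lookup_const_map: "lookup (const_map x) \<mu> = [:lookup x \<mu>:]"
  by (simp add: const_map_def Poly_Mapping.map.rep_eq when_def)

lemma lookup_coeff_map: "lookup (coeff_map i z) \<mu> = coeff (lookup z \<mu>) i"
  by (simp add: coeff_map_def Poly_Mapping.map.rep_eq when_def)

lemma const_map_add: "const_map (x + y) = const_map x + const_map y"
  by (rule poly_mapping_eqI) (simp add: lookup_const_map lookup_add)

lemma const_map_single: "const_map (single \<mu> c) = single \<mu> [:c:]"
  by (rule poly_mapping_eqI) (simp add: lookup_const_map lookup_single when_def)

lemma const_map_mult: "const_map (x * y) = const_map x * const_map y"
proof (rule additive_poly_mapping_eqI[of "\<lambda>x. const_map (x * y)"])
  fix \<mu> and a :: 'b
  show "const_map (single \<mu> a * y) = const_map (single \<mu> a) * const_map y"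
    by (rule additive_poly_mapping_eqI[of "\<lambda>y. const_map (single \<mu> a * y)"])
      (simp_all only: distrib_left const_map_add mult_single const_map_single, simp add: mult.commute)
qed (simp_all add: distrib_right const_map_add)

lemma const_map_1: "const_map 1 = 1"
  using const_map_single[of 0 1] by (simp only: single_one pCons_one)

lemma const_map_power: "const_map (x ^ n) = const_map x ^ n"
  by (induction n) (simp_all add: const_map_1 const_map_mult)

lemma const_map_prod: "const_map (prod f T) = (\<Prod>x\<in>T. const_map (f x))"
  by (induction T rule: infinite_finite_induct) (simp_all add: const_map_1 const_map_mult)

lemma coeff_map_add: "coeff_map i (x + y) = coeff_map i x + coeff_map i y"
  by (rule poly_mapping_eqI) (simp add: lookup_coeff_map lookup_add)

lemma coeff_map_single: "coeff_map i (single \<mu> c) = single \<mu> (coeff c i)"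
  by (rule poly_mapping_eqI) (simp add: lookup_coeff_map lookup_single when_def)

lemma coeff_map_const_map: "coeff_map i (const_map x) = (if i = 0 then x else 0)"
  by (rule poly_mapping_eqI) (simp add: lookup_coeff_map lookup_const_map coeff_pCons split: nat.split)

lemma coeff_map_single_mult:
  "coeff_map i (single \<mu> c * z) = (\<Sum>a\<le>i. single \<mu> (coeff c a) * coeff_map (i - a) z)"
proof (rule additive_poly_mapping_eqI[of "\<lambda>z. coeff_map i (single \<mu> c * z)"])
  fix \<nu> d
  have "coeff_map i (single \<mu> c * single \<nu> d) = single (\<mu> + \<nu>) (\<Sum>a\<le>i. coeff c a * coeff d (i - a))"
    by (simp add: mult_single coeff_map_single coeff_mult)
  also have "\<dots> = (\<Sum>a\<le>i. single (\<mu> + \<nu>) (coeff c a * coeff d (i - a)))"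
    by (rule additive_sum) (rule single_add)
  finally show "coeff_map i (single \<mu> c * single \<nu> d) =
      (\<Sum>a\<le>i. single \<mu> (coeff c a) * coeff_map (i - a) (single \<nu> d))"
    by (simp add: mult_single coeff_map_single)
qed (simp_all add: distrib_left coeff_map_add sum.distrib)

text \<open>The extension of \<open>Q\<close> to coefficients in k[T], described by the coefficients
  of the powers of T.\<close>

definition extended_ideal :: "('v, 'k::comm_ring_1) mpoly set \<Rightarrow> ('v, 'k poly) mpoly set" where
  "extended_ideal Q = {z. \<forall>i. coeff_map i z \<in> Q}"

lemma const_map_in_extended_ideal: "0 \<in> Q \<Longrightarrow> const_map x \<in> extended_ideal Q \<longleftrightarrow> x \<in> Q"
  by (auto simp: extended_ideal_def coeff_map_const_map)

lemma extended_ideal_subspace: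
  fixes Q :: "('v, 'k::comm_ring_1) mpoly set"
  assumes Q: "idl.subspace Q"
  shows "idl.subspace (extended_ideal Q)"
  unfolding idl.subspace_def
proof (intro conjI ballI allI)
  have "coeff_map i 0 = (0 :: ('v, 'k) mpoly)" for i by (rule poly_mapping_eqI) (simp add: lookup_coeff_map)
  then show "0 \<in> extended_ideal Q" using idl.subspace_0[OF Q] by (simp add: extended_ideal_def)
  show add: "x + y \<in> extended_ideal Q" if "x \<in> extended_ideal Q" "y \<in> extended_ideal Q" for x y
    using that idl.subspace_add[OF Q] by (simp add: extended_ideal_def coeff_map_add)
  fix c x assume x: "x \<in> extended_ideal Q"
  have "coeff_map i (c * x) \<in> Q" for i
  proof -
    have "coeff_map i (c * x) = coeff_map i (\<Sum>\<mu>\<in>keys c. single \<mu> (lookup c \<mu>) * x)"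
      by (simp add: poly_mapping_sum_singles flip: sum_distrib_right)
    also have "\<dots> = (\<Sum>\<mu>\<in>keys c. coeff_map i (single \<mu> (lookup c \<mu>) * x))"
      by (rule additive_sum) (rule coeff_map_add)
    also have "\<dots> \<in> Q"
      unfolding coeff_map_single_mult using x
      by (intro idl.subspace_sum[OF Q] idl.subspace_scale[OF Q]) (simp add: extended_ideal_def)
    finally show ?thesis .
  qed
  then show "c * x \<in> extended_ideal Q" by (simp add: extended_ideal_def)
qed

text \<open>If a0 is the order of \<open>E\<close>, the coefficient of T^(i+a0) in E z is a unit
  times the i-th coefficient of z, plus multiples of earlier ones, which lie in \<open>Q\<close> by
  induction.\<close>

lemma extended_ideal_saturated:
  fixes Q :: "('v, 'k::field) mpoly set"
  assumes Q: "idl.subspace Q"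
  shows "saturated (extended_ideal Q)"
  unfolding saturated_def
proof (intro allI impI)
  fix E :: "'k poly" and z assume E: "E \<noteq> 0" and Ez: "mconst E * z \<in> extended_ideal Q"
  define a0 where "a0 = (LEAST a. coeff E a \<noteq> 0)"
  have a0: "coeff E a0 \<noteq> 0" unfolding a0_def by (rule LeastI_ex) (use E leading_coeff_neq_0 in blast)
  have less: "coeff E a = 0" if "a < a0" for a using not_less_Least that unfolding a0_def by blast
  have "coeff_map i z \<in> Q" for i
  proof (induction i rule: less_induct)
    case (less i)
    have "coeff_map (i + a0) (mconst E * z) = (\<Sum>a\<le>i + a0. single 0 (coeff E a) * coeff_map (i + a0 - a) z)"
      unfolding mconst_def by (rule coeff_map_single_mult)
    also have "\<dots> = single 0 (coeff E a0) * coeff_map i z +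
        (\<Sum>a\<in>{..i + a0} - {a0}. single 0 (coeff E a) * coeff_map (i + a0 - a) z)"
      by (subst sum.remove[of _ a0]) auto
    finally have eq: "single 0 (coeff E a0) * coeff_map i z = coeff_map (i + a0) (mconst E * z) -
        (\<Sum>a\<in>{..i + a0} - {a0}. single 0 (coeff E a) * coeff_map (i + a0 - a) z)" by simp
    have "single 0 (coeff E a) * coeff_map (i + a0 - a) z \<in> Q" if "a \<in> {..i + a0} - {a0}" for a
    proof (cases "a < a0")
      case True
      then show ?thesis using \<open>\<And>a. a < a0 \<Longrightarrow> coeff E a = 0\<close> idl.subspace_0[OF Q] by simp
    next
      case False
      then have "i + a0 - a < i" using that by auto
      then show ?thesis by (intro idl.subspace_scale[OF Q] less.IH)
    qed
    then have "(\<Sum>a\<in>{..i + a0} - {a0}. single 0 (coeff E a) * coeff_map (i + a0 - a) z) \<in> Q"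
      by (rule idl.subspace_sum[OF Q])
    then have "single 0 (coeff E a0) * coeff_map i z \<in> Q"
      unfolding eq using Ez by (intro idl.subspace_diff[OF Q]) (simp_all add: extended_ideal_def)
    then have "single 0 (inverse (coeff E a0)) * (single 0 (coeff E a0) * coeff_map i z) \<in> Q"
      by (rule idl.subspace_scale[OF Q])
    then show ?case using a0 by (simp add: mult_single flip: mult.assoc)
  qed
  then show "z \<in> extended_ideal Q" by (simp add: extended_ideal_def)
qed

text \<open>The field may be finite, so the generic reduction is taken after adjoining a variable to it.\<close>

lemma spreads_dimension:
  fixes f :: "'s::finite \<Rightarrow> ('v::{finite,linorder}, 'k::field) mpoly"
  assumes p: "prime p" "CHAR('k) = p" and j0: "f j0 \<noteq> 0"
  shows "spreads p CARD('v) f"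
proof -
  define g where "g j = const_map (f j)" for j
  obtain fs where fs: "set fs = range g" using finite_list[of "range g"] by auto
  have inf: "infinite (UNIV :: 'k poly set)"
  proof
    assume "finite (UNIV :: 'k poly set)"
    moreover have "inj (\<lambda>n. monom (1 :: 'k) n)" by (rule injI) (simp add: monom_eq_iff')
    ultimately have "finite (UNIV :: nat set)" by (metis finite_imageD finite_subset subset_UNIV)
    then show False by simp
  qed
  have "g j0 \<noteq> 0"
  proof
    assume "g j0 = 0"
    then have "coeff_map 0 (const_map (f j0)) = coeff_map 0 0" by (simp add: g_def)
    moreover have "coeff_map 0 0 = (0 :: ('v, 'k) mpoly)" by (rule poly_mapping_eqI) (simp add: lookup_coeff_map)
    ultimately show False using j0 by (simp add: coeff_map_const_map)
  qed
  from reduction_to_dimension[OF inf this, of fs] obtain hs m where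
    hs: "length hs \<le> CARD('v)" "set hs \<subseteq> idl.span (set fs)" and
    red: "\<And>Q J N. idl.subspace Q \<Longrightarrow> saturated Q \<Longrightarrow> g j0 ^ J \<in> Q \<Longrightarrow> mons (set hs) N \<subseteq> Q \<Longrightarrow>
      mons (set fs) (N + m) \<subseteq> Q"
    by blast
  have char: "CHAR(('v, 'k poly) mpoly) = p" using p(2) by (simp add: CHAR_poly_mapping)
  show ?thesis unfolding spreads_def
  proof (intro exI[of _ m] allI impI)
    fix e Q N
    assume Q: "idl.subspace Q" and f: "\<forall>j. f j ^ p ^ e \<in> Q" and notsub: "\<not> mons (range f) (N + m) \<subseteq> Q"
    let ?Q = "extended_ideal Q"
    note Q' = extended_ideal_subspace[OF Q] extended_ideal_saturated[OF Q]
    note mem = const_map_in_extended_ideal[OF idl.subspace_0[OF Q]]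
    have g: "g j ^ p ^ e \<in> ?Q" for j using f by (simp add: g_def mem flip: const_map_power)
    have mons_g: "const_map x \<in> mons (range g) M" if "x \<in> mons (range f) M" for x M
      using that
    proof (induction M arbitrary: x)
      case (Suc M)
      then obtain j b where x: "x = f j * b" "b \<in> mons (range f) M" unfolding mons.simps by blast
      then have "const_map x = g j * const_map b" by (simp add: const_map_mult g_def)
      then show ?case using Suc.IH[OF x(2)] unfolding mons.simps by blast
    qed (simp add: const_map_1)
    from notsub obtain x where "x \<in> mons (range f) (N + m)" "x \<notin> Q" by blast
    then have "\<not> mons (set fs) (N + m) \<subseteq> ?Q" using mons_g mem unfolding fs by blast
    \<comment> \<open>\<open>red\<close> is used with J = p ^ e: the nonzero element
      \<open>g j0\<close> is itself one of the generators whose p^e-th power lies in the extended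
      ideal.\<close>
    then have "\<not> mons (set hs) N \<subseteq> ?Q" using red[OF Q' g] by blast
    then obtain h where h: "h \<in> mons (set hs) N" "h \<notin> ?Q" by blast
    from mons_list[OF h(1)] obtain \<beta> where
      \<beta>: "h = (\<Prod>l<length hs. (hs ! l) ^ \<beta> l)" "(\<Sum>l<length hs. \<beta> l) = N" by blast
    have "digit_spread p (length hs) g e ?Q (\<Sum>l<length hs. \<beta> l)"
    proof (rule digit_spreadI[OF p(1) char Q'(1) _ g])
      show "hs ! l \<in> idl.span (range g)" if "l < length hs" for l
        using hs(2) nth_mem[OF that] unfolding fs by blast
      show "(\<Prod>l<length hs. (hs ! l) ^ \<beta> l) \<notin> ?Q" using h(2) \<beta>(1) by simp
    qed
    then obtain L :: "(nat \<times> nat \<times> nat) set" and j k where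
      L: "finite L" "\<forall>l\<in>L. k l < e" "\<forall>\<kappa>. card {l \<in> L. k l = \<kappa>} \<le> length hs * (p - 1)"
        "(\<Sum>l\<in>L. p ^ k l) = N" "(\<Prod>l\<in>L. g (j l) ^ p ^ k l) \<notin> ?Q"
      unfolding digit_spread_def \<beta>(2) by blast
    \<comment> \<open>The selected factors are among the original generators, so the product has
      constant coefficients in T and descends to k.\<close>
    have "(\<Prod>l\<in>L. g (j l) ^ p ^ k l) = const_map (\<Prod>l\<in>L. f (j l) ^ p ^ k l)"
      by (simp add: const_map_prod const_map_power g_def)
    with L(5) have "(\<Prod>l\<in>L. f (j l) ^ p ^ k l) \<notin> Q" by (simp add: mem)
    moreover have "\<forall>\<kappa>. card {l \<in> L. k l = \<kappa>} \<le> CARD('v) * (p - 1)"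
      using L(3) hs(1) by (meson le_trans mult_le_mono1)
    ultimately show "digit_spread p CARD('v) f e Q N"
      unfolding digit_spread_def using L(1,2,4) by blast
  qed
qed

section \<open>The F-pure threshold of the generic link\<close>

text \<open>Number the elements and cut the numbering into consecutive blocks of length
  \<open>d\<close>.\<close>

lemma partition_into_rows:
  assumes "finite A" "card A \<le> CARD('c::finite) * d"
  shows "\<exists>g :: 'a \<Rightarrow> 'c. \<forall>\<gamma>. card {a \<in> A. g a = \<gamma>} \<le> d"
proof (cases "d = 0")
  case True
  then have "A = {}" using assms by simp
  then show ?thesis by simp
next
  case False
  obtain h where h: "bij_betw h A {..<card A}"
    using ex_bij_betw_finite_nat[OF assms(1)] by (auto simp: atLeast0LessThan)
  obtain v :: "'c \<Rightarrow> nat" where v: "bij_betw v UNIV {..<CARD('c)}"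
    using ex_bij_betw_finite_nat[of "UNIV :: 'c set"] by (auto simp: atLeast0LessThan)
  have "\<exists>\<gamma> :: 'c. v \<gamma> = h a div d" if "a \<in> A" for a
  proof -
    have "h a < card A" using h that by (auto simp: bij_betw_def)
    then have "h a < CARD('c) * d" using assms(2) by linarith
    then have "h a div d < CARD('c)" by (rule less_mult_imp_div_less)
    then show ?thesis using v by (metis bij_betw_def imageE lessThan_iff)
  qed
  then obtain g where g: "\<And>a. a \<in> A \<Longrightarrow> v (g a :: 'c) = h a div d" by metis
  have "card {a \<in> A. g a = \<gamma>} \<le> d" for \<gamma>
  proof -
    have "h ` {a \<in> A. g a = \<gamma>} \<subseteq> {v \<gamma> * d..<v \<gamma> * d + d}"
    proof
      fix x assume "x \<in> h ` {a \<in> A. g a = \<gamma>}"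
      then have "x div d = v \<gamma>" using g by auto
      then show "x \<in> {v \<gamma> * d..<v \<gamma> * d + d}"
        using False dividend_less_div_times[of d x] div_times_less_eq_dividend[of x d] by auto
    qed
    from card_mono[OF finite_atLeastLessThan this]
    have "card (h ` {a \<in> A. g a = \<gamma>}) \<le> d" by simp
    moreover have "inj_on h {a \<in> A. g a = \<gamma>}" using h by (auto simp: bij_betw_def inj_on_def)
    ultimately show ?thesis by (simp add: card_image)
  qed
  then show ?thesis by blast
qed

text \<open>Levels are disjoint and treated independently: each keeps as many indices as the rows
  can hold.\<close>

lemma choose_rows:
  fixes k :: "'l \<Rightarrow> nat"
  assumes "finite L"
  shows "\<exists>L'\<subseteq>L. \<exists>i :: 'l \<Rightarrow> 'c::finite. (\<forall>\<gamma> \<kappa>. card {l \<in> L'. i l = \<gamma> \<and> k l = \<kappa>} \<le> d) \<and>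
    (\<forall>\<kappa>. card {l \<in> L'. k l = \<kappa>} = min (card {l \<in> L. k l = \<kappa>}) (CARD('c) * d))"
proof -
  have "\<forall>\<kappa>. \<exists>T. T \<subseteq> {l \<in> L. k l = \<kappa>} \<and> card T = min (card {l \<in> L. k l = \<kappa>}) (CARD('c) * d)"
  proof
    fix \<kappa>
    have "min (card {l \<in> L. k l = \<kappa>}) (CARD('c) * d) \<le> card {l \<in> L. k l = \<kappa>}" by simp
    then obtain T where "T \<subseteq> {l \<in> L. k l = \<kappa>}" "card T = min (card {l \<in> L. k l = \<kappa>}) (CARD('c) * d)"
      by (rule obtain_subset_with_card_n)
    then show "\<exists>T. T \<subseteq> {l \<in> L. k l = \<kappa>} \<and> card T = min (card {l \<in> L. k l = \<kappa>}) (CARD('c) * d)"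
      by blast
  qed
  from choice[OF this] obtain T where T': "\<forall>\<kappa>. T \<kappa> \<subseteq> {l \<in> L. k l = \<kappa>} \<and>
    card (T \<kappa>) = min (card {l \<in> L. k l = \<kappa>}) (CARD('c) * d)" ..
  then have T: "T \<kappa> \<subseteq> {l \<in> L. k l = \<kappa>}" "card (T \<kappa>) = min (card {l \<in> L. k l = \<kappa>}) (CARD('c) * d)" for \<kappa>
    by simp_all
  have "\<forall>\<kappa>. \<exists>g :: 'l \<Rightarrow> 'c. \<forall>\<gamma>. card {a \<in> T \<kappa>. g a = \<gamma>} \<le> d"
  proof
    fix \<kappa>
    have "finite (T \<kappa>)" using T(1)[of \<kappa>] assms by (auto intro: finite_subset)
    then show "\<exists>g :: 'l \<Rightarrow> 'c. \<forall>\<gamma>. card {a \<in> T \<kappa>. g a = \<gamma>} \<le> d"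
      by (rule partition_into_rows) (simp add: T(2))
  qed
  from choice[OF this] obtain g :: "nat \<Rightarrow> 'l \<Rightarrow> 'c" where g: "\<forall>\<kappa> \<gamma>. card {a \<in> T \<kappa>. g \<kappa> a = \<gamma>} \<le> d" ..
  define L' where "L' = {l \<in> L. l \<in> T (k l)}"
  define i where "i l = g (k l) l" for l
  have level: "{l \<in> L'. k l = \<kappa>} = T \<kappa>" for \<kappa> using T(1)[of \<kappa>] by (auto simp: L'_def)
  have "{l \<in> L'. i l = \<gamma> \<and> k l = \<kappa>} = {a \<in> T \<kappa>. g \<kappa> a = \<gamma>}" for \<gamma> \<kappa>
    using T(1)[of \<kappa>] by (auto simp: L'_def i_def)
  then have "\<forall>\<gamma> \<kappa>. card {l \<in> L'. i l = \<gamma> \<and> k l = \<kappa>} \<le> d" using g by simp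
  moreover have "L' \<subseteq> L" by (auto simp: L'_def)
  ultimately show ?thesis using T(2) level by (intro exI[of _ L'] conjI exI[of _ i]) auto
qed

section \<open>Frobenius splitting and what F-purity of the ideal yields\<close>

lemma power_eventually_ge:
  assumes "prime (p :: nat)"
  shows "\<forall>\<^sub>F e in sequentially. B \<le> real p ^ e"
proof -
  have p: "1 < real p" using prime_gt_1_nat[OF assms] by simp
  obtain n where n: "B < real p ^ n" using real_arch_pow[OF p] by blast
  have "B \<le> real p ^ e" if "n \<le> e" for e
    using power_increasing[OF that, of "real p"] n p by linarith
  then show ?thesis unfolding eventually_sequentially by blast
qed

lemma mons_ge_in_power:
  fixes J :: "'a::comm_ring_1 set"
  assumes "idl.subspace J" "x \<in> mons J M" "N \<le> M"
  shows "x \<in> ideal_power cring_class_ops J N"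
proof -
  have "x \<in> mons J (N + (M - N))" using assms(2,3) by simp
  from mons_split[OF this] obtain a b where "a \<in> mons J N" "x = a * b" by blast
  then show ?thesis unfolding ideal_power_class[OF assms(1)]
    by (simp add: subspace_mult_right[OF idl.subspace_span] idl.span_base)
qed

text \<open>The ring is Frobenius split: the Cartier-type operator at the exponent 0 sends 1 to
  1.\<close>

lemma frob_functional_unit:
  fixes M :: "('v, 'k::field) mpoly set"
  assumes p: "prime CHAR('k)" and perf: "perfect_field TYPE('k)"
  obtains \<phi> :: "('v, 'k) mpoly \<Rightarrow> ('v, 'k) mpoly" where "frob_lin (CHAR('k) ^ e) \<phi>" "\<phi> 1 = 1"
proof -
  let ?q = "CHAR('k) ^ e"
  have q: "?q > 0" using prime_gt_0_nat[OF p] by simp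
  obtain \<psi> :: "'k \<Rightarrow> 'k" where \<psi>: "frob_lin ?q \<psi>" and \<psi>1: "\<psi> 1 = 1"
    using perfect_root[OF p perf] by blast
  have z: "expo_scale ?q 0 = (0 :: 'v \<Rightarrow>\<^sub>0 nat)" by (rule poly_mapping_eqI) simp
  have "cart ?q \<psi> 0 (single (0 + expo_scale ?q 0) 1) = single (0 :: 'v \<Rightarrow>\<^sub>0 nat) (\<psi> 1)"
    by (rule cart_single[OF q]) (rule frob_lin_0[OF \<psi>])
  then have one: "cart ?q \<psi> 0 (1 :: ('v, 'k) mpoly) = 1" unfolding z \<psi>1 by simp
  have "frob_lin ?q (cart ?q \<psi> (0 :: 'v \<Rightarrow>\<^sub>0 nat))"
    by (rule frob_lin_cart[OF q \<psi> _ frobenius_add_mpoly[OF p]]) (use q in simp)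
  from that[OF this one] show ?thesis .
qed

lemma generators_of_frobenius:
  assumes p: "prime CHAR('k::field)" and perf: "perfect_field TYPE('k::field)"
  shows "\<exists>G. finite G \<and> (\<forall>z :: ('v::finite, 'k) mpoly. \<exists>c. z = (\<Sum>g\<in>G. c g ^ CHAR('k) ^ e * g))"
proof -
  let ?q = "CHAR('k) ^ e"
  have q: "?q > 0" using prime_gt_0_nat[OF p] by simp
  obtain \<psi> :: "'k \<Rightarrow> 'k" where \<psi>: "frob_lin ?q \<psi>" "\<And>c. \<psi> c ^ ?q = c"
    using perfect_root[OF p perf] by blast
  define s where "s \<mu> = single \<mu> (1 :: 'k)" for \<mu> :: "'v \<Rightarrow>\<^sub>0 nat"
  have inj: "inj_on s (expo_box ?q)"
    by (rule inj_onI) (metis s_def lookup_single_eq lookup_single_not_eq zero_neq_one)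
  have "\<exists>c. z = (\<Sum>g\<in>s ` expo_box ?q. c g ^ ?q * g)" for z :: "('v, 'k) mpoly"
  proof
    have "z = (\<Sum>\<mu>\<in>expo_box ?q. cart ?q \<psi> \<mu> z ^ ?q * s \<mu>)"
      unfolding s_def by (rule cart_expansion[OF q \<psi> frobenius_add_mpoly[OF p]])
    also have "\<dots> = (\<Sum>g\<in>s ` expo_box ?q. cart ?q \<psi> (the_inv_into (expo_box ?q) s g) z ^ ?q * g)"
      by (simp add: sum.reindex[OF inj] the_inv_into_f_f[OF inj])
    finally show "z = (\<Sum>g\<in>s ` expo_box ?q. cart ?q \<psi> (the_inv_into (expo_box ?q) s g) z ^ ?q * g)" .
  qed
  then show ?thesis by (intro exI[of _ "s ` expo_box ?q"]) simp
qed

text \<open>F-purity speaks of maximal ideals, but Frobenius ideals grow with the ideal, so any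
  proper \<open>M\<close> is covered; later \<open>M\<close> is \<open>I\<close> itself or a prime
  contracted from S.\<close>

lemma F_pure_imp_not_subset:
  fixes f :: "'s \<Rightarrow> ('v::{finite,linorder}, 'k::field) mpoly"
  assumes p: "prime CHAR('k)" and perf: "perfect_field TYPE('k)"
    and pure: "F_pure CHAR('k) (idl.span (range f)) s"
    and M: "idl.subspace M" "1 \<notin> M"
  shows "\<forall>\<^sub>F e in sequentially.
    \<not> mons (range f) (nat \<lfloor>s * (real CHAR('k) ^ e - 1)\<rfloor>) \<subseteq> frob_ideal (CHAR('k) ^ e) M"
proof -
  obtain M' where M': "maximalideal M' (cring_class_ops :: ('v, 'k) mpoly ring)" "M \<subseteq> M'"
    using prime_id_subset_maximal[OF M] by blast
  have "\<forall>\<^sub>F e in sequentially. \<not> idl.span (mons (idl.span (range f)) (nat \<lfloor>s * (real CHAR('k) ^ e - 1)\<rfloor>))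
      \<subseteq> frob_ideal (CHAR('k) ^ e) M'"
    by (rule F_pureD[OF pure M'(1) idl.subspace_span prime_gt_0_nat[OF p] frobenius_add_mpoly[OF p]
          generators_of_frobenius[OF p perf]])
  then show ?thesis
  proof (rule eventually_mono)
    fix e
    let ?N = "nat \<lfloor>s * (real CHAR('k) ^ e - 1)\<rfloor>"
    assume n: "\<not> idl.span (mons (idl.span (range f)) ?N) \<subseteq> frob_ideal (CHAR('k) ^ e) M'"
    show "\<not> mons (range f) ?N \<subseteq> frob_ideal (CHAR('k) ^ e) M"
    proof
      assume "mons (range f) ?N \<subseteq> frob_ideal (CHAR('k) ^ e) M"
      then have "idl.span (mons (range f) ?N) \<subseteq> frob_ideal (CHAR('k) ^ e) M"
        by (rule idl.span_minimal[OF _ frob_ideal_subspace[OF M(1)]])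
      also have "\<dots> \<subseteq> frob_ideal (CHAR('k) ^ e) M'" by (rule frob_ideal_antimono[OF M'(2)])
      finally show False using n unfolding span_mons_span by blast
    qed
  qed
qed

text \<open>The functional produces a constant polynomial, which lies outside \<open>M\<close>
  exactly when its coefficient lies outside the contraction of \<open>M\<close> to R.\<close>

lemma link_F_pure_step:
  fixes f :: "'s::{finite,linorder} \<Rightarrow> ('v::{finite,linorder}, 'k::field) mpoly"
    and J :: "('c::{finite,linorder} \<times> 's, ('v, 'k) mpoly) mpoly set"
    and L :: "'l set" and i :: "'l \<Rightarrow> 'c"
  assumes p: "prime CHAR('k)"
    and J: "idl.subspace J" "range (generic_combination f) \<subseteq> J" and M: "prime_id M"
    and L: "finite L" "\<And>l. l \<in> L \<Longrightarrow> k l < e"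
    and small: "\<And>\<gamma> \<kappa>. card {l \<in> L. i l = \<gamma> \<and> k l = \<kappa>} \<le> CHAR('k) - 1"
    and notin: "(\<Prod>l\<in>L. f (j l) ^ CHAR('k) ^ k l) \<notin> frob_ideal (CHAR('k) ^ e) {a. mconst a \<in> M}"
    and N: "N \<le> (\<Sum>l\<in>L. CHAR('k) ^ k l)"
  shows "\<exists>\<phi>. frob_lin (CHAR('k) ^ e) \<phi> \<and>
    (\<exists>d\<in>ideal_power (cring_class_ops :: ('c \<times> 's, ('v, 'k) mpoly) mpoly ring) J N. \<phi> d \<notin> M)"
proof -
  have sM: "idl.subspace {a. mconst a \<in> M}"
    using M unfolding prime_id_def idl.subspace_def by auto
  have small': "card {l \<in> L. i l = \<gamma> \<and> k l = \<kappa>} < CHAR('k)" for \<gamma> \<kappa>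
    using small[of \<gamma> \<kappa>] prime_gt_0_nat[OF p] by linarith
  let ?G = "\<Prod>l\<in>L. generic_combination f (i l) ^ CHAR('k) ^ k l"
  obtain \<Phi> a where \<Phi>: "frob_lin (CHAR('k) ^ e) \<Phi>" "\<Phi> ?G = mconst a" "a \<notin> {a. mconst a \<in> M}"
    by (rule product_functional[OF p L small' sM notin])
  have "?G \<in> mons J (\<Sum>l\<in>L. CHAR('k) ^ k l)"
    using J(2) by (intro mons_prod[OF L(1)] mons_power) blast
  then have "?G \<in> ideal_power cring_class_ops J N" by (rule mons_ge_in_power[OF J(1) _ N])
  moreover have "\<Phi> ?G \<notin> M" using \<Phi>(2,3) by simp
  ultimately show ?thesis using \<Phi>(1) by blast
qed

lemma spreads_bound:
  fixes f :: "'s \<Rightarrow> ('v::{finite,linorder}, 'k::field) mpoly"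
  assumes p: "prime CHAR('k)" and perf: "perfect_field TYPE('k)"
    and sp: "spreads CHAR('k) \<rho> f" and pure: "F_pure CHAR('k) (idl.span (range f)) s"
    and M: "idl.subspace M" "1 \<notin> M" "range f \<subseteq> M"
  shows "\<exists>m. \<forall>\<^sub>F e in sequentially. nat \<lfloor>s * (real CHAR('k) ^ e - 1)\<rfloor> \<ge> m \<longrightarrow>
    digit_spread CHAR('k) \<rho> f e (frob_ideal (CHAR('k) ^ e) M) (nat \<lfloor>s * (real CHAR('k) ^ e - 1)\<rfloor> - m)"
proof -
  from sp obtain m where m: "\<And>e Q N. idl.subspace Q \<Longrightarrow> \<forall>j. f j ^ CHAR('k) ^ e \<in> Q \<Longrightarrow>
    \<not> mons (range f) (N + m) \<subseteq> Q \<Longrightarrow> digit_spread CHAR('k) \<rho> f e Q N"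
    unfolding spreads_def by blast
  show ?thesis
  proof (rule exI[of _ m], rule eventually_mono[OF F_pure_imp_not_subset[OF p perf pure M(1,2)]], rule impI)
    fix e
    let ?N = "nat \<lfloor>s * (real CHAR('k) ^ e - 1)\<rfloor>"
    let ?Q = "frob_ideal (CHAR('k) ^ e) M"
    assume n: "\<not> mons (range f) ?N \<subseteq> ?Q" and ge: "m \<le> ?N"
    have "\<forall>j. f j ^ CHAR('k) ^ e \<in> ?Q" using M(3) power_in_frob_ideal[OF M(1)] by blast
    moreover have "\<not> mons (range f) (?N - m + m) \<subseteq> ?Q" using n ge by simp
    ultimately show "digit_spread CHAR('k) \<rho> f e ?Q (?N - m)"
      by (rule m[OF frob_ideal_subspace[OF M(1)]])
  qed
qed

text \<open>At most \<rho> (p - 1) factors per level give total degree at most \<rho> (q - 1),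
  whereas F-purity yields s (q - 1) up to a bounded error.\<close>

lemma F_pure_exponent_le:
  fixes f :: "'s \<Rightarrow> ('v::{finite,linorder}, 'k::field) mpoly"
  assumes p: "prime CHAR('k)" and perf: "perfect_field TYPE('k)"
    and sp: "spreads CHAR('k) \<rho> f" and pure: "F_pure CHAR('k) (idl.span (range f)) s"
    and M: "idl.subspace M" "1 \<notin> M" "range f \<subseteq> M"
  shows "s \<le> real \<rho>"
proof (rule ccontr)
  assume "\<not> s \<le> real \<rho>"
  then have s: "s - real \<rho> > 0" by simp
  let ?p = "CHAR('k)"
  have p0: "?p > 0" using prime_gt_0_nat[OF p] .
  from spreads_bound[OF assms] obtain m where m: "\<forall>\<^sub>F e in sequentially.
    nat \<lfloor>s * (real ?p ^ e - 1)\<rfloor> \<ge> m \<longrightarrow>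
      digit_spread ?p \<rho> f e (frob_ideal (?p ^ e) M) (nat \<lfloor>s * (real ?p ^ e - 1)\<rfloor> - m)" ..
  \<comment> \<open>q is taken so large that the surplus (s - \<rho>) (q - 1) exceeds the loss m and
    the rounding.\<close>
  have big: "\<forall>\<^sub>F e in sequentially. (real m + 2) / (s - real \<rho>) + 1 \<le> real ?p ^ e"
    by (rule power_eventually_ge[OF p])
  obtain e where e: "nat \<lfloor>s * (real ?p ^ e - 1)\<rfloor> \<ge> m \<longrightarrow>
      digit_spread ?p \<rho> f e (frob_ideal (?p ^ e) M) (nat \<lfloor>s * (real ?p ^ e - 1)\<rfloor> - m)"
    "(real m + 2) / (s - real \<rho>) + 1 \<le> real ?p ^ e"
    using eventually_happens[OF eventually_conj[OF m big]] by auto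
  let ?N = "nat \<lfloor>s * (real ?p ^ e - 1)\<rfloor>"
  have "real m + 2 \<le> (s - real \<rho>) * (real ?p ^ e - 1)"
    using e(2) s by (simp add: field_simps)
  then have lower: "real \<rho> * (real ?p ^ e - 1) + real m + 2 \<le> s * (real ?p ^ e - 1)"
    by (simp add: algebra_simps)
  have "0 \<le> real \<rho> * (real ?p ^ e - 1)" using p0 by simp
  then have "s * (real ?p ^ e - 1) \<ge> real m + 2" using lower by linarith
  then have N: "real ?N > s * (real ?p ^ e - 1) - 1" by linarith
  then have "real ?N \<ge> real m" using lower \<open>0 \<le> real \<rho> * (real ?p ^ e - 1)\<close> by linarith
  then have ge: "?N \<ge> m" by simp
  with e(1) have "digit_spread ?p \<rho> f e (frob_ideal (?p ^ e) M) (?N - m)" by blast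
  then obtain L :: "(nat \<times> nat \<times> nat) set" and k where
    L: "finite L" "\<forall>l\<in>L. k l < e" "\<forall>\<kappa>. card {l \<in> L. k l = \<kappa>} \<le> \<rho> * (?p - 1)" "(\<Sum>l\<in>L. ?p ^ k l) = ?N - m"
    unfolding digit_spread_def by blast
  have "?N - m = (\<Sum>\<kappa><e. card {l \<in> L. k l = \<kappa>} * ?p ^ \<kappa>)"
    using sum_level_sets[OF L(1), of k e ?p] L(2,4) by simp
  also have "\<dots> \<le> (\<Sum>\<kappa><e. \<rho> * (?p - 1) * ?p ^ \<kappa>)"
    using L(3) by (intro sum_mono mult_right_mono) auto
  also have "\<dots> = \<rho> * (?p ^ e - 1)"
    using geometric_digits[OF p0, of e] by (simp add: mult.assoc flip: sum_distrib_left)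
  finally have "real (?N - m) \<le> real (\<rho> * (?p ^ e - 1))" by (simp only: of_nat_le_iff)
  then have "real ?N - real m \<le> real \<rho> * (real ?p ^ e - 1)"
    using ge p0 by (simp add: of_nat_diff)
  with N lower show False by linarith
qed

text \<open>If the contraction \<open>M0\<close> contains all \<open>f j\<close>, a digit spread is
  truncated to the capacity of the rows. Otherwise some \<open>f j\<close> lies outside
  \<open>M0\<close>, and its powers alone fill all rows at all levels.\<close>

lemma link_F_pure:
  fixes f :: "'s::{finite,linorder} \<Rightarrow> ('v::{finite,linorder}, 'k::field) mpoly"
    and J :: "('c::{finite,linorder} \<times> 's, ('v, 'k) mpoly) mpoly set"
  assumes p: "prime CHAR('k)" and perf: "perfect_field TYPE('k)"
    and J: "idl.subspace J" "range (generic_combination f) \<subseteq> J"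
    and proper: "1 \<notin> idl.span (range f)"
    and sp: "spreads CHAR('k) \<rho> f" and c\<rho>: "CARD('c) \<le> \<rho>"
    and pure: "F_pure CHAR('k) (idl.span (range f)) s"
    and t: "0 \<le> t" "t < real CARD('c) / real \<rho> * s"
  shows "F_pure CHAR('k) J t"
proof (rule F_pureI)
  let ?p = "CHAR('k)" and ?c = "CARD('c)"
  show p0: "?p > 0" using prime_gt_0_nat[OF p] .
  fix M :: "('c \<times> 's, ('v, 'k) mpoly) mpoly set" assume M: "prime_id M"
  define M0 where "M0 = {a :: ('v, 'k) mpoly. mconst a \<in> M}"
  have M0: "prime_id M0" using M unfolding prime_id_def idl.subspace_def M0_def by auto
  have sM0: "idl.subspace M0" using M0 by (simp add: prime_id_def)
  have c0: "?c > 0" by simp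
  have \<rho>0: "\<rho> > 0" using c\<rho> c0 by linarith
  have goalI: "\<exists>\<phi>. frob_lin (?p ^ e) \<phi> \<and> (\<exists>d\<in>ideal_power (cring_class_ops :: ('c \<times> 's, ('v, 'k) mpoly) mpoly ring) J
        (nat \<lfloor>t * (real ?p ^ e - 1)\<rfloor>). \<phi> d \<notin> M)"
    if "finite L" "\<And>l. l \<in> L \<Longrightarrow> k l < e" "\<And>\<gamma> \<kappa>. card {l \<in> L. i l = \<gamma> \<and> k l = \<kappa>} \<le> ?p - 1"
      "(\<Prod>l\<in>L. f (j l) ^ ?p ^ k l) \<notin> frob_ideal (?p ^ e) M0" "t * (real ?p ^ e - 1) \<le> real (\<Sum>l\<in>L. ?p ^ k l)"
    for L :: "(nat \<times> nat \<times> nat) set" and k and i :: "nat \<times> nat \<times> nat \<Rightarrow> 'c" and j e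
  proof -
    have "nat \<lfloor>t * (real ?p ^ e - 1)\<rfloor> \<le> (\<Sum>l\<in>L. ?p ^ k l)"
      using that(5) by (metis floor_mono floor_of_nat nat_int nat_mono)
    from link_F_pure_step[OF p J M that(1-3) that(4)[unfolded M0_def] this] show ?thesis .
  qed
  show "\<forall>\<^sub>F e in sequentially. \<exists>\<phi>. frob_lin (?p ^ e) \<phi> \<and>
      (\<exists>d\<in>ideal_power (cring_class_ops :: ('c \<times> 's, ('v, 'k) mpoly) mpoly ring) J
        (nat \<lfloor>t * (real ?p ^ e - 1)\<rfloor>). \<phi> d \<notin> M)"
  proof (cases "range f \<subseteq> M0")
    case False
    then obtain j0 where j0: "f j0 \<notin> M0" by blast
    \<comment> \<open>Obtained by testing against \<open>I\<close> itself. It gives t < c s / \<rho>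
      \<le> c, so total degree c (q - 1) is enough in this case.\<close>
    have "s \<le> real \<rho>"
      by (rule F_pure_exponent_le[OF p perf sp pure idl.subspace_span proper idl.span_superset])
    then have "real ?c * s \<le> real ?c * real \<rho>" by (intro mult_left_mono) auto
    then have "real ?c / real \<rho> * s \<le> real ?c" using \<rho>0 by (simp add: field_simps)
    then have tc: "t \<le> real ?c" using t(2) by linarith
    show ?thesis
    proof (rule always_eventually, rule allI)
      fix e :: nat
      obtain v :: "'c \<Rightarrow> nat" where v: "bij_betw v UNIV {..<?c}"
        using ex_bij_betw_finite_nat[of "UNIV :: 'c set"] by (auto simp: atLeast0LessThan)
      define L where "L = {..<?c} \<times> {..<e} \<times> {..<?p - 1}"
      define i where "i l = inv_into UNIV v (fst l)" for l :: "nat \<times> nat \<times> nat"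
      define k where "k l = fst (snd l)" for l :: "nat \<times> nat \<times> nat"
      have fin: "finite L" by (simp add: L_def)
      have inv: "v (inv_into UNIV v x) = x" if "x < ?c" for x
        using v that by (metis bij_betw_def f_inv_into_f lessThan_iff)
      have rows: "card {l \<in> L. i l = \<gamma> \<and> k l = \<kappa>} \<le> ?p - 1" for \<gamma> \<kappa>
      proof -
        have "{l \<in> L. i l = \<gamma> \<and> k l = \<kappa>} \<subseteq> {v \<gamma>} \<times> {\<kappa>} \<times> {..<?p - 1}"
          using inv by (auto simp: L_def i_def k_def)
        from card_mono[OF _ this] show ?thesis by simp
      qed
      have sum: "(\<Sum>l\<in>L. ?p ^ k l) = ?c * (?p ^ e - 1)"
      proof -
        have "(\<Sum>l\<in>L. ?p ^ k l) = (\<Sum>x<?c. \<Sum>y\<in>{..<e} \<times> {..<?p - 1}. ?p ^ fst y)"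
          unfolding L_def k_def by (subst sum.cartesian_product) (simp only: case_prod_unfold)
        also have "\<dots> = (\<Sum>x<?c. \<Sum>\<kappa><e. \<Sum>r<?p - 1. ?p ^ \<kappa>)"
          by (intro sum.cong refl, subst sum.cartesian_product) (simp_all add: case_prod_unfold)
        also have "\<dots> = ?c * (?p ^ e - 1)" using geometric_digits[OF p0, of e] by simp
        finally show ?thesis .
      qed
      have "(\<Prod>l\<in>L. f j0 ^ ?p ^ k l) \<notin> frob_ideal (?p ^ e) M0"
      proof
        \<comment> \<open>Multiplication by f j0 ^ c completes the exponent to c q, a q-th power;
          the splitting functional would then put f j0 ^ c into the prime \<open>M0\<close>.\<close>
        have "(\<Prod>l\<in>L. f j0 ^ ?p ^ k l) = f j0 ^ (?c * (?p ^ e - 1))"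
          unfolding sum[symmetric] by (rule power_sum[symmetric])
        moreover assume "(\<Prod>l\<in>L. f j0 ^ ?p ^ k l) \<in> frob_ideal (?p ^ e) M0"
        ultimately have "f j0 ^ ?c * f j0 ^ (?c * (?p ^ e - 1)) \<in> frob_ideal (?p ^ e) M0"
          using idl.subspace_scale[OF frob_ideal_subspace[OF sM0]] by metis
        moreover have "?c + ?c * (?p ^ e - 1) = ?c * ?p ^ e"
          using p0 by (simp add: diff_mult_distrib2)
        then have "f j0 ^ ?c * f j0 ^ (?c * (?p ^ e - 1)) = (f j0 ^ ?c) ^ ?p ^ e * 1"
          by (simp flip: power_add power_mult)
        ultimately have mem: "(f j0 ^ ?c) ^ ?p ^ e * 1 \<in> frob_ideal (?p ^ e) M0" by simp
        obtain \<phi> :: "('v, 'k) mpoly \<Rightarrow> ('v, 'k) mpoly" where \<phi>: "frob_lin (?p ^ e) \<phi>" "\<phi> 1 = 1"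
          by (rule frob_functional_unit[OF p perf])
        have "\<phi> ((f j0 ^ ?c) ^ ?p ^ e * 1) \<in> M0" using mem \<phi>(1) unfolding frob_ideal_def by blast
        then have "f j0 ^ ?c \<in> M0" unfolding frob_lin_scale[OF \<phi>(1)] \<phi>(2) by simp
        then show False using prime_id_power[OF M0 j0] by blast
      qed
      moreover have "t * (real ?p ^ e - 1) \<le> real (\<Sum>l\<in>L. ?p ^ k l)"
      proof -
        have "t * (real ?p ^ e - 1) \<le> real ?c * (real ?p ^ e - 1)"
          using tc p0 by (intro mult_right_mono) auto
        also have "\<dots> = real (\<Sum>l\<in>L. ?p ^ k l)" unfolding sum using p0 by (simp add: of_nat_diff)
        finally show ?thesis .
      qed
      ultimately show "\<exists>\<phi>. frob_lin (?p ^ e) \<phi> \<and>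
          (\<exists>d\<in>ideal_power (cring_class_ops :: ('c \<times> 's, ('v, 'k) mpoly) mpoly ring) J
            (nat \<lfloor>t * (real ?p ^ e - 1)\<rfloor>). \<phi> d \<notin> M)"
        by (intro goalI[where i = i and j = "\<lambda>_. j0", OF fin _ rows]) (auto simp: L_def k_def)
    qed
  next
    case True
    from spreads_bound[OF p perf sp pure sM0 prime_id_one[OF M0] True] obtain m where
      m: "\<forall>\<^sub>F e in sequentially. nat \<lfloor>s * (real ?p ^ e - 1)\<rfloor> \<ge> m \<longrightarrow>
        digit_spread ?p \<rho> f e (frob_ideal (?p ^ e) M0) (nat \<lfloor>s * (real ?p ^ e - 1)\<rfloor> - m)" ..
    have \<theta>: "real ?c * s - real \<rho> * t > 0" using t(2) \<rho>0 by (simp add: field_simps)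
    have s0: "s > 0"
    proof (rule ccontr)
      assume "\<not> s > 0"
      then have "real ?c * s \<le> 0" by (simp add: mult_nonneg_nonpos)
      moreover have "0 \<le> real \<rho> * t" using t(1) by simp
      ultimately show False using \<theta> by linarith
    qed
    \<comment> \<open>The first bound lets the gap c s - \<rho> t pay for the loss m and one unit of
      rounding, both scaled by c; the second makes the exponent of \<open>I\<close> at least
      m.\<close>
    define B where "B = max (real ?c * (real m + 1) / (real ?c * s - real \<rho> * t) + 1) ((real m + 1) / s + 1)"
    have big: "\<forall>\<^sub>F e in sequentially. B \<le> real ?p ^ e" by (rule power_eventually_ge[OF p])
    from eventually_conj[OF m big] show ?thesis
    proof (rule eventually_mono)
      fix e
      let ?N = "nat \<lfloor>s * (real ?p ^ e - 1)\<rfloor>"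
      assume "(?N \<ge> m \<longrightarrow> digit_spread ?p \<rho> f e (frob_ideal (?p ^ e) M0) (?N - m)) \<and> B \<le> real ?p ^ e"
      then have e: "?N \<ge> m \<Longrightarrow> digit_spread ?p \<rho> f e (frob_ideal (?p ^ e) M0) (?N - m)"
        "real ?c * (real m + 1) / (real ?c * s - real \<rho> * t) \<le> real ?p ^ e - 1"
        "(real m + 1) / s \<le> real ?p ^ e - 1"
        by (auto simp: B_def)
      have e2: "real ?c * (real m + 1) \<le> (real ?c * s - real \<rho> * t) * (real ?p ^ e - 1)"
        using e(2) \<theta> by (simp add: pos_divide_le_eq mult.commute)
      have e3: "real m + 1 \<le> s * (real ?p ^ e - 1)"
        using e(3) s0 by (simp add: pos_divide_le_eq mult.commute)
      then have N: "real ?N > s * (real ?p ^ e - 1) - 1" by linarith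
      then have ge: "?N \<ge> m" using e3 by linarith
      from e(1)[OF ge] obtain L :: "(nat \<times> nat \<times> nat) set" and j k where
        L: "finite L" "\<forall>l\<in>L. k l < e" "\<forall>\<kappa>. card {l \<in> L. k l = \<kappa>} \<le> \<rho> * (?p - 1)"
          "(\<Sum>l\<in>L. ?p ^ k l) = ?N - m" "(\<Prod>l\<in>L. f (j l) ^ ?p ^ k l) \<notin> frob_ideal (?p ^ e) M0"
        unfolding digit_spread_def by blast
      from choose_rows[OF L(1), of k "?p - 1"] obtain L' and i :: "nat \<times> nat \<times> nat \<Rightarrow> 'c" where
        L': "L' \<subseteq> L" "\<forall>\<gamma> \<kappa>. card {l \<in> L'. i l = \<gamma> \<and> k l = \<kappa>} \<le> ?p - 1"
          "\<forall>\<kappa>. card {l \<in> L'. k l = \<kappa>} = min (card {l \<in> L. k l = \<kappa>}) (?c * (?p - 1))"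
        by blast
      have fin': "finite L'" using L(1) L'(1) by (rule rev_finite_subset)
      have eq: "(\<Prod>l\<in>L. f (j l) ^ ?p ^ k l) = (\<Prod>l\<in>L'. f (j l) ^ ?p ^ k l) * (\<Prod>l\<in>L - L'. f (j l) ^ ?p ^ k l)"
        by (subst mult.commute, rule prod.subset_diff[OF L'(1) L(1)])
      have notin: "(\<Prod>l\<in>L'. f (j l) ^ ?p ^ k l) \<notin> frob_ideal (?p ^ e) M0"
      proof
        assume "(\<Prod>l\<in>L'. f (j l) ^ ?p ^ k l) \<in> frob_ideal (?p ^ e) M0"
        then have "(\<Prod>l\<in>L. f (j l) ^ ?p ^ k l) \<in> frob_ideal (?p ^ e) M0"
          unfolding eq by (rule subspace_mult_right[OF frob_ideal_subspace[OF sM0]])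
        with L(5) show False ..
      qed
      \<comment> \<open>A level within capacity is kept whole and c \<le> \<rho> suffices; a larger
        one is cut to c (p - 1), while its size was at most \<rho> (p - 1).\<close>
      have level: "?c * card {l \<in> L. k l = \<kappa>} \<le> \<rho> * card {l \<in> L'. k l = \<kappa>}" for \<kappa>
      proof (cases "card {l \<in> L. k l = \<kappa>} \<le> ?c * (?p - 1)")
        case True
        then show ?thesis using L'(3) c\<rho> by (simp add: mult_le_mono1)
      next
        case False
        then have "card {l \<in> L'. k l = \<kappa>} = ?c * (?p - 1)" using L'(3) by simp
        moreover have "?c * card {l \<in> L. k l = \<kappa>} \<le> ?c * (\<rho> * (?p - 1))" using L(3) by simp
        ultimately show ?thesis by (simp add: mult.left_commute)
      qed
      have "?c * (?N - m) = (\<Sum>\<kappa><e. ?c * card {l \<in> L. k l = \<kappa>} * ?p ^ \<kappa>)"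
        using sum_level_sets[OF L(1), of k e ?p] L(2,4) by (simp add: sum_distrib_left mult.assoc)
      also have "\<dots> \<le> (\<Sum>\<kappa><e. \<rho> * card {l \<in> L'. k l = \<kappa>} * ?p ^ \<kappa>)"
        by (intro sum_mono mult_right_mono level) simp
      also have "\<dots> = \<rho> * (\<Sum>l\<in>L'. ?p ^ k l)"
      proof -
        have "k l < e" if "l \<in> L'" for l using L(2) L'(1) that by blast
        from sum_level_sets[OF fin' this, where p = ?p] show ?thesis
          by (simp only: sum_distrib_left mult.assoc)
      qed
      finally have "real (?c * (?N - m)) \<le> real (\<rho> * (\<Sum>l\<in>L'. ?p ^ k l))" by (simp only: of_nat_le_iff)
      then have upper: "real ?c * (real ?N - real m) \<le> real \<rho> * real (\<Sum>l\<in>L'. ?p ^ k l)"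
        using ge by (simp add: of_nat_diff)
      have "real ?c * (s * (real ?p ^ e - 1) - 1 - real m) \<le> real ?c * (real ?N - real m)"
        using N by (intro mult_left_mono) auto
      then have "real \<rho> * (t * (real ?p ^ e - 1)) \<le> real \<rho> * real (\<Sum>l\<in>L'. ?p ^ k l)"
        using upper e2 by (simp only: right_diff_distrib left_diff_distrib distrib_left mult_1_right mult.assoc)
      then have "t * (real ?p ^ e - 1) \<le> real (\<Sum>l\<in>L'. ?p ^ k l)" using \<rho>0 by (simp only: mult_le_cancel_left_pos of_nat_0_less_iff)
      then show "\<exists>\<phi>. frob_lin (?p ^ e) \<phi> \<and>
          (\<exists>d\<in>ideal_power (cring_class_ops :: ('c \<times> 's, ('v, 'k) mpoly) mpoly ring) J
            (nat \<lfloor>t * (real ?p ^ e - 1)\<rfloor>). \<phi> d \<notin> M)"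
        using L(2) L'(1,2) by (intro goalI[OF fin' _ _ notin]) auto
    qed
  qed
qed

text \<open>Makes the supremum defining the threshold of \<open>J\<close> nonnegative instead of
  minus infinity.\<close>

lemma link_F_pure_0:
  fixes f :: "'s::{finite,linorder} \<Rightarrow> ('v::{finite,linorder}, 'k::field) mpoly"
    and J :: "('c::{finite,linorder} \<times> 's, ('v, 'k) mpoly) mpoly set"
  assumes p: "prime CHAR('k)" and perf: "perfect_field TYPE('k)"
    and J: "idl.subspace J" "range (generic_combination f) \<subseteq> J"
  shows "F_pure CHAR('k) J 0"
proof (rule F_pureI)
  let ?p = "CHAR('k)"
  show "?p > 0" using prime_gt_0_nat[OF p] .
  fix M :: "('c \<times> 's, ('v, 'k) mpoly) mpoly set" assume M: "prime_id M"
  show "\<forall>\<^sub>F e in sequentially. \<exists>\<phi>. frob_lin (?p ^ e) \<phi> \<and>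
      (\<exists>d\<in>ideal_power (cring_class_ops :: ('c \<times> 's, ('v, 'k) mpoly) mpoly ring) J
        (nat \<lfloor>0 * (real ?p ^ e - 1)\<rfloor>). \<phi> d \<notin> M)"
  proof (rule always_eventually, rule allI)
    fix e
    obtain \<phi> :: "('v, 'k) mpoly \<Rightarrow> ('v, 'k) mpoly" where \<phi>: "frob_lin (?p ^ e) \<phi>" "\<phi> 1 = 1"
      by (rule frob_functional_unit[OF p perf])
    have "1 \<notin> frob_ideal (?p ^ e) {a. mconst a \<in> M}"
      using \<phi> prime_id_one[OF M] unfolding frob_ideal_def by force
    then show "\<exists>\<phi>. frob_lin (?p ^ e) \<phi> \<and>
      (\<exists>d\<in>ideal_power (cring_class_ops :: ('c \<times> 's, ('v, 'k) mpoly) mpoly ring) J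
        (nat \<lfloor>0 * (real ?p ^ e - 1)\<rfloor>). \<phi> d \<notin> M)"
      by (intro link_F_pure_step[OF p J M, where L = "{} :: nat set" and k = "\<lambda>_. 0"]) auto
  qed
qed

text \<open>F-purity of \<open>J\<close> is available only strictly below (c / \<rho>) s; density of
  the reals closes the gap in the supremum.\<close>

lemma link_fpt_ge:
  fixes f :: "'s::{finite,linorder} \<Rightarrow> ('v::{finite,linorder}, 'k::field) mpoly"
    and J :: "('c::{finite,linorder} \<times> 's, ('v, 'k) mpoly) mpoly set"
  assumes p: "prime CHAR('k)" and perf: "perfect_field TYPE('k)"
    and J: "idl.subspace J" "range (generic_combination f) \<subseteq> J"
    and proper: "1 \<notin> idl.span (range f)"
    and sp: "spreads CHAR('k) \<rho> f" and c\<rho>: "CARD('c) \<le> \<rho>"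
  shows "fpt CHAR('k) J \<ge> ereal (real CARD('c) / real \<rho>) * fpt CHAR('k) (idl.span (range f))"
proof -
  let ?p = "CHAR('k)" and ?K = "real CARD('c) / real \<rho>" and ?I = "idl.span (range f)"
  have ge: "ereal t \<le> fpt ?p J" if "0 \<le> t" "F_pure ?p J t" for t
    unfolding fpt_def using that by (intro Sup_upper) auto
  have "0 < CARD('c)" by simp
  with c\<rho> have "\<rho> > 0" by linarith
  then have K: "?K > 0" by simp
  have "ereal ?K * ereal s \<le> fpt ?p J" if s: "0 \<le> s" "F_pure ?p ?I s" for s
  proof (rule ccontr)
    assume "\<not> ?thesis"
    then have less: "fpt ?p J < ereal (?K * s)" by simp
    have nonneg: "ereal 0 \<le> fpt ?p J" by (rule ge[OF _ link_F_pure_0[OF p perf J]]) simp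
    obtain r where r: "fpt ?p J = ereal r" using less nonneg by (cases "fpt ?p J") auto
    have rs: "0 \<le> r" "r < ?K * s" using r less nonneg by auto
    obtain t where t: "r < t" "t < ?K * s" using dense[OF rs(2)] by blast
    with rs(1) have t0: "0 \<le> t" by linarith
    have "F_pure ?p J t" by (rule link_F_pure[OF p perf J proper sp c\<rho> s(2) t0 t(2)])
    from ge[OF t0 this] t(1) show False by (simp add: r)
  qed
  then have "x \<le> fpt ?p J / ereal ?K" if "x \<in> {ereal s | s. 0 \<le> s \<and> F_pure ?p ?I s}" for x
    using that K by (auto simp: ereal_le_divide_pos)
  then have "fpt ?p ?I \<le> fpt ?p J / ereal ?K" unfolding fpt_def[of ?p ?I] by (rule Sup_least)
  then show ?thesis using K by (simp add: ereal_le_divide_pos)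
qed

section \<open>The link, heights and the three bounds\<close>

lemma generic_link_ideal:
  fixes f :: "'s::finite \<Rightarrow> 'a::comm_ring_1"
  shows "idl.subspace (generic_link f :: ('c \<times> 's, 'a) mpoly set)"
    and "range (generic_combination f) \<subseteq> (generic_link f :: ('c \<times> 's, 'a) mpoly set)"
proof -
  let ?A = "idl.span (range (generic_combination f)) :: ('c \<times> 's, 'a) mpoly set"
  have link: "(generic_link f :: ('c \<times> 's, 'a) mpoly set) =
      {a. \<forall>x\<in>idl.span (mconst ` idl.span (range f)). a * x \<in> ?A}"
    by (simp add: generic_link_def colon_ideal_def genideal_class carrier_class times_class Let_def)
  show "idl.subspace (generic_link f :: ('c \<times> 's, 'a) mpoly set)"
    unfolding link idl.subspace_def
    by (auto simp: distrib_right mult.assoc idl.span_zero intro: idl.span_add idl.span_scale)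
  show "range (generic_combination f) \<subseteq> (generic_link f :: ('c \<times> 's, 'a) mpoly set)"
    unfolding link using subspace_mult_right[OF idl.subspace_span idl.span_base] by blast
qed

text \<open>The height of an ideal bounds the height of each prime over it from below, and a
  supremum of at least c in \<open>enat\<close> is realized by an actual chain of length at least
  c.\<close>

lemma height_chain:
  assumes ht: "height (cring_class_ops :: 'a::comm_ring_1 ring) I = enat c" and P: "prime_id P" "I \<subseteq> P"
  shows "\<exists>C. (\<forall>i\<le>c. prime_id (C i)) \<and> (\<forall>i<c. C i \<subset> C (Suc i)) \<and> C c = P"
proof -
  let ?R = "cring_class_ops :: 'a ring"
  define S where "S = {enat n | n. \<exists>C. (\<forall>i\<le>n. primeideal (C i) ?R) \<and> (\<forall>i<n. C i \<subset> C (Suc i)) \<and> C n = P}"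
  have "height ?R I \<le> prime_height ?R P"
    unfolding height_def using P by (intro Inf_lower) (auto simp: primeideal_class_iff)
  then have le: "enat c \<le> Sup S" unfolding ht prime_height_def S_def .
  have "\<exists>n\<ge>c. enat n \<in> S"
  proof (rule ccontr)
    assume n: "\<not> ?thesis"
    show False
    proof (cases c)
      case 0
      have "enat 0 \<in> S" unfolding S_def using P(1) by (auto simp: primeideal_class_iff intro!: exI[of _ "\<lambda>_. P"])
      with n 0 show False by auto
    next
      case (Suc c')
      have "x \<le> enat c'" if "x \<in> S" for x
      proof -
        from that obtain n where x: "x = enat n" unfolding S_def by blast
        with that n have "\<not> c \<le> n" by blast
        then show ?thesis using x Suc by simp
      qed
      then have "Sup S \<le> enat c'" by (rule Sup_least)
      with le Suc show False by (metis enat_ord_simps(1) Suc_n_not_le_n order_trans)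
    qed
  qed
  then obtain n C where n: "c \<le> n" and C: "\<forall>i\<le>n. prime_id (C i)" "\<forall>i<n. C i \<subset> C (Suc i)" "C n = P"
    unfolding S_def primeideal_class_iff by blast
  \<comment> \<open>The index shift drops the n - c lowest primes and keeps the top one.\<close>
  show ?thesis
    by (rule exI[of _ "\<lambda>i. C (i + (n - c))"]) (use n C in auto)
qed

theorem corollary4p4:
  fixes p :: nat
    and f :: "'s::{finite,linorder} \<Rightarrow> ('v::{finite,linorder}, 'k::field) mpoly"
    and R :: "('v, 'k) mpoly ring"
    and I :: "('v, 'k) mpoly set"
    and J :: "('c::{finite,linorder} \<times> 's, ('v, 'k) mpoly) mpoly set"
  assumes char: "CHAR('k) = p" "p > 0"
    and perfect: "perfect_field TYPE('k)"
    and R: "R = cring_class_ops"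
    and I: "I = Idl\<^bsub>R\<^esub> (range f)"
    and nonzero: "I \<noteq> {\<zero>\<^bsub>R\<^esub>}"
    and proper: "I \<noteq> carrier R"
    and unmixed: "equidimensional_unmixed R I"
    and ht: "height R I = enat CARD('c)"
    and J: "J = generic_link f"
  shows "(\<forall>r K. reduction R K I \<and> generated_by_elements R K r \<longrightarrow>
            fpt p J \<ge> ereal (real CARD('c) / real r) * fpt p I) \<and>
         ((\<exists>K. reduction R K I \<and> generated_by_elements R K CARD('c)) \<longrightarrow> fpt p J \<ge> fpt p I) \<and>
         (complete_intersection R I \<longrightarrow> fpt p J \<ge> fpt p I) \<and>
         fpt p J \<ge> ereal (real CARD('c) / real CARD('v)) * fpt p I"
proof -
  have p: "prime CHAR('k)" using prime_CHAR_semidom[where ?'a = 'k] char by simp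
  have If: "I = idl.span (range f)" unfolding I R by (rule genideal_class)
  have sI: "idl.subspace I" unfolding If by simp
  have proper': "1 \<notin> I"
  proof
    assume "1 \<in> I"
    then have "x \<in> I" for x using idl.subspace_scale[OF sI, of 1 x] by simp
    then show False using proper by (auto simp: R cring_class_ops_def)
  qed
  obtain P0 where P0: "prime_id P0" "I \<subseteq> P0"
    using prime_id_subset_maximal[OF sI proper'] maximalideal_class_prime by blast
  note chain = height_chain[OF ht[unfolded R]]
  have J': "idl.subspace J" "range (generic_combination f) \<subseteq> J"
    unfolding J by (rule generic_link_ideal)+
  have bound: "fpt p J \<ge> ereal (real CARD('c) / real \<rho>) * fpt p I"
    if "spreads CHAR('k) \<rho> f" "CARD('c) \<le> \<rho>" for \<rho>
    using link_fpt_ge[OF p perfect J' proper'[unfolded If] that] unfolding If char(1) .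
  have red: "fpt p J \<ge> ereal (real CARD('c) / real r) * fpt p I"
    if K: "reduction R K I" "generated_by_elements R K r" for r K
  proof -
    from K(2) obtain hs where hs: "length hs = r" "K = idl.span (set hs)"
      unfolding generated_by_elements_def R genideal_class by blast
    from K(1) obtain m where m: "K \<subseteq> I" "K \<cdot>\<^bsub>R\<^esub> ideal_power R I m = ideal_power R I (Suc m)"
      unfolding reduction_def by blast
    have eq: "idl.span {a * b | a b. a \<in> K \<and> b \<in> idl.span (mons I m)} = idl.span (mons I (Suc m))"
      using m(2) unfolding R ideal_power_class[OF sI] hs(2)
      by (simp only: ideal_prod_class[OF idl.subspace_span idl.subspace_span])
    have hsI: "set hs \<subseteq> I" using m(1) idl.span_superset[of "set hs"] unfolding hs(2) by blast
    have "spreads CHAR('k) (length hs) f"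
      by (rule spreads_reduction[OF p _ hsI[unfolded If] eq[unfolded hs(2) If]]) (rule CHAR_poly_mapping)
    moreover have "CARD('c) \<le> length hs"
    proof (rule krull_height_le_generators[OF p perfect P0(1)])
      show "set hs \<subseteq> P0" using hsI P0(2) by blast
      fix P assume P: "prime_id P" "set hs \<subseteq> P"
      have sP: "idl.subspace P" using P(1) by (simp add: prime_id_def)
      have "K \<subseteq> P" unfolding hs(2) by (rule idl.span_minimal[OF P(2) sP])
      then have "{a * b | a b. a \<in> K \<and> b \<in> idl.span (mons I m)} \<subseteq> P"
        using subspace_mult_right[OF sP] by blast
      then have sub: "idl.span (mons I (Suc m)) \<subseteq> P" unfolding eq[symmetric] by (rule idl.span_minimal[OF _ sP])
      \<comment> \<open>A prime over \<open>K\<close> contains I^(m+1) = K I^m and hence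
        \<open>I\<close>, so the height of \<open>I\<close> applies to it.\<close>
      have "I \<subseteq> P"
      proof
        fix a assume "a \<in> I"
        then have "a ^ Suc m \<in> P" using sub idl.span_base[OF mons_power] by blast
        then show "a \<in> P" using prime_id_power[OF P(1)] by blast
      qed
      from chain[OF P(1) this]
      show "\<exists>C. (\<forall>i\<le>CARD('c). prime_id (C i)) \<and> (\<forall>i<CARD('c). C i \<subset> C (Suc i)) \<and> C CARD('c) = P" .
    qed
    ultimately show ?thesis using bound unfolding hs(1) by blast
  qed
  have one: "ereal (real CARD('c) / real CARD('c)) * x = x" for x by (simp flip: one_ereal_def)
  have red_c: "fpt p J \<ge> fpt p I" if "reduction R K I" "generated_by_elements R K CARD('c)" for K
    using red[OF that] unfolding one .
  have ci: "fpt p J \<ge> fpt p I" if "complete_intersection R I"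
  proof -
    from that ht have gen: "generated_by_elements R I CARD('c)" by (auto simp: complete_intersection_def)
    \<comment> \<open>Every ideal is a reduction of itself with m = 0.\<close>
    have "idl.span {a * b | a b. a \<in> I \<and> b \<in> idl.span (mons I 0)} = idl.span (mons I (Suc 0))"
    proof (intro subset_antisym idl.span_minimal idl.subspace_span)
      have "a * b \<in> idl.span (mons I (Suc 0))" if "a \<in> I" for a b
        using subspace_mult_right[OF idl.subspace_span idl.span_base[of a "mons I (Suc 0)"]] that by auto
      then show "{a * b | a b. a \<in> I \<and> b \<in> idl.span (mons I 0)} \<subseteq> idl.span (mons I (Suc 0))" by blast
      have "1 \<in> idl.span (mons I 0)" by (simp add: idl.span_base)
      then have "x * 1 \<in> idl.span {a * b | a b. a \<in> I \<and> b \<in> idl.span (mons I 0)}" if "x \<in> I" for x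
        using that by (intro idl.span_base) blast
      then show "mons I (Suc 0) \<subseteq> idl.span {a * b | a b. a \<in> I \<and> b \<in> idl.span (mons I 0)}"
        by auto
    qed
    then have eq: "I \<cdot>\<^bsub>R\<^esub> ideal_power R I 0 = ideal_power R I (Suc 0)"
      unfolding R ideal_power_class[OF sI] ideal_prod_class[OF sI idl.subspace_span] .
    have "ideal I R" unfolding R ideal_class_iff by (rule sI)
    with eq have "reduction R I I" unfolding reduction_def by blast
    from red_c[OF this gen] show ?thesis .
  qed
  have dim: "fpt p J \<ge> ereal (real CARD('c) / real CARD('v)) * fpt p I"
  proof (rule bound)
    \<comment> \<open>A nonzero generator plays the part of \<open>y\<close> in the
      elimination.\<close>
    have "\<exists>j. f j \<noteq> 0"
    proof (rule ccontr)
      assume "\<not> ?thesis"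
      then have "range f = {0}" by auto
      then show False using nonzero unfolding If R zero_class by simp
    qed
    then show "spreads CHAR('k) CARD('v) f" using spreads_dimension[OF p refl] by blast
    from chain[OF P0] show "CARD('c) \<le> CARD('v)" using chain_length_le_dim by metis
  qed
  show ?thesis using red red_c ci dim by blast
qed

end
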